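(* For all $n\geq 2$ and all primes $p$ the following local functional equation holds: $$\zeta_{G_n,p}^{\leq}(s)\big|_{p\rightarrow p^{-1}}=-p^{\binom{2n-1}{2}-(2n-1)s}\,\zeta_{G_n,p}^{\leq}(s).$$
   Context: For $n\geq 2$, $G_n$ is the nilpotent group of class $2$ $$G_n := \langle x_1,\dots,x_{n},y_1,\dots,y_{n-1}\mid [x_i,x_n]=y_i,\ 1\leq i\leq n-1,\ \text{all other } [\,,] \text{ trivial}\rangle,$$ i.e. all other commutators of pairs of the generators $x_1,\dots,x_n,y_1,\dots,y_{n-1}$ are trivial. For a prime $p$, the local subgroup zeta function is the Dirichlet series $$\zeta_{G_n,p}^{\leq}(s):=\sum_{H\leq_p G_n}|G_n:H|^{-s},$$ where the sum runs over all subgroups $H$ of $G_n$ of finite $p$-power index (including $H=G_n$). For fixed $n$ there is a unique rational function $R_n(U,V)\in\mathbb{Q}(U,V)$, independent of $p$, such that $\zeta_{G_n,p}^{\leq}(s)=R_n(p,p^{-s})$ for all primes $p$. The notation $|_{p\rightarrow p^{-1}}$ means the formal substitution $p\mapsto p^{-1}$, $p^{-s}\mapsto p^{s}$ in this rational function, i.e. $\zeta_{G_n,p}^{\leq}(s)|_{p\rightarrow p^{-1}}:=R_n(p^{-1},p^{s})$, and the functional equation is an identity of rational functions in $p$ and $p^{-s}$. *)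

theory Defs
  imports
    "HOL-Analysis.Analysis"
    "HOL-Algebra.Coset"
    "HOL-Computational_Algebra.Polynomial"
    "HOL-Computational_Algebra.Fraction_Field"
    "HOL-Computational_Algebra.Primes"
begin

section \<open>Groups given by generators and relators\<close>

text \<open>
  A word over the alphabet \<open>S\<close> is a list of letters \<open>(a, e)\<close>, where \<open>(a, True)\<close> stands for
  the generator \<open>a\<close> and \<open>(a, False)\<close> for its formal inverse.
\<close>

type_synonym 'g word = "('g \<times> bool) list"

definition words :: "'g set \<Rightarrow> 'g word set" where
  "words S = lists (S \<times> UNIV)"

inductive_set pres_rel :: "'g set \<Rightarrow> 'g word set \<Rightarrow> ('g word \<times> 'g word) set"
  for S :: "'g set" and R :: "'g word set" where
  refl: "w \<in> words S \<Longrightarrow> (w, w) \<in> pres_rel S R"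
| sym: "(v, w) \<in> pres_rel S R \<Longrightarrow> (w, v) \<in> pres_rel S R"
| trans: "(u, v) \<in> pres_rel S R \<Longrightarrow> (v, w) \<in> pres_rel S R \<Longrightarrow> (u, w) \<in> pres_rel S R"
| cancel: "u \<in> words S \<Longrightarrow> v \<in> words S \<Longrightarrow> a \<in> S \<Longrightarrow>
    (u @ [(a, e), (a, \<not> e)] @ v, u @ v) \<in> pres_rel S R"
| relator: "u \<in> words S \<Longrightarrow> v \<in> words S \<Longrightarrow> r \<in> R \<Longrightarrow> r \<in> words S \<Longrightarrow>
    (u @ r @ v, u @ v) \<in> pres_rel S R"

definition presented_group :: "'g set \<Rightarrow> 'g word set \<Rightarrow> 'g word set monoid" where
  "presented_group S R =
     \<lparr>carrier = words S // pres_rel S R,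
      mult = (\<lambda>A B. \<Union>u\<in>A. \<Union>v\<in>B. pres_rel S R `` {u @ v}),
      one = pres_rel S R `` {[]}\<rparr>"

lemma words_append [simp]: "u @ v \<in> words S \<longleftrightarrow> u \<in> words S \<and> v \<in> words S"
  by (auto simp: words_def)

lemma words_Nil [simp]: "[] \<in> words S"
  by (auto simp: words_def)

lemma pres_rel_words: "(u, v) \<in> pres_rel S R \<Longrightarrow> u \<in> words S \<and> v \<in> words S"
  by (induction rule: pres_rel.induct) (auto simp: words_def)

lemma equiv_pres_rel: "equiv (words S) (pres_rel S R)"
proof (rule equivI)
  show "pres_rel S R \<subseteq> words S \<times> words S"
    using pres_rel_words by fast
  show "refl_on (words S) (pres_rel S R)"
    by (rule refl_onI) (rule pres_rel.refl)
  show "sym (pres_rel S R)"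
    by (rule symI) (rule pres_rel.sym)
  show "trans (pres_rel S R)"
    by (rule transI) (rule pres_rel.trans)
qed

lemma pres_rel_context:
  assumes "(u, v) \<in> pres_rel S R" "a \<in> words S" "b \<in> words S"
  shows "(a @ u @ b, a @ v @ b) \<in> pres_rel S R"
  using assms
proof (induction rule: pres_rel.induct)
  case (refl w)
  then show ?case by (simp add: pres_rel.refl)
next
  case (sym v w)
  then show ?case using pres_rel.sym by blast
next
  case (trans u v w)
  then show ?case using pres_rel.trans by blast
next
  case (cancel u v c e)
  then show ?case using pres_rel.cancel[of "a @ u" S "v @ b" c e R] by simp
next
  case (relator u v r)
  then show ?case using pres_rel.relator[of "a @ u" S "v @ b" r R] by simp
qed

lemma pres_rel_append:
  assumes "(u, u') \<in> pres_rel S R" "(v, v') \<in> pres_rel S R"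
  shows "(u @ v, u' @ v') \<in> pres_rel S R"
proof (rule pres_rel.trans)
  show "(u @ v, u' @ v) \<in> pres_rel S R"
    using pres_rel_context[OF assms(1), of "[]" v] pres_rel_words[OF assms(2)] by simp
  show "(u' @ v, u' @ v') \<in> pres_rel S R"
    using pres_rel_context[OF assms(2), of u' "[]"] pres_rel_words[OF assms(1)] by simp
qed

lemma presented_group_mult:
  assumes "u \<in> words S" "v \<in> words S"
  shows "pres_rel S R `` {u} \<otimes>\<^bsub>presented_group S R\<^esub> pres_rel S R `` {v} = pres_rel S R `` {u @ v}"
proof -
  let ?r = "pres_rel S R"
  have *: "?r `` {u' @ v'} = ?r `` {u @ v}" if "u' \<in> ?r `` {u}" "v' \<in> ?r `` {v}" for u' v'
  proof -
    have "(u @ v, u' @ v') \<in> ?r" using that by (intro pres_rel_append) simp_all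
    then show ?thesis by (rule equiv_class_eq[OF equiv_pres_rel, symmetric])
  qed
  have "(\<Union>u'\<in>?r `` {u}. \<Union>v'\<in>?r `` {v}. ?r `` {u' @ v'}) =
      (\<Union>u'\<in>?r `` {u}. \<Union>v'\<in>?r `` {v}. ?r `` {u @ v})"
    by (intro SUP_cong HOL.refl *)
  also have "u \<in> ?r `` {u}" "v \<in> ?r `` {v}"
    using assms by (simp_all add: pres_rel.refl)
  then have "(\<Union>u'\<in>?r `` {u}. \<Union>v'\<in>?r `` {v}. ?r `` {u @ v}) = ?r `` {u @ v}"
    by blast
  finally show ?thesis by (simp add: presented_group_def)
qed

lemma pres_rel_inverse:
  "w \<in> words S \<Longrightarrow> (rev (map (\<lambda>(a, e). (a, \<not> e)) w) @ w, []) \<in> pres_rel S R"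
proof (induction w)
  case Nil
  show ?case by (simp add: pres_rel.refl)
next
  case (Cons l w)
  obtain a e where l: "l = (a, e)" by (cases l)
  let ?i = "rev (map (\<lambda>(a, e). (a, \<not> e)) w)"
  have a: "a \<in> S" and w: "w \<in> words S" using Cons.prems l by (auto simp: words_def)
  then have "?i \<in> words S" by (force simp: words_def)
  then have "(?i @ [(a, \<not> e), (a, \<not> \<not> e)] @ w, ?i @ w) \<in> pres_rel S R"
    using a w by (intro pres_rel.cancel)
  from pres_rel.trans[OF this Cons.IH[OF w]] show ?case by (simp add: l)
qed

lemma group_presented_group: "group (presented_group S R)"
proof (rule groupI)
  let ?G = "presented_group S R" and ?c = "\<lambda>w. pres_rel S R `` {w}"
  have car: "x \<in> carrier ?G \<longleftrightarrow> (\<exists>w\<in>words S. x = ?c w)" for x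
    by (auto simp: presented_group_def quotient_def)
  have one: "\<one>\<^bsub>?G\<^esub> = ?c []" by (simp add: presented_group_def)
  show "\<one>\<^bsub>?G\<^esub> \<in> carrier ?G" unfolding car one by (rule bexI[of _ "[]"]) auto
  fix x assume "x \<in> carrier ?G"
  then obtain u where u: "u \<in> words S" "x = ?c u" using car by blast
  show "\<one>\<^bsub>?G\<^esub> \<otimes>\<^bsub>?G\<^esub> x = x" using u one by (simp add: presented_group_mult)
  let ?i = "rev (map (\<lambda>(a, e). (a, \<not> e)) u)"
  have i: "?i \<in> words S" using u(1) by (force simp: words_def)
  have "?c (?i @ u) = ?c []"
    using pres_rel_inverse[OF u(1)] equiv_class_eq[OF equiv_pres_rel] by fast
  then have "?c ?i \<otimes>\<^bsub>?G\<^esub> x = \<one>\<^bsub>?G\<^esub>" using u i one by (simp add: presented_group_mult)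
  then show "\<exists>y\<in>carrier ?G. y \<otimes>\<^bsub>?G\<^esub> x = \<one>\<^bsub>?G\<^esub>" using car i by blast
  fix y assume "y \<in> carrier ?G"
  then obtain v where v: "v \<in> words S" "y = ?c v" using car by blast
  show "x \<otimes>\<^bsub>?G\<^esub> y \<in> carrier ?G"
    unfolding car by (rule bexI[of _ "u @ v"]) (use u v in \<open>simp_all add: presented_group_mult\<close>)
  fix z assume "z \<in> carrier ?G"
  then obtain w where w: "w \<in> words S" "z = ?c w" using car by blast
  show "x \<otimes>\<^bsub>?G\<^esub> y \<otimes>\<^bsub>?G\<^esub> z = x \<otimes>\<^bsub>?G\<^esub> (y \<otimes>\<^bsub>?G\<^esub> z)"
    using u v w by (simp add: presented_group_mult)
qed


section \<open>The groups $G_n$\<close>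

datatype gen = X nat | Y nat

definition commutator_word :: "'g \<Rightarrow> 'g \<Rightarrow> 'g word" where
  "commutator_word a b = [(a, False), (b, False), (a, True), (b, True)]"

definition G_gens :: "nat \<Rightarrow> gen set" where
  "G_gens n = X ` {1..n} \<union> Y ` {1..n - 1}"

definition G_relators :: "nat \<Rightarrow> gen word set" where
  "G_relators n =
     {commutator_word (X i) (X n) @ [(Y i, False)] | i. i \<in> {1..n - 1}} \<union>
     {commutator_word a b | a b. a \<in> G_gens n \<and> b \<in> G_gens n \<and>
        (\<forall>i\<in>{1..n - 1}. {a, b} \<noteq> {X i, X n})}"

definition G :: "nat \<Rightarrow> gen word set monoid" where
  "G n = presented_group (G_gens n) (G_relators n)"


section \<open>Local subgroup zeta functions\<close>

text \<open>
  The cardinality of an infinite set is \<open>0\<close>, hence for a prime \<open>p\<close> the condition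
  \<open>group_index \<Gamma> H = p ^ k\<close> entails that the index is finite.
\<close>

definition group_index :: "('a, 'b) monoid_scheme \<Rightarrow> 'a set \<Rightarrow> nat" where
  "group_index \<Gamma> H = card (rcosets\<^bsub>\<Gamma>\<^esub> H)"

definition p_index_subgroups :: "('a, 'b) monoid_scheme \<Rightarrow> nat \<Rightarrow> 'a set set" where
  "p_index_subgroups \<Gamma> p = {H. subgroup H \<Gamma> \<and> (\<exists>k. group_index \<Gamma> H = p ^ k)}"

definition zeta_term :: "('a, 'b) monoid_scheme \<Rightarrow> complex \<Rightarrow> 'a set \<Rightarrow> complex" where
  "zeta_term \<Gamma> s H = of_nat (group_index \<Gamma> H) powr (- s)"

definition local_zeta :: "('a, 'b) monoid_scheme \<Rightarrow> nat \<Rightarrow> complex \<Rightarrow> complex" where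
  "local_zeta \<Gamma> p s = (\<Sum>\<^sub>\<infinity>H\<in>p_index_subgroups \<Gamma> p. zeta_term \<Gamma> s H)"


section \<open>Rational functions in two variables over the rationals\<close>

text \<open>
  The field $\mathbb{Q}(U,V)$ is the fraction field of $\mathbb{Q}[U][V]$: in \<open>rat poly poly\<close>
  the inner variable is \<open>U\<close> and the outer one is \<open>V\<close>.
\<close>

type_synonym ratfun = "rat poly poly fract"

definition ratU :: ratfun where "ratU = Fract [:[:0, 1:]:] 1"

definition ratV :: ratfun where "ratV = Fract [:0, 1:] 1"

instance fract :: ("{idom, ring_char_0}") field_char_0
proof
  have "of_nat m = Fract (of_nat m :: 'a) 1" for m
    by (simp add: of_nat_fract)
  then show "inj (of_nat :: nat \<Rightarrow> 'a fract)"
    by (auto simp: inj_def eq_fract)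
qed

definition bipoly_eval :: "rat poly poly \<Rightarrow> 'k \<Rightarrow> 'k \<Rightarrow> 'k :: field_char_0" where
  "bipoly_eval P u v = poly (map_poly (\<lambda>q. poly (map_poly of_rat q) u) P) v"

definition ratfun_regular :: "ratfun \<Rightarrow> 'k :: field_char_0 \<Rightarrow> 'k \<Rightarrow> bool" where
  "ratfun_regular R u v \<longleftrightarrow> (\<exists>A B. R = Fract A B \<and> bipoly_eval B u v \<noteq> 0)"

text \<open>
  The value \<open>R(u, v)\<close> in an arbitrary field of characteristic zero, meaningful if \<open>R\<close> is regular
  at \<open>(u, v)\<close>. Taking the field to be \<open>ratfun\<close> itself gives formal substitution.
\<close>

definition ratfun_eval :: "ratfun \<Rightarrow> 'k \<Rightarrow> 'k \<Rightarrow> 'k :: field_char_0" where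
  "ratfun_eval R u v =
     (THE w. \<exists>A B. R = Fract A B \<and> bipoly_eval B u v \<noteq> 0 \<and>
        w = bipoly_eval A u v / bipoly_eval B u v)"

lemma map_poly_hom_add:
  fixes h :: "'a :: comm_ring_1 \<Rightarrow> 'b :: comm_ring_1"
  assumes "h 0 = 0" "\<And>x y. h (x + y) = h x + h y"
  shows "map_poly h (p + q) = map_poly h p + map_poly h q"
  by (rule poly_eqI) (simp add: coeff_map_poly assms)

lemma map_poly_hom_mult:
  fixes h :: "'a :: comm_ring_1 \<Rightarrow> 'b :: comm_ring_1"
  assumes "h 0 = 0" "\<And>x y. h (x + y) = h x + h y" "\<And>x y. h (x * y) = h x * h y"
  shows "map_poly h (p * q) = map_poly h p * map_poly h q"
proof (rule poly_eqI)
  fix k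
  have "h (sum f A) = (\<Sum>i\<in>A. h (f i))" for f and A :: "nat set"
    by (induction A rule: infinite_finite_induct) (auto simp: assms)
  then show "coeff (map_poly h (p * q)) k = coeff (map_poly h p * map_poly h q) k"
    by (simp add: coeff_map_poly assms coeff_mult)
qed

lemma bipoly_eval_mult: "bipoly_eval (P * Q) u v = bipoly_eval P u v * bipoly_eval Q u v"
  unfolding bipoly_eval_def
  by (subst map_poly_hom_mult)
    (simp_all add: map_poly_hom_add map_poly_hom_mult of_rat_add of_rat_mult)

lemma bipoly_eval_0 [simp]: "bipoly_eval 0 u v = 0"
  by (simp add: bipoly_eval_def)

lemma ratfun_eval_Fract:
  assumes "bipoly_eval B u v \<noteq> 0"
  shows "ratfun_eval (Fract A B) u v = bipoly_eval A u v / bipoly_eval B u v"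
  unfolding ratfun_eval_def
proof (rule the_equality)
  fix w
  assume "\<exists>A' B'. Fract A B = Fract A' B' \<and> bipoly_eval B' u v \<noteq> 0 \<and>
    w = bipoly_eval A' u v / bipoly_eval B' u v"
  then obtain A' B' where *: "Fract A B = Fract A' B'" "bipoly_eval B' u v \<noteq> 0"
    "w = bipoly_eval A' u v / bipoly_eval B' u v" by blast
  then have "B \<noteq> 0" "B' \<noteq> 0" using assms by auto
  then have "bipoly_eval (A * B') u v = bipoly_eval (A' * B) u v" using * by (simp add: eq_fract)
  then show "w = bipoly_eval A u v / bipoly_eval B u v"
    using * assms by (simp add: bipoly_eval_mult frac_eq_eq)
qed (use assms in blast)


section \<open>The rational function describing all local zeta functions\<close>

definition is_zeta_ratfun :: "('a, 'b) monoid_scheme \<Rightarrow> ratfun \<Rightarrow> bool" where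
  "is_zeta_ratfun \<Gamma> R \<longleftrightarrow>
     (\<forall>p. prime p \<longrightarrow> (\<exists>\<sigma>::real. \<forall>s. Re s > \<sigma> \<longrightarrow>
        zeta_term \<Gamma> s summable_on p_index_subgroups \<Gamma> p \<and>
        ratfun_regular R (of_nat p) (of_nat p powr (- s)) \<and>
        local_zeta \<Gamma> p s = ratfun_eval R (of_nat p) (of_nat p powr (- s))))"

definition zeta_ratfun :: "('a, 'b) monoid_scheme \<Rightarrow> ratfun" where
  "zeta_ratfun \<Gamma> = (THE R. is_zeta_ratfun \<Gamma> R)"

end

theory Submission
  imports Defs
    "HOL-Algebra.Multiplicative_Group"
    "HOL-Library.Function_Algebras"
begin

text \<open>
  Put \<open>d = n - 1\<close> and \<open>T = p\<^bsup>-s\<^esup>\<close>. In the model of $G_n$ on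
  $\mathbb{Z}^d \times \mathbb{Z} \times \mathbb{Z}^d$ a subgroup of finite index is given by its image
  $p^k\mathbb{Z}$ in the middle factor, two lattices \<open>K\<close>, \<open>L\<close> in $\mathbb{Z}^d$ with
  $p^k K \subseteq L$, and $|\mathbb{Z}^d:K|\,|\mathbb{Z}^d:L|^{d+1}$ many choices of gluing data, so that
  $\zeta(s) = \sum_k T^k \sum_{p^k K \subseteq L} (pT)^{[K]} (p^{d+1}T)^{[L]}$ where \<open>[K]\<close> is the exponent of the index.

  For a lattice \<open>L\<close> let \<open>r\<close> be the codimension of its image modulo \<open>p\<close>, and let \<open>M = {v. p v \<in> L}\<close>, so that
  $[L] = [M] + r$. The number of \<open>L\<close> of codimension \<open>r\<close> lying over a given \<open>M\<close> of codimension \<open>i\<close> is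
  $A_{ri} = \binom{d-i}{d-r}_p p^{i(d-r)}$, as such \<open>L\<close> are subspaces of \<open>M / p M\<close> meeting a fixed subspace
  trivially. Hence the zeta function is obtained by solving two triangular linear systems with matrix \<open>A\<close>
  over $\mathbb{Q}(p,T)$.

  The functional equation comes from inversion of Gaussian binomials: if $\bar A$ is \<open>A\<close> with \<open>p\<close> replaced by
  $p^{-1}$ and \<open>D\<close> is the diagonal matrix with entries $(-1)^r p^{\binom r2}$, then $\bar A D A = D$, which turns
  the linear systems at $(p^{-1},T^{-1})$ into the ones at \<open>(p, T)\<close>.
\<close>

section \<open>Gaussian binomials and the functional equation\<close>

text \<open>The double sum over \<open>K\<close> and \<open>L\<close> becomes linear for two
  reasons. First, p^k K \<subseteq> L says that K lies in M_k = {v. p^k v \<in> L}, which is again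
  free of rank d; so the sum over K is (pT)^[M_k] times a factor depending on neither k nor L, and
  the zeta function is a product. Second, M_{k+1} of L is M_k of M, so raising k by one costs a
  factor T and otherwise affects only [L]. The number of L over M depends on M through its
  codimension alone, hence the unknowns are indexed by codimension.

  The weights come from two counts. There are |Z^d : L|^d homomorphisms from K to Z^d / L, and
  lifting a generator of p^k Z leaves |Z^d : K| |Z^d : L| choices; hence the exponents 1 and d + 1
  of p.

  No closed formula is needed: the solution of the systems is one expression over an arbitrary
  field. In the complex numbers it sums the Dirichlet series, in Q(U, V) it is the rational
  function, and the formal substitution is its evaluation at another pair of elements of Q(U,
  V).\<close>

fun qbinom :: "'a::comm_semiring_1 \<Rightarrow> nat \<Rightarrow> nat \<Rightarrow> 'a" where
  "qbinom q n 0 = 1"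
| "qbinom q 0 (Suc k) = 0"
| "qbinom q (Suc n) (Suc k) = qbinom q n (Suc k) + q ^ (n - k) * qbinom q n k"

lemma qbinom_eq_0: "n < k \<Longrightarrow> qbinom q n k = 0"
proof (induction n arbitrary: k)
  case (Suc n) then show ?case by (cases k) auto
qed (auto elim: lessE)

lemma qbinom_self [simp]: "qbinom q n n = 1"
  by (induction n) (auto simp: qbinom_eq_0)

text \<open>The second q-Pascal rule. The defining one is what splitting subspaces by a hyperplane
  produces; this one makes the alternating sum below telescope.\<close>

lemma qbinom_Suc_Suc: "k \<le> n \<Longrightarrow> qbinom q (Suc n) (Suc k) = q ^ Suc k * qbinom q n (Suc k) + qbinom q n k"
proof (induction n arbitrary: k)
  case (Suc n)
  show ?case
  proof (cases k)
    case 0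
    have "qbinom q (Suc (Suc n)) 1 = qbinom q (Suc n) 1 + q ^ Suc n" by simp
    also have "qbinom q (Suc n) 1 = q * qbinom q n 1 + 1"
      using Suc.IH[of 0] by (simp del: qbinom.simps(3))
    also have "\<dots> + q ^ Suc n = q * (qbinom q n 1 + q ^ n) + 1" by (simp add: algebra_simps)
    also have "qbinom q n 1 + q ^ n = qbinom q (Suc n) 1" by simp
    finally show ?thesis using 0 by (simp del: qbinom.simps(3))
  next
    case (Suc j)
    show ?thesis
    proof (cases "k = Suc n")
      case True then show ?thesis by (simp add: qbinom_eq_0)
    next
      case False
      then have *: "j < n" using Suc Suc.prems by auto
      have a: "qbinom q (Suc n) (Suc k) = q ^ Suc k * qbinom q n (Suc k) + qbinom q n k"
        using Suc.IH[of k] * Suc by simp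
      have b: "qbinom q (Suc n) k = q ^ k * qbinom q n k + qbinom q n j"
        using Suc.IH[of j] * Suc by simp
      have c: "q ^ (n - j) = q ^ (n - Suc j) * q" using * by (metis Suc_diff_Suc power_Suc2)
      have "qbinom q (Suc (Suc n)) (Suc k) = qbinom q (Suc n) (Suc k) + q ^ (n - j) * qbinom q (Suc n) k"
        using Suc by simp
      also have "\<dots> = q ^ Suc k * (qbinom q n (Suc k) + q ^ (n - Suc j) * qbinom q n k) + (qbinom q n k + q ^ (n - j) * qbinom q n j)"
        unfolding a b c by (simp add: algebra_simps)
      also have "\<dots> = q ^ Suc k * qbinom q (Suc n) (Suc k) + qbinom q (Suc n) k"
        using Suc by simp
      finally show ?thesis .
    qed
  qed
qed simp

text \<open>A Gaussian binomial is a palindromic polynomial of degree k (n - k) in q: inverting q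
  exchanges the two Pascal rules.\<close>

lemma qbinom_inverse:
  fixes q :: "'a::field"
  assumes "q \<noteq> 0"
  shows "k \<le> n \<Longrightarrow> qbinom q n k = q ^ (k * (n - k)) * qbinom (inverse q) n k"
proof (induction n arbitrary: k)
  case (Suc n)
  show ?case
  proof (cases k)
    case (Suc j)
    show ?thesis
    proof (cases "j = n")
      case False
      then have j: "j < n" using Suc Suc.prems by simp
      have 1: "qbinom q n (Suc j) = q ^ (Suc j * (n - Suc j)) * qbinom (inverse q) n (Suc j)"
        using Suc.IH j by simp
      have 2: "qbinom q n j = q ^ (j * (n - j)) * qbinom (inverse q) n j"
        using Suc.IH j by simp
      have n: "n - j = Suc (n - Suc j)" using j by simp
      have "qbinom q (Suc n) k = q ^ Suc j * qbinom q n (Suc j) + qbinom q n j"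
        unfolding Suc using j by (simp only: qbinom_Suc_Suc)
      also have "\<dots> = q ^ (k * (Suc n - k)) * (qbinom (inverse q) n (Suc j) + inverse q ^ (n - j) * qbinom (inverse q) n j)"
      proof -
        have "q ^ (k * (Suc n - k)) * inverse q ^ (n - j) = q ^ (j * (n - j))"
          using assms unfolding Suc by (simp add: power_add power_inverse)
        moreover have "q ^ (k * (Suc n - k)) = q ^ Suc j * q ^ (Suc j * (n - Suc j))"
          unfolding Suc power_add[symmetric] by (simp add: n)
        ultimately show ?thesis unfolding 1 2 by (simp only: distrib_left mult.assoc[symmetric])
      qed
      finally show ?thesis using Suc by simp
    qed (simp add: Suc)
  qed simp
qed auto

lemma triangle_Suc: "(Suc j choose 2) = j + (j choose 2)"
  by (simp add: numeral_2_eq_2)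

text \<open>This is the q-binomial theorem for the product of the 1 - q^i x with i < n, taken at x =
  1, where the factor for i = 0 vanishes. By the second Pascal rule the summands are differences of
  consecutive values of \<open>?t\<close>.\<close>

lemma qbinom_alternating_sum:
  fixes q :: "'a::comm_ring_1"
  shows "(\<Sum>j\<le>n. (-1) ^ j * q ^ (j choose 2) * qbinom q n j) = (if n = 0 then 1 else 0)"
proof (cases n)
  case (Suc m)
  let ?t = "\<lambda>j. (-1) ^ j * q ^ (j choose 2) * qbinom q m j * q ^ j"
  have s: "(-1) ^ Suc j * q ^ (Suc j choose 2) * qbinom q (Suc m) (Suc j) = ?t (Suc j) - ?t j"
    if "j \<le> m" for j
  proof -
    have "(-1) ^ Suc j * q ^ (Suc j choose 2) * (q ^ Suc j * qbinom q m (Suc j) + qbinom q m j)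
        = ?t (Suc j) - ?t j"
      unfolding triangle_Suc by (simp add: algebra_simps power_add)
    then show ?thesis using qbinom_Suc_Suc[OF that, of q] by simp
  qed
  have "(\<Sum>j\<le>Suc m. (-1) ^ j * q ^ (j choose 2) * qbinom q (Suc m) j) =
     1 + (\<Sum>j\<le>m. ?t (Suc j) - ?t j)"
    unfolding sum.atMost_Suc_shift using s by (simp del: qbinom.simps(3) add: binomial_eq_0)
  also have "(\<Sum>j\<le>m. ?t (Suc j) - ?t j) = ?t (Suc m) - ?t 0"
    unfolding lessThan_Suc_atMost[symmetric] by (rule sum_lessThan_telescope)
  finally show ?thesis using Suc by (simp add: qbinom_eq_0 binomial_eq_0)
qed (simp add: binomial_eq_0)

text \<open>The q-Pochhammer symbol (q; q)_n: the q-factorial before division by (1 - q)^n, so that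
  it makes sense in any commutative ring.\<close>

fun qfact :: "'a::comm_ring_1 \<Rightarrow> nat \<Rightarrow> 'a" where
  "qfact q 0 = 1"
| "qfact q (Suc n) = (1 - q ^ Suc n) * qfact q n"

lemma qbinom_qfact:
  fixes q :: "'a::comm_ring_1"
  shows "k \<le> n \<Longrightarrow> qbinom q n k * (qfact q k * qfact q (n - k)) = qfact q n"
proof (induction n arbitrary: k)
  case (Suc n)
  show ?case
  proof (cases k)
    case (Suc j)
    show ?thesis
    proof (cases "j = n")
      case False
      then have j: "j < n" using Suc Suc.prems by simp
      obtain m where m: "n = j + Suc m" using j less_iff_Suc_add by fastforce
      have 1: "qbinom q n (Suc j) * (qfact q (Suc j) * qfact q (n - Suc j)) = qfact q n"
        using Suc.IH[of "Suc j"] j by simp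
      have 2: "qbinom q n j * (qfact q j * qfact q (n - j)) = qfact q n"
        using Suc.IH[of j] j by simp
      have "qbinom q (Suc n) k * (qfact q k * qfact q (Suc n - k)) =
         (1 - q ^ (n - j)) * (qbinom q n (Suc j) * (qfact q (Suc j) * qfact q (n - Suc j)))
         + q ^ (n - j) * (1 - q ^ Suc j) * (qbinom q n j * (qfact q j * qfact q (n - j)))"
        unfolding Suc diff_Suc_Suc m by (simp add: algebra_simps)
      also have "\<dots> = (1 - q ^ (n - j) * q ^ Suc j) * qfact q n"
        unfolding 1 2 by (simp add: algebra_simps)
      also have "q ^ (n - j) * q ^ Suc j = q ^ Suc n"
        unfolding power_add[symmetric] using j by simp
      finally show ?thesis by simp
    qed (simp add: Suc)
  qed simp
qed auto

lemma qfact_nonzero: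
  fixes q :: "'a::idom"
  assumes "\<And>i. i > 0 \<Longrightarrow> q ^ i \<noteq> 1"
  shows "qfact q n \<noteq> 0"
  by (induction n) (use assms[of "Suc _"] in auto)

text \<open>Both sides are the q-multinomial coefficient of b, c - b and a - c. That q is no root of
  unity makes the q-factorials cancellable.\<close>

lemma qbinom_mult:
  fixes q :: "'a::idom"
  assumes q: "\<And>i. i > 0 \<Longrightarrow> q ^ i \<noteq> 1" and "b \<le> c" "c \<le> a"
  shows "qbinom q a c * qbinom q c b = qbinom q a b * qbinom q (a - b) (c - b)"
proof -
  let ?f = "qfact q b * qfact q (c - b) * qfact q (a - c)"
  have "qbinom q a c * qbinom q c b * ?f * qfact q c = qfact q a * qfact q c"
    unfolding qbinom_qfact[OF \<open>b \<le> c\<close>, of q, symmetric] qbinom_qfact[OF \<open>c \<le> a\<close>, of q, symmetric]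
    by (simp only: mult_ac)
  moreover have "qbinom q a b * qbinom q (a - b) (c - b) * ?f * qfact q (a - b) = qfact q a * qfact q (a - b)"
  proof -
    have "a - b - (c - b) = a - c" using assms by simp
    then have "qbinom q (a - b) (c - b) * (qfact q (c - b) * qfact q (a - c)) = qfact q (a - b)"
      using qbinom_qfact[of "c - b" "a - b" q] assms by simp
    moreover have "qbinom q a b * (qfact q b * qfact q (a - b)) = qfact q a"
      using qbinom_qfact[of b a q] assms by simp
    moreover have "qbinom q a b * qbinom q (a - b) (c - b) * ?f * qfact q (a - b) =
       (qbinom q a b * (qfact q b * qfact q (a - b))) * (qbinom q (a - b) (c - b) * (qfact q (c - b) * qfact q (a - c)))"
      by (simp only: mult_ac)
    ultimately show ?thesis by simp
  qed
  ultimately have "qbinom q a c * qbinom q c b * ?f = qbinom q a b * qbinom q (a - b) (c - b) * ?f"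
    using qfact_nonzero[OF q] by simp
  then show ?thesis using qfact_nonzero[OF q] by simp
qed

lemma qbinom_symmetric:
  fixes q :: "'a::idom"
  assumes q: "\<And>i. i > 0 \<Longrightarrow> q ^ i \<noteq> 1" and "k \<le> n"
  shows "qbinom q n (n - k) = qbinom q n k"
proof -
  have "qbinom q n (n - k) * (qfact q k * qfact q (n - k)) = qbinom q n k * (qfact q k * qfact q (n - k))"
    using qbinom_qfact[of k n q] qbinom_qfact[of "n - k" n q] assms(2) by (simp add: mult_ac)
  then show ?thesis using qfact_nonzero[OF q] by simp
qed

text \<open>By \<open>qbinom_mult\<close> a factor independent of c comes out, and what remains is
  the alternating sum of row a - b.\<close>

lemma qbinom_inversion:
  fixes q :: "'a::idom"
  assumes q: "\<And>i. i > 0 \<Longrightarrow> q ^ i \<noteq> 1" and "b \<le> a"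
  shows "(\<Sum>c=b..a. (-1) ^ (a - c) * q ^ ((a - c) choose 2) * (qbinom q a c * qbinom q c b)) =
    (if a = b then 1 else 0)"
proof -
  have "(\<Sum>c=b..a. (-1) ^ (a - c) * q ^ ((a - c) choose 2) * (qbinom q a c * qbinom q c b)) =
     (\<Sum>c=b..a. qbinom q a b * ((-1) ^ (a - c) * q ^ ((a - c) choose 2) * qbinom q (a - b) (a - c)))"
  proof (rule sum.cong[OF HOL.refl])
    fix c assume c: "c \<in> {b..a}"
    then have "c - b \<le> a - b" "a - b - (c - b) = a - c" by auto
    then have "qbinom q (a - b) (c - b) = qbinom q (a - b) (a - c)"
      using qbinom_symmetric[OF q, of "c - b" "a - b"] by metis
    then have "qbinom q a c * qbinom q c b = qbinom q a b * qbinom q (a - b) (a - c)"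
      using qbinom_mult[OF q, of b c a] c by simp
    then show "(-1) ^ (a - c) * q ^ ((a - c) choose 2) * (qbinom q a c * qbinom q c b) =
       qbinom q a b * ((-1) ^ (a - c) * q ^ ((a - c) choose 2) * qbinom q (a - b) (a - c))"
      by (simp only: mult_ac)
  qed
  also have "\<dots> = (\<Sum>j\<le>a - b. qbinom q a b * ((-1) ^ j * q ^ (j choose 2) * qbinom q (a - b) j))"
    by (rule sum.reindex_bij_witness[of _ "\<lambda>j. a - j" "\<lambda>c. a - c"]) (use assms in auto)
  also have "\<dots> = (if a = b then 1 else 0)"
    unfolding sum_distrib_left[symmetric] qbinom_alternating_sum using assms by auto
  finally show ?thesis .
qed

text \<open>The entries of the matrices \<open>A\<close> and \<open>D\<close>.\<close>

definition trans_coeff :: "'a::comm_semiring_1 \<Rightarrow> nat \<Rightarrow> nat \<Rightarrow> nat \<Rightarrow> 'a" where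
  "trans_coeff q d r i = qbinom q (d - i) (d - r) * q ^ (i * (d - r))"

definition diag_coeff :: "'a::comm_ring_1 \<Rightarrow> nat \<Rightarrow> 'a" where
  "diag_coeff q r = (-1) ^ r * q ^ (r choose 2)"

lemma trans_coeff_top [simp]: "trans_coeff q d d i = 1"
  by (simp add: trans_coeff_def)

lemma trans_coeff_diag [simp]: "trans_coeff q d r r = q ^ (r * (d - r))"
  by (simp add: trans_coeff_def)

text \<open>The exponents of q met in \<open>trans_coeff_inversion\<close>; the term
  \<open>Suc i choose 2\<close> stands on the left to avoid subtraction of naturals.\<close>

lemma choose_two_shift:
  assumes "i \<le> j" "j \<le> d"
  shows "(j choose 2) + i * (d - j) + (Suc i choose 2) = ((j - i) choose 2) + i * d"
proof -
  obtain k where j: "j = i + k" using assms le_Suc_ex by blast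
  obtain l where d: "d = j + l" using assms le_Suc_ex by blast
  have "(j choose 2) + (Suc i choose 2) = (k choose 2) + i * j"
    unfolding j by (induction k) (simp_all add: triangle_Suc, induction i, simp_all add: triangle_Suc)
  then show ?thesis unfolding d j by (simp add: algebra_simps)
qed

text \<open>The palindromic symmetry contributes the exponent (d - r) * (r - j), which together with
  j * (d - r) gives r * (d - r). This no longer depends on j, and so the matrix product reduces to a
  Gaussian inversion.\<close>

lemma trans_coeff_inverse:
  fixes q :: "'a::field"
  assumes "q \<noteq> 0" "j \<le> r" "r \<le> d"
  shows "trans_coeff (inverse q) d r j = inverse q ^ (r * (d - r)) * qbinom q (d - j) (d - r)"
proof -
  obtain k where k: "r = j + k" using assms le_Suc_ex by blast
  have "d - j - (d - r) = r - j" using assms by simp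
  then have "qbinom (inverse q) (d - j) (d - r) = inverse q ^ ((d - r) * (r - j)) * qbinom q (d - j) (d - r)"
    using qbinom_inverse[of "inverse q" "d - r" "d - j"] assms by simp
  moreover have "r * (d - r) = (d - r) * (r - j) + j * (d - r)"
    unfolding k by (simp add: add_mult_distrib mult.commute)
  ultimately show ?thesis by (simp add: trans_coeff_def power_add mult_ac)
qed

text \<open>The matrix identity of the overview, entry by entry. Up to the constant
  \<open>?c\<close>, the summand is that of \<open>qbinom_inversion\<close> for d - i and d - r,
  with c = d - j as the summation index.\<close>

lemma trans_coeff_inversion:
  fixes q :: "'a::field"
  assumes "q \<noteq> 0" and q: "\<And>i. i > 0 \<Longrightarrow> q ^ i \<noteq> 1" and "i \<le> r" "r \<le> d"
  shows "(\<Sum>j=i..r. trans_coeff (inverse q) d r j * diag_coeff q j * trans_coeff q d j i) =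
    (if i = r then diag_coeff q r else 0)"
proof -
  let ?c = "inverse q ^ (r * (d - r)) * (-1) ^ i * q ^ (i * d) * inverse q ^ (Suc i choose 2)"
  let ?s = "\<lambda>c. (-1) ^ (d - i - c) * q ^ ((d - i - c) choose 2) * (qbinom q (d - i) c * qbinom q c (d - r))"
  have "trans_coeff (inverse q) d r j * diag_coeff q j * trans_coeff q d j i = ?c * ?s (d - j)"
    if j: "j \<in> {i..r}" for j
  proof -
    have 1: "d - i - (d - j) = j - i" using j assms by auto
    have "q ^ (j choose 2) * q ^ (i * (d - j)) * q ^ (Suc i choose 2) = q ^ ((j - i) choose 2) * q ^ (i * d)"
      unfolding power_add[symmetric] using choose_two_shift[of i j d] j assms by simp
    then have "q ^ (j choose 2) * q ^ (i * (d - j)) = q ^ ((j - i) choose 2) * q ^ (i * d) * inverse q ^ (Suc i choose 2)"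
      using assms(1) by (simp add: field_simps)
    moreover have "(-1) ^ j = (-1) ^ i * ((-1) ^ (j - i) :: 'a)"
      unfolding power_add[symmetric] using j by simp
    moreover have "trans_coeff (inverse q) d r j * diag_coeff q j * trans_coeff q d j i =
       inverse q ^ (r * (d - r)) * qbinom q (d - j) (d - r) * (-1) ^ j * qbinom q (d - i) (d - j)
         * (q ^ (j choose 2) * q ^ (i * (d - j)))"
      using trans_coeff_inverse[of q j r d] assms j
      by (simp add: diag_coeff_def trans_coeff_def mult_ac)
    ultimately show ?thesis unfolding 1 by (simp only: mult_ac)
  qed
  then have "(\<Sum>j=i..r. trans_coeff (inverse q) d r j * diag_coeff q j * trans_coeff q d j i) =
      (\<Sum>j=i..r. ?c * ?s (d - j))" by (intro sum.cong) auto
  also have "\<dots> = (\<Sum>c=d-r..d-i. ?c * ?s c)"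
    by (rule sum.reindex_bij_witness[of _ "\<lambda>c. d - c" "\<lambda>j. d - j"]) (use assms in auto)
  also have "\<dots> = ?c * (if d - i = d - r then 1 else 0)"
    unfolding sum_distrib_left[symmetric] using qbinom_inversion[OF q, of "d - r" "d - i"] assms by simp
  also have "\<dots> = (if i = r then diag_coeff q r else 0)"
  proof (cases "i = r")
    case True
    have "(r choose 2) + r * (d - r) + (Suc r choose 2) = r * d"
      using choose_two_shift[of r r d] assms by (simp add: binomial_eq_0)
    then have "q ^ (r * d) = q ^ (r choose 2) * q ^ (r * (d - r)) * q ^ (Suc r choose 2)"
      unfolding power_add[symmetric] by simp
    then have "?c = diag_coeff q r"
      using True assms(1) by (simp add: diag_coeff_def field_simps)
    then show ?thesis using True by simp
  qed (use assms in auto)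
  finally show ?thesis .
qed

lemma trans_coeff_inversion_vec:
  fixes q :: "'a::field"
  assumes "q \<noteq> 0" and q: "\<And>i. i > 0 \<Longrightarrow> q ^ i \<noteq> 1" and "r \<le> d"
  shows "(\<Sum>j\<le>r. trans_coeff (inverse q) d r j * (diag_coeff q j * (\<Sum>i\<le>j. trans_coeff q d j i * w i))) =
    diag_coeff q r * w r"
proof -
  let ?t = "\<lambda>i j. trans_coeff (inverse q) d r j * diag_coeff q j * trans_coeff q d j i * w i"
  have "(\<Sum>j\<le>r. trans_coeff (inverse q) d r j * (diag_coeff q j * (\<Sum>i\<le>j. trans_coeff q d j i * w i))) =
     (\<Sum>j\<le>r. \<Sum>i\<le>j. ?t i j)"
    by (simp add: sum_distrib_left mult_ac)
  also have "\<dots> = (\<Sum>i\<le>r. \<Sum>j=i..r. ?t i j)"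
    by (subst sum.Sigma; (simp)?; subst sum.Sigma; (simp)?; rule sum.reindex_bij_witness[of _ "\<lambda>(i,j). (j,i)" "\<lambda>(i,j). (j,i)"]) auto
  also have "\<dots> = (\<Sum>i\<le>r. (if i = r then diag_coeff q r else 0) * w i)"
    unfolding sum_distrib_right[symmetric]
    by (intro sum.cong HOL.refl arg_cong2[where f = "(*)"] trans_coeff_inversion assms) auto
  also have "\<dots> = diag_coeff q r * w r" by (simp add: if_distrib[of "\<lambda>x. x * _"] cong: if_cong)
  finally show ?thesis .
qed

section \<open>Triangular linear systems over a field\<close>

fun tri_solve :: "(nat \<Rightarrow> nat \<Rightarrow> 'a::field) \<Rightarrow> (nat \<Rightarrow> 'a) \<Rightarrow> nat \<Rightarrow> 'a" where
  "tri_solve A b r = (b r + (\<Sum>i<r. A r i * tri_solve A b i)) / (1 - A r r)"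

declare tri_solve.simps [simp del]

lemma tri_solve_eq:
  assumes "A r r \<noteq> 1"
  shows "tri_solve A b r = b r + (\<Sum>i\<le>r. A r i * tri_solve A b i)"
proof -
  have "tri_solve A b r * (1 - A r r) = b r + (\<Sum>i<r. A r i * tri_solve A b i)"
    by (subst tri_solve.simps) (use assms in simp)
  then show ?thesis by (simp add: lessThan_Suc_atMost[symmetric] algebra_simps)
qed

text \<open>The means of identifying solutions at inverted arguments: a candidate vector only has to
  satisfy the system.\<close>

lemma tri_solve_unique:
  assumes "\<And>r. r \<le> n \<Longrightarrow> A r r \<noteq> 1"
    and "\<And>r. r \<le> n \<Longrightarrow> f r = b r + (\<Sum>i\<le>r. A r i * f i)" and "r \<le> n"
  shows "tri_solve A b r = f r"
  using assms(3)
proof (induction r rule: less_induct)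
  case (less r)
  have "f r = b r + (\<Sum>i<r. A r i * f i) + A r r * f r"
    using assms(2)[OF less.prems] by (simp add: lessThan_Suc_atMost[symmetric] add.assoc)
  then have "f r * (1 - A r r) = b r + (\<Sum>i<r. A r i * f i)" by (simp add: algebra_simps)
  also have "(\<Sum>i<r. A r i * f i) = (\<Sum>i<r. A r i * tri_solve A b i)"
    using less by (intro sum.cong) auto
  finally show ?case using assms(1)[OF less.prems] by (subst tri_solve.simps) (simp add: field_simps)
qed

text \<open>Generating function of the lattices of codimension r, with x marking the exponent of the
  index. The row r = 0 of the recursion would read f 0 = f 0; it is replaced by f 0 = 1, since only
  the whole lattice has codimension 0.\<close>

definition lattice_fun :: "'a::field \<Rightarrow> nat \<Rightarrow> 'a \<Rightarrow> nat \<Rightarrow> 'a" where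
  "lattice_fun q d x = tri_solve (\<lambda>r i. if r = 0 then 0 else x ^ r * trans_coeff q d r i) (\<lambda>r. of_bool (r = 0))"

text \<open>Sum over k and over the lattices L of codimension r, with weight t^k (q^(d+1) t)^[L] (q
  t)^[M_k]. The inhomogeneous term is the part k = 0: there M_0 = L, and the two weights multiply to
  q^(d+2) t^2.\<close>

definition pair_fun :: "'a::field \<Rightarrow> nat \<Rightarrow> 'a \<Rightarrow> nat \<Rightarrow> 'a" where
  "pair_fun q d t = tri_solve (\<lambda>r i. t * (q ^ (d + 1) * t) ^ r * trans_coeff q d r i) (lattice_fun q d (q ^ (d + 2) * t ^ 2))"

text \<open>The first factor is the sum over the sublattices K of M_k, which is the same for every
  lattice of rank d.\<close>

definition zeta_fun :: "'a::field \<Rightarrow> nat \<Rightarrow> 'a \<Rightarrow> 'a" where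
  "zeta_fun q d t = (\<Sum>r\<le>d. lattice_fun q d (q * t) r) * (\<Sum>r\<le>d. pair_fun q d t r)"

text \<open>All denominators occurring in \<open>zeta_fun q d t\<close> have the form \<open>1 - q^a * t^b\<close>. The bound on \<open>a\<close> is what
  makes the condition satisfiable for \<open>q = p\<close> and small complex \<open>t\<close>.\<close>

definition generic :: "'a::field \<Rightarrow> nat \<Rightarrow> 'a \<Rightarrow> bool" where
  "generic q d t \<longleftrightarrow> q \<noteq> 0 \<and> t \<noteq> 0 \<and> (\<forall>i>0. q ^ i \<noteq> 1) \<and>
     (\<forall>a b. a \<le> 2 * (d + 1) ^ 2 \<and> b > 0 \<longrightarrow> q ^ a * t ^ b \<noteq> 1)"

text \<open>These are the diagonal entries of the systems. The largest power of q that occurs is (d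
  + 2) * r + r * (d - r), and this is where the bound 2 * (d + 1)^2 comes from.\<close>

lemma genericD:
  assumes "generic q d t" "r \<le> d"
  shows "r \<noteq> 0 \<Longrightarrow> (q * t) ^ r * q ^ (r * (d - r)) \<noteq> 1"
    and "r \<noteq> 0 \<Longrightarrow> (q ^ (d + 2) * t ^ 2) ^ r * q ^ (r * (d - r)) \<noteq> 1"
    and "t * (q ^ (d + 1) * t) ^ r * q ^ (r * (d - r)) \<noteq> 1"
proof -
  have *: "q ^ a * t ^ b \<noteq> 1" if "a \<le> 2 * (d + 1) ^ 2" "b > 0" for a b
    using that assms by (auto simp: generic_def)
  have r: "r * (d - r) \<le> (d + 1) * (d + 1)" by (rule mult_le_mono) (use assms in auto)
  have "r \<le> (d + 1) * (d + 1)" using assms by simp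
  then have "q ^ (r + r * (d - r)) * t ^ r \<noteq> 1" if "r \<noteq> 0"
    using r that by (intro *) (auto simp: power2_eq_square)
  then show "r \<noteq> 0 \<Longrightarrow> (q * t) ^ r * q ^ (r * (d - r)) \<noteq> 1"
    by (simp add: power_mult_distrib power_add mult_ac)
  have "q ^ ((d + 2) * r + r * (d - r)) * t ^ (2 * r) \<noteq> 1" if "r \<noteq> 0"
  proof (intro *)
    have "(d + 2) * r + r * (d - r) \<le> (d + 2) * d + d * d"
      using assms by (intro add_mono mult_le_mono) auto
    then show "(d + 2) * r + r * (d - r) \<le> 2 * (d + 1) ^ 2" by (simp add: power2_eq_square)
  qed (use that in auto)
  moreover have "(q ^ (d + 2) * t ^ 2) ^ r * q ^ (r * (d - r)) = q ^ ((d + 2) * r + r * (d - r)) * t ^ (2 * r)"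
    unfolding power_mult_distrib power_mult[symmetric] power_add[of q "(d + 2) * r"] by (simp only: mult_ac)
  ultimately show "r \<noteq> 0 \<Longrightarrow> (q ^ (d + 2) * t ^ 2) ^ r * q ^ (r * (d - r)) \<noteq> 1"
    by simp
  have "q ^ ((d + 1) * r + r * (d - r)) * t ^ (Suc r) \<noteq> 1"
  proof (intro *)
    have "(d + 1) * r + r * (d - r) \<le> (d + 1) * d + d * d"
      using assms by (intro add_mono mult_le_mono) auto
    then show "(d + 1) * r + r * (d - r) \<le> 2 * (d + 1) ^ 2" by (simp add: power2_eq_square)
  qed auto
  then show "t * (q ^ (d + 1) * t) ^ r * q ^ (r * (d - r)) \<noteq> 1"
    by (simp add: power_mult_distrib power_add power_mult mult_ac)
qed

lemma generic_inverse:
  assumes "generic q d t"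
  shows "generic (inverse q) d (inverse t)"
  unfolding generic_def
proof (intro conjI allI impI)
  show "inverse q ^ i \<noteq> 1" if "i > 0" for i
    using assms that by (auto simp: generic_def power_inverse)
  fix a b :: nat assume "a \<le> 2 * (d + 1) ^ 2 \<and> 0 < b"
  then have "q ^ a * t ^ b \<noteq> 1" using assms by (auto simp: generic_def)
  moreover have "inverse q ^ a * inverse t ^ b = inverse (q ^ a * t ^ b)" by (simp add: power_inverse)
  ultimately show "inverse q ^ a * inverse t ^ b \<noteq> 1" by (metis inverse_eq_1_iff)
qed (use assms in \<open>auto simp: generic_def\<close>)

section \<open>The systems under inversion of all variables\<close>

lemma lattice_fun_0 [simp]: "lattice_fun q d x 0 = 1"
  unfolding lattice_fun_def by (subst tri_solve.simps) simp

lemma lattice_fun_eq: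
  assumes "r \<noteq> 0 \<Longrightarrow> x ^ r * q ^ (r * (d - r)) \<noteq> 1"
  shows "lattice_fun q d x r = x ^ r * (\<Sum>i\<le>r. trans_coeff q d r i * lattice_fun q d x i)"
proof (cases "r = 0")
  case True
  then show ?thesis by simp
next
  case False
  then show ?thesis using assms
    unfolding lattice_fun_def by (subst tri_solve_eq) (auto simp: sum_distrib_left mult.assoc)
qed

lemma pair_fun_eq:
  assumes "t * (q ^ (d + 1) * t) ^ r * q ^ (r * (d - r)) \<noteq> 1"
  shows "pair_fun q d t r = lattice_fun q d (q ^ (d + 2) * t ^ 2) r +
    t * (q ^ (d + 1) * t) ^ r * (\<Sum>i\<le>r. trans_coeff q d r i * pair_fun q d t i)"
  unfolding pair_fun_def
  by (subst tri_solve_eq) (use assms in \<open>auto simp: sum_distrib_left mult.assoc\<close>)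

text \<open>By uniqueness it is enough that D A f solves the inverted system. The inverted matrix
  takes D A f to D f, and dividing by x^r turns f r into the r-th entry of A f, by the equation for
  f itself.\<close>

lemma lattice_fun_inverse:
  fixes q :: "'a::field"
  assumes "q \<noteq> 0" and q: "\<And>i. i > 0 \<Longrightarrow> q ^ i \<noteq> 1" and "x \<noteq> 0"
    and nz: "\<And>r. r \<noteq> 0 \<Longrightarrow> r \<le> d \<Longrightarrow> x ^ r * q ^ (r * (d - r)) \<noteq> 1" and "r \<le> d"
  shows "lattice_fun (inverse q) d (inverse x) r =
    diag_coeff q r * (\<Sum>i\<le>r. trans_coeff q d r i * lattice_fun q d x i)"
  unfolding lattice_fun_def[of "inverse q"]
proof (rule tri_solve_unique[OF _ _ \<open>r \<le> d\<close>])
  have eq: "lattice_fun q d x r = x ^ r * (\<Sum>i\<le>r. trans_coeff q d r i * lattice_fun q d x i)" if "r \<le> d" for r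
    using nz that by (intro lattice_fun_eq) auto
  fix r assume r: "r \<le> d"
  show "(if r = 0 then 0 else inverse x ^ r * trans_coeff (inverse q) d r r) \<noteq> 1"
  proof (cases "r = 0")
    case False
    have "inverse x ^ r * trans_coeff (inverse q) d r r = inverse (x ^ r * q ^ (r * (d - r)))"
      by (simp add: power_inverse)
    then show ?thesis using nz[OF False r] False inverse_eq_1_iff by metis
  qed simp
  have "(\<Sum>i\<le>r. inverse x ^ r * trans_coeff (inverse q) d r i *
      (diag_coeff q i * (\<Sum>j\<le>i. trans_coeff q d i j * lattice_fun q d x j))) =
      inverse x ^ r * (diag_coeff q r * lattice_fun q d x r)"
    by (subst trans_coeff_inversion_vec[OF assms(1) q r, symmetric]) (simp_all add: sum_distrib_left mult.assoc)
  also have "\<dots> = diag_coeff q r * (\<Sum>i\<le>r. trans_coeff q d r i * lattice_fun q d x i)"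
    using eq[OF r] \<open>x \<noteq> 0\<close> by (simp add: power_inverse)
  finally show "diag_coeff q r * (\<Sum>i\<le>r. trans_coeff q d r i * lattice_fun q d x i) = of_bool (r = 0) +
      (\<Sum>i\<le>r. (if r = 0 then 0 else inverse x ^ r * trans_coeff (inverse q) d r i) *
      (diag_coeff q i * (\<Sum>j\<le>i. trans_coeff q d i j * lattice_fun q d x j)))"
    \<comment> \<open>The row r = 0 is the normalisation of the system and only asks for the value
      1.\<close>
    by (cases "r = 0") (simp_all add: diag_coeff_def binomial_eq_0)
qed

text \<open>The last row of A consists of ones, so a sum over all codimensions is a last entry. This
  is used twice: for the inverted matrix, and in the equation for f at r = d.\<close>

lemma sum_lattice_fun_inverse:
  fixes q :: "'a::field"
  assumes "q \<noteq> 0" and q: "\<And>i. i > 0 \<Longrightarrow> q ^ i \<noteq> 1" and "x \<noteq> 0"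
    and nz: "\<And>r. r \<noteq> 0 \<Longrightarrow> r \<le> d \<Longrightarrow> x ^ r * q ^ (r * (d - r)) \<noteq> 1"
  shows "(\<Sum>r\<le>d. lattice_fun (inverse q) d (inverse x) r) =
    diag_coeff q d * x ^ d * (\<Sum>r\<le>d. lattice_fun q d x r)"
proof -
  have "(\<Sum>r\<le>d. lattice_fun (inverse q) d (inverse x) r) = diag_coeff q d * lattice_fun q d x d"
    using lattice_fun_inverse[OF assms] trans_coeff_inversion_vec[OF assms(1) q, of d d "lattice_fun q d x"]
    by simp
  also have "lattice_fun q d x d = x ^ d * (\<Sum>r\<le>d. lattice_fun q d x r)"
    using lattice_fun_eq[of d x q d] nz[of d] by simp
  finally show ?thesis by (simp add: mult_ac)
qed

lemma sum_pair_fun_inverse: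
  fixes q :: "'a::field"
  assumes "generic q d t"
  shows "(\<Sum>r\<le>d. pair_fun (inverse q) d (inverse t) r) =
    - diag_coeff q d * t * (q ^ (d + 1) * t) ^ d * (\<Sum>r\<le>d. pair_fun q d t r)"
proof -
  have q: "q \<noteq> 0" "\<And>i. i > 0 \<Longrightarrow> q ^ i \<noteq> 1" "t \<noteq> 0"
    using assms by (auto simp: generic_def)
  define x where "x = q ^ (d + 2) * t ^ 2"
  define y where "y = q ^ (d + 1) * t"
  have x: "x \<noteq> 0" "inverse q ^ (d + 2) * inverse t ^ 2 = inverse x"
    using q by (auto simp: x_def power_inverse)
  have y: "y \<noteq> 0" "inverse q ^ (d + 1) * inverse t = inverse y"
    using q by (auto simp: y_def power_inverse)
  note nz = genericD[OF assms, folded x_def y_def]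
  define f where "f = lattice_fun q d x"
  define F where "F = pair_fun q d t"
  \<comment> \<open>\<open>w\<close> is minus the part of \<open>F\<close> with k > 0. As with a
    geometric series, inversion turns the sum over k \<ge> 0 into minus the sum over k > 0; the sign
    of the functional equation arises here.\<close>
  define w where "w = (\<lambda>i. f i - F i)"
  have f: "f r = x ^ r * (\<Sum>i\<le>r. trans_coeff q d r i * f i)" if "r \<le> d" for r
    unfolding f_def using nz(2)[OF that] by (rule lattice_fun_eq)
  have F: "F r = f r + t * y ^ r * (\<Sum>i\<le>r. trans_coeff q d r i * F i)" if "r \<le> d" for r
    using pair_fun_eq[of t q d r] nz(3)[OF that] unfolding F_def f_def x_def y_def by simp
  have G: "pair_fun (inverse q) d (inverse t) r = diag_coeff q r * (\<Sum>i\<le>r. trans_coeff q d r i * w i)"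
    if "r \<le> d" for r
    unfolding pair_fun_def x(2) y(2)
  proof (rule tri_solve_unique[OF _ _ that])
    fix r assume r: "r \<le> d"
    have "inverse t * inverse y ^ r * trans_coeff (inverse q) d r r = inverse (t * y ^ r * q ^ (r * (d - r)))"
      by (simp add: power_inverse)
    then show "inverse t * inverse y ^ r * trans_coeff (inverse q) d r r \<noteq> 1"
      using nz(3)[OF r] inverse_eq_1_iff by metis
    have "(\<Sum>i\<le>r. inverse t * inverse y ^ r * trans_coeff (inverse q) d r i *
        (diag_coeff q i * (\<Sum>j\<le>i. trans_coeff q d i j * w j))) =
        inverse t * inverse y ^ r * (diag_coeff q r * w r)"
      by (subst trans_coeff_inversion_vec[OF q(1,2) r, symmetric]) (simp_all add: sum_distrib_left mult.assoc)
    also have "\<dots> = - (diag_coeff q r * (\<Sum>i\<le>r. trans_coeff q d r i * F i))"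
    proof -
      have "inverse t * inverse y ^ r * (t * y ^ r) = 1" using q y by (simp add: field_simps)
      moreover have "w r = - (t * y ^ r * (\<Sum>i\<le>r. trans_coeff q d r i * F i))"
        using F[OF r] unfolding w_def by simp
      ultimately show ?thesis by (simp add: mult.assoc mult.left_commute[of "diag_coeff q r"])
    qed
    moreover have "lattice_fun (inverse q) d (inverse x) r = diag_coeff q r * (\<Sum>i\<le>r. trans_coeff q d r i * f i)"
      unfolding f_def using lattice_fun_inverse[OF q(1,2) x(1) _ r] nz(2) by blast
    ultimately show "diag_coeff q r * (\<Sum>i\<le>r. trans_coeff q d r i * w i) =
      lattice_fun (inverse q) d (inverse x) r + (\<Sum>i\<le>r. inverse t * inverse y ^ r * trans_coeff (inverse q) d r i *
        (diag_coeff q i * (\<Sum>j\<le>i. trans_coeff q d i j * w j)))"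
      unfolding w_def by (simp add: right_diff_distrib sum_subtractf)
  qed
  have "(\<Sum>r\<le>d. pair_fun (inverse q) d (inverse t) r) = diag_coeff q d * w d"
    using G trans_coeff_inversion_vec[OF q(1,2), of d d w] by simp
  also have "w d = - t * y ^ d * (\<Sum>r\<le>d. F r)"
    using F[of d] unfolding w_def by simp
  finally show ?thesis unfolding F_def y_def by simp
qed

text \<open>The sign (-1)^d of D enters once for each factor and cancels. The powers of q are twice
  \<open>d choose 2\<close> from D, then d and (d + 1) * d from the weights of K and L.\<close>

lemma zeta_fun_inverse:
  fixes q :: "'a::field"
  assumes "generic q d t"
  shows "zeta_fun (inverse q) d (inverse t) = - (q ^ ((2 * d + 1) choose 2) * t ^ (2 * d + 1)) * zeta_fun q d t"
proof -
  have q: "q \<noteq> 0" "\<And>i. i > 0 \<Longrightarrow> q ^ i \<noteq> 1" "t \<noteq> 0"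
    using assms by (auto simp: generic_def)
  have i: "inverse q * inverse t = inverse (q * t)" by simp
  have "zeta_fun (inverse q) d (inverse t) =
    - (diag_coeff q d * (q * t) ^ d * diag_coeff q d * t * (q ^ (d + 1) * t) ^ d) * zeta_fun q d t"
    unfolding zeta_fun_def i sum_pair_fun_inverse[OF assms]
    by (subst sum_lattice_fun_inverse) (use q genericD(1)[OF assms] in auto)
  also have "diag_coeff q d * (q * t) ^ d * diag_coeff q d * t * (q ^ (d + 1) * t) ^ d =
      q ^ ((2 * d + 1) choose 2) * t ^ (2 * d + 1)"
  proof -
    have "(2 * d + 1) choose 2 = (d choose 2) + d + (d choose 2) + (d + 1) * d"
      by (induction d) (simp_all add: triangle_Suc)
    moreover have "((-1) ^ d * (-1) ^ d :: 'a) = 1" by (simp add: power_mult_distrib[symmetric])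
    moreover have "diag_coeff q d * (q * t) ^ d * diag_coeff q d * t * (q ^ (d + 1) * t) ^ d =
       ((-1) ^ d * (-1) ^ d) * q ^ ((d choose 2) + d + (d choose 2) + (d + 1) * d) * t ^ (d + 1 + d)"
      unfolding diag_coeff_def power_add power_mult power_mult_distrib by (simp only: mult_ac power_one_right)
    ultimately show ?thesis by (simp add: mult_2)
  qed
  finally show ?thesis .
qed

section \<open>Evaluation of rational functions\<close>

lemma bipoly_eval_add: "bipoly_eval (P + Q) u v = bipoly_eval P u v + bipoly_eval Q u v"
  unfolding bipoly_eval_def by (subst map_poly_hom_add) (simp_all add: map_poly_hom_add of_rat_add)

lemma bipoly_eval_1 [simp]: "bipoly_eval 1 u v = 1"
  by (simp add: bipoly_eval_def map_poly_1)

lemma bipoly_eval_uminus: "bipoly_eval (- P) u v = - bipoly_eval P u v"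
  using bipoly_eval_add[of P "- P" u v] by (simp add: eq_neg_iff_add_eq_0 add.commute)

lemma bipoly_eval_diff: "bipoly_eval (P - Q) u v = bipoly_eval P u v - bipoly_eval Q u v"
  using bipoly_eval_add[of "P - Q" Q u v] by simp

text \<open>Regularity and value are bundled so that both pass through field operations together.
  The field may be \<open>ratfun\<close> itself, which covers formal substitution.\<close>

definition has_value :: "ratfun \<Rightarrow> 'k \<Rightarrow> 'k \<Rightarrow> 'k :: field_char_0 \<Rightarrow> bool" where
  "has_value R u v w \<longleftrightarrow> ratfun_regular R u v \<and> ratfun_eval R u v = w"

lemma has_value_Fract:
  "bipoly_eval B u v \<noteq> 0 \<Longrightarrow> has_value (Fract A B) u v (bipoly_eval A u v / bipoly_eval B u v)"
  using ratfun_eval_Fract by (auto simp: has_value_def ratfun_regular_def)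

lemma has_value_Fract': 
  "bipoly_eval B u v \<noteq> 0 \<Longrightarrow> w = bipoly_eval A u v / bipoly_eval B u v \<Longrightarrow> has_value (Fract A B) u v w"
  using has_value_Fract by metis

lemma has_valueE:
  assumes "has_value R u v w"
  obtains A B where "R = Fract A B" "B \<noteq> 0" "bipoly_eval B u v \<noteq> 0" "w = bipoly_eval A u v / bipoly_eval B u v"
proof -
  obtain A B where *: "R = Fract A B" "bipoly_eval B u v \<noteq> 0"
    using assms by (auto simp: has_value_def ratfun_regular_def)
  then have "B \<noteq> 0" by auto
  moreover have "w = bipoly_eval A u v / bipoly_eval B u v"
    using assms * ratfun_eval_Fract[OF *(2)] by (simp add: has_value_def)
  ultimately show ?thesis using that * by blast
qed

text \<open>Regularity concerns some representation, so this particular B may vanish at (u, v); the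
  equation survives once denominators are cleared.\<close>

lemma has_value_num_denom:
  assumes "has_value (Fract A B) u v w" "B \<noteq> 0"
  shows "bipoly_eval A u v = w * bipoly_eval B u v"
proof -
  obtain A' B' where *: "Fract A B = Fract A' B'" "B' \<noteq> 0" "bipoly_eval B' u v \<noteq> 0"
    "w = bipoly_eval A' u v / bipoly_eval B' u v" using has_valueE[OF assms(1)] by metis
  then have "bipoly_eval (A * B') u v = bipoly_eval (A' * B) u v" using assms by (simp add: eq_fract)
  moreover have "bipoly_eval A' u v = w * bipoly_eval B' u v" using * by simp
  ultimately have "bipoly_eval A u v * bipoly_eval B' u v = w * bipoly_eval B u v * bipoly_eval B' u v"
    by (simp add: bipoly_eval_mult mult_ac)
  then show ?thesis using *(3) by simp
qed

lemma has_value_add: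
  assumes "has_value R u v w" "has_value R' u v w'"
  shows "has_value (R + R') u v (w + w')"
proof -
  obtain A B where 1: "R = Fract A B" "B \<noteq> 0" "bipoly_eval B u v \<noteq> 0" "w = bipoly_eval A u v / bipoly_eval B u v"
    using has_valueE[OF assms(1)] .
  obtain A' B' where 2: "R' = Fract A' B'" "B' \<noteq> 0" "bipoly_eval B' u v \<noteq> 0" "w' = bipoly_eval A' u v / bipoly_eval B' u v"
    using has_valueE[OF assms(2)] .
  have "R + R' = Fract (A * B' + A' * B) (B * B')" using 1 2 by simp
  then show ?thesis using 1 2
    by (auto intro!: has_value_Fract' simp: bipoly_eval_mult bipoly_eval_add add_frac_eq)
qed

lemma has_value_uminus:
  assumes "has_value R u v w"
  shows "has_value (- R) u v (- w)"
proof -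
  obtain A B where 1: "R = Fract A B" "B \<noteq> 0" "bipoly_eval B u v \<noteq> 0" "w = bipoly_eval A u v / bipoly_eval B u v"
    using has_valueE[OF assms(1)] .
  then show ?thesis by (auto intro!: has_value_Fract' simp: bipoly_eval_uminus)
qed

lemma has_value_diff:
  "has_value R u v w \<Longrightarrow> has_value R' u v w' \<Longrightarrow> has_value (R - R') u v (w - w')"
  using has_value_add[OF _ has_value_uminus] by fastforce

lemma has_value_mult:
  assumes "has_value R u v w" "has_value R' u v w'"
  shows "has_value (R * R') u v (w * w')"
proof -
  obtain A B where 1: "R = Fract A B" "B \<noteq> 0" "bipoly_eval B u v \<noteq> 0" "w = bipoly_eval A u v / bipoly_eval B u v"
    using has_valueE[OF assms(1)] .
  obtain A' B' where 2: "R' = Fract A' B'" "B' \<noteq> 0" "bipoly_eval B' u v \<noteq> 0" "w' = bipoly_eval A' u v / bipoly_eval B' u v"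
    using has_valueE[OF assms(2)] .
  have "R * R' = Fract (A * A') (B * B')" using 1 2 by simp
  then show ?thesis using 1 2
    by (auto intro!: has_value_Fract' simp: bipoly_eval_mult)
qed

lemma has_value_divide:
  assumes "has_value R u v w" "has_value R' u v w'" "w' \<noteq> 0"
  shows "has_value (R / R') u v (w / w')"
proof -
  obtain A' B' where 2: "R' = Fract A' B'" "B' \<noteq> 0" "bipoly_eval B' u v \<noteq> 0" "w' = bipoly_eval A' u v / bipoly_eval B' u v"
    using has_valueE[OF assms(2)] .
  have "has_value (inverse R') u v (inverse w')"
    unfolding 2(1) inverse_fract using 2 assms(3) by (intro has_value_Fract') auto
  then show ?thesis using has_value_mult[OF assms(1)] by (simp add: divide_inverse)
qed

lemma has_value_0: "has_value 0 u v 0"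
  unfolding Zero_fract_def by (intro has_value_Fract') auto

lemma has_value_1: "has_value 1 u v 1"
  unfolding One_fract_def by (intro has_value_Fract') auto

lemma has_value_ratU: "has_value ratU u v u"
  unfolding ratU_def by (intro has_value_Fract') (auto simp: bipoly_eval_def map_poly_pCons)

lemma has_value_ratV: "has_value ratV u v v"
  unfolding ratV_def by (intro has_value_Fract') (auto simp: bipoly_eval_def map_poly_pCons)

lemma has_value_power: "has_value R u v w \<Longrightarrow> has_value (R ^ n) u v (w ^ n)"
  by (induction n) (simp_all add: has_value_1 has_value_mult)

lemma has_value_sum: "(\<And>i. i \<in> I \<Longrightarrow> has_value (R i) u v (w i)) \<Longrightarrow> has_value (sum R I) u v (sum w I)"
  by (induction I rule: infinite_finite_induct) (simp_all add: has_value_0 has_value_add)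

lemma has_value_qbinom: "has_value Q u v q \<Longrightarrow> has_value (qbinom Q n k) u v (qbinom q n k)"
  by (induction Q n k rule: qbinom.induct)
    (auto intro!: has_value_0 has_value_1 has_value_add has_value_mult has_value_power)

lemma has_value_trans_coeff: "has_value Q u v q \<Longrightarrow> has_value (trans_coeff Q d r i) u v (trans_coeff q d r i)"
  unfolding trans_coeff_def by (intro has_value_mult has_value_qbinom has_value_power)

text \<open>Solving divides only by 1 - a r r, so evaluation commutes with it as soon as these
  values are nonzero in the target field.\<close>

lemma has_value_tri_solve:
  assumes "\<And>r i. i \<le> r \<Longrightarrow> r \<le> n \<Longrightarrow> has_value (A r i) u v (a r i)"
    and "\<And>r. r \<le> n \<Longrightarrow> has_value (B r) u v (b r)"
    and "\<And>r. r \<le> n \<Longrightarrow> a r r \<noteq> 1" and "r \<le> n"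
  shows "has_value (tri_solve A B r) u v (tri_solve a b r)"
  using assms(4)
proof (induction r rule: less_induct)
  case (less r)
  then show ?case using assms
    by (subst (1 2) tri_solve.simps)
      (intro has_value_divide has_value_add has_value_diff has_value_sum has_value_mult has_value_1, auto)
qed

lemma has_value_lattice_fun:
  assumes "has_value Q u v q" "has_value Z u v x"
    and "\<And>r. r \<noteq> 0 \<Longrightarrow> r \<le> d \<Longrightarrow> x ^ r * q ^ (r * (d - r)) \<noteq> 1" and "r \<le> d"
  shows "has_value (lattice_fun Q d Z r) u v (lattice_fun q d x r)"
  unfolding lattice_fun_def
proof (rule has_value_tri_solve[OF _ _ _ assms(4)])
  show "has_value (of_bool (r = 0)) u v (of_bool (r = 0))" for r :: nat
    using has_value_0 has_value_1 by (cases "r = 0") auto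
  show "has_value (if r = 0 then 0 else Z ^ r * trans_coeff Q d r i) u v
     (if r = 0 then 0 else x ^ r * trans_coeff q d r i)" for r i
    using assms by (auto intro!: has_value_0 has_value_mult has_value_power has_value_trans_coeff)
qed (use assms in auto)

lemma has_value_zeta_fun:
  assumes "has_value Q u v q" "has_value T u v t" "generic q d t"
  shows "has_value (zeta_fun Q d T) u v (zeta_fun q d t)"
  unfolding zeta_fun_def pair_fun_def
proof (intro has_value_mult has_value_sum has_value_lattice_fun has_value_tri_solve[where n = d])
qed (use assms genericD[OF assms(3)] in \<open>auto intro!: has_value_lattice_fun has_value_mult has_value_power has_value_trans_coeff\<close>)

text \<open>Two arguments in one variable: for fixed p, infinitely many v force every coefficient, a
  polynomial in U, to vanish at U = p; then infinitely many primes force that polynomial to be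
  zero.\<close>

lemma bipoly_eq_0:
  fixes Q :: "rat poly poly"
  assumes "\<And>p. prime p \<Longrightarrow> infinite {v. bipoly_eval Q (of_nat p :: complex) v = 0}"
  shows "Q = 0"
proof (rule poly_eqI)
  fix k
  let ?q = "map_poly of_rat (Polynomial.coeff Q k) :: complex poly"
  have root: "poly ?q (of_nat p) = 0" if "prime p" for p
  proof -
    have "map_poly (\<lambda>q. poly (map_poly of_rat q) (of_nat p :: complex)) Q = 0"
      using assms[OF that] poly_roots_finite unfolding bipoly_eval_def by blast
    then have "Polynomial.coeff (map_poly (\<lambda>q. poly (map_poly of_rat q) (of_nat p :: complex)) Q) k = 0" by simp
    then show ?thesis by (simp add: coeff_map_poly)
  qed
  have "infinite (of_nat ` {p::nat. prime p} :: complex set)"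
    using primes_infinite by (simp add: finite_image_iff inj_on_def)
  moreover have "of_nat ` {p::nat. prime p} \<subseteq> {x. poly ?q x = 0}" using root by auto
  ultimately have "?q = 0" using poly_roots_finite finite_subset by blast
  then have "Polynomial.coeff ?q i = 0" for i by simp
  then have "Polynomial.coeff (Polynomial.coeff Q k) i = 0" for i by (simp add: coeff_map_poly)
  then show "Polynomial.coeff Q k = Polynomial.coeff 0 k" by (simp add: poly_eq_iff)
qed

lemma is_zeta_ratfun_unique:
  assumes "is_zeta_ratfun \<Gamma> R" "is_zeta_ratfun \<Gamma> R'"
  shows "R = R'"
proof -
  obtain A B where R: "R = Fract A B" "B \<noteq> 0" by (cases R)
  obtain A' B' where R': "R' = Fract A' B'" "B' \<noteq> 0" by (cases R')
  have "A * B' - A' * B = 0"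
  proof (rule bipoly_eq_0)
    fix p :: nat assume p: "prime p"
    obtain \<sigma> where s: "\<And>s. Re s > \<sigma> \<Longrightarrow> has_value R (of_nat p) (of_nat p powr (- s)) (local_zeta \<Gamma> p s)"
      using assms(1) p unfolding is_zeta_ratfun_def has_value_def by metis
    obtain \<sigma>' where s': "\<And>s. Re s > \<sigma>' \<Longrightarrow> has_value R' (of_nat p) (of_nat p powr (- s)) (local_zeta \<Gamma> p s)"
      using assms(2) p unfolding is_zeta_ratfun_def has_value_def by metis
    define c where "c = max \<sigma> \<sigma>' + 1"
    \<comment> \<open>Real points to the right of both abscissae; the absolute values p^(-c-k) tell
      the points of \<open>V\<close> apart.\<close>
    define V where "V = (\<lambda>k::nat. (of_nat p :: complex) powr (- of_real (c + real k)))"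
    have p1: "p > 1" using p prime_gt_1_nat by auto
    have "V k \<in> {v. bipoly_eval (A * B' - A' * B) (of_nat p :: complex) v = 0}" for k
    proof -
      have r: "Re (of_real (c + real k)) > \<sigma>" "Re (of_real (c + real k)) > \<sigma>'" by (auto simp: c_def)
      note 1 = has_value_num_denom[OF s[OF r(1), unfolded R] R(2)]
      note 2 = has_value_num_denom[OF s'[OF r(2), unfolded R'] R'(2)]
      show ?thesis
        unfolding V_def using 1 2
        by (simp add: bipoly_eval_diff bipoly_eval_mult)
    qed
    then have "range V \<subseteq> {v. bipoly_eval (A * B' - A' * B) (of_nat p :: complex) v = 0}" by blast
    moreover have "inj V"
    proof (rule injI)
      fix k l assume "V k = V l"
      then have "norm (V k) = norm (V l)" by simp
      then have "real p powr (- (c + real k)) = real p powr (- (c + real l))"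
        unfolding V_def by (simp add: norm_powr_real_powr)
      then show "k = l" using p1 powr_inj[of "real p" "- (c + real k)" "- (c + real l)"] by simp
    qed
    then have "infinite (range V)" by (simp add: finite_image_iff)
    ultimately show "infinite {v. bipoly_eval (A * B' - A' * B) (of_nat p :: complex) v = 0}"
      using finite_subset by blast
  qed
  then show ?thesis using R R' by (simp add: eq_fract)
qed

section \<open>Indices of subgroups\<close>

text \<open>The class \<open>group_add\<close> does not assume commutativity, so one theory of
  indices serves both the lattices and the nilpotent model.\<close>

definition add_subgroup :: "'a::group_add set \<Rightarrow> bool" where
  "add_subgroup H \<longleftrightarrow> 0 \<in> H \<and> (\<forall>x\<in>H. \<forall>y\<in>H. x - y \<in> H)"

lemma add_subgroupD:
  assumes "add_subgroup H"
  shows add_subgroup_0: "0 \<in> H"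
    and add_subgroup_diff: "x \<in> H \<Longrightarrow> y \<in> H \<Longrightarrow> x - y \<in> H"
    and add_subgroup_uminus: "x \<in> H \<Longrightarrow> - x \<in> H"
    and add_subgroup_add: "x \<in> H \<Longrightarrow> y \<in> H \<Longrightarrow> x + y \<in> H"
proof -
  show 0: "0 \<in> H" and d: "x \<in> H \<Longrightarrow> y \<in> H \<Longrightarrow> x - y \<in> H" for x y
    using assms by (auto simp: add_subgroup_def)
  show m: "x \<in> H \<Longrightarrow> - x \<in> H" for x using d[OF 0] by fastforce
  show "x \<in> H \<Longrightarrow> y \<in> H \<Longrightarrow> x + y \<in> H" using d[OF _ m] by fastforce
qed

lemma add_subgroup_Int: "add_subgroup H \<Longrightarrow> add_subgroup K \<Longrightarrow> add_subgroup (H \<inter> K)"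
  by (auto simp: add_subgroup_def)

definition coset :: "'a::group_add set \<Rightarrow> 'a \<Rightarrow> 'a set" where
  "coset H x = (\<lambda>h. h + x) ` H"

text \<open>An infinite index has the value 0, so finiteness is expressed below by a nonzero index.
  \<open>K\<close> may be any set: the cosets of \<open>H\<close> represented in it are
  counted.\<close>

definition idx :: "'a::group_add set \<Rightarrow> 'a set \<Rightarrow> nat" where
  "idx K H = card (coset H ` K)"

lemma coset_self: "add_subgroup H \<Longrightarrow> x \<in> coset H x"
  unfolding coset_def by (rule image_eqI[of _ _ 0]) (auto dest: add_subgroup_0)

lemma mem_coset_iff: "y \<in> coset H x \<longleftrightarrow> y - x \<in> H"
  unfolding coset_def by (auto intro!: image_eqI[of _ _ "y - x"])

lemma coset_eq_iff:
  assumes "add_subgroup H"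
  shows "coset H x = coset H y \<longleftrightarrow> x - y \<in> H"
proof
  assume "coset H x = coset H y"
  then show "x - y \<in> H" using coset_self[OF assms, of x] by (simp add: mem_coset_iff)
next
  assume xy: "x - y \<in> H"
  have "z - x \<in> H \<longleftrightarrow> z - y \<in> H" for z
  proof -
    have "z - x = (z - y) - (x - y)" "z - y = (z - x) + (x - y)"
      by (simp_all add: diff_conv_add_uminus add.assoc minus_add del: add_uminus_conv_diff)
    then show ?thesis using xy add_subgroup_diff[OF assms] add_subgroup_add[OF assms] by metis
  qed
  then show "coset H x = coset H y" by (auto simp: mem_coset_iff)
qed

lemma card_image_same_kernel:
  assumes "\<And>x y. x \<in> K \<Longrightarrow> y \<in> K \<Longrightarrow> f x = f y \<longleftrightarrow> g x = g y"
  shows "card (f ` K) = card (g ` K)"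
proof (rule bij_betw_same_card)
  show "bij_betw (\<lambda>z. g (inv_into K f z)) (f ` K) (g ` K)"
  proof (rule bij_betw_imageI)
    show "inj_on (\<lambda>z. g (inv_into K f z)) (f ` K)"
      by (intro inj_onI) (metis assms f_inv_into_f inv_into_into)
    show "(\<lambda>z. g (inv_into K f z)) ` f ` K = g ` K"
      unfolding image_image by (intro image_cong HOL.refl) (metis assms f_inv_into_f imageI inv_into_into)
  qed
qed

lemma idx_eq_card_image:
  assumes "add_subgroup H" "\<And>x y. x \<in> K \<Longrightarrow> y \<in> K \<Longrightarrow> f x = f y \<longleftrightarrow> x - y \<in> H"
  shows "idx K H = card (f ` K)"
  unfolding idx_def using assms by (intro card_image_same_kernel) (simp add: coset_eq_iff)

text \<open>With representatives for the cosets of \<open>M\<close>, a coset of \<open>H\<close>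
  amounts to a coset of \<open>M\<close> together with the coset of the remainder. As this is a
  bijection, infinite indices are covered too, both sides then being 0.\<close>

lemma idx_tower:
  assumes "add_subgroup H" "add_subgroup M" "add_subgroup K" "H \<subseteq> M" "M \<subseteq> K"
  shows "idx K H = idx K M * idx M H"
proof -
  define rep where "rep = (\<lambda>x. SOME y. y \<in> K \<and> coset M y = coset M x)"
  have rep: "rep x \<in> K" "coset M (rep x) = coset M x" if "x \<in> K" for x
    using someI[of "\<lambda>y. y \<in> K \<and> coset M y = coset M x" x] that unfolding rep_def by auto
  have rep_eq: "rep x = rep y" if "coset M x = coset M y" for x y
    using that unfolding rep_def by simp
  define f where "f = (\<lambda>x. (coset M x, coset H (x - rep x)))"
  have "idx K H = card (f ` K)"
  proof (rule idx_eq_card_image[OF assms(1)])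
    fix x y assume xy: "x \<in> K" "y \<in> K"
    have e: "x - r - (y - r) = x - y" for r by (simp add: algebra_simps)
    show "f x = f y \<longleftrightarrow> x - y \<in> H"
    proof
      assume "f x = f y"
      then have c: "coset M x = coset M y" and d: "coset H (x - rep x) = coset H (y - rep y)"
        by (simp_all add: f_def)
      show "x - y \<in> H" using d unfolding rep_eq[OF c] coset_eq_iff[OF assms(1)] e .
    next
      assume H: "x - y \<in> H"
      then have c: "coset M x = coset M y" using assms by (auto simp: coset_eq_iff)
      show "f x = f y" using H c unfolding f_def rep_eq[OF c] by (simp add: coset_eq_iff[OF assms(1)] e)
    qed
  qed
  also have "f ` K = (coset M ` K) \<times> (coset H ` M)"
  proof
    show "f ` K \<subseteq> (coset M ` K) \<times> (coset H ` M)"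
    proof (rule image_subsetI)
      fix x assume x: "x \<in> K"
      have "x - rep x \<in> M" using rep(2)[OF x] coset_eq_iff[OF assms(2)] by metis
      then show "f x \<in> (coset M ` K) \<times> (coset H ` M)" using x by (simp add: f_def)
    qed
    show "(coset M ` K) \<times> (coset H ` M) \<subseteq> f ` K"
    proof clarify
      fix x m assume x: "x \<in> K" and m: "m \<in> M"
      let ?z = "m + rep x"
      have "coset M ?z = coset M x"
        using rep[OF x] m coset_eq_iff[OF assms(2)] by (metis add_diff_cancel)
      moreover have "rep ?z = rep x" using rep_eq[OF calculation] .
      moreover have "?z \<in> K" using rep[OF x] m assms add_subgroup_add by blast
      ultimately show "(coset M x, coset H m) \<in> f ` K"
        by (intro image_eqI[of _ _ ?z]) (simp_all add: f_def)
    qed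
  qed
  finally show ?thesis by (simp add: idx_def card_cartesian_product)
qed

lemma idx_same [simp]: "add_subgroup H \<Longrightarrow> idx H H = 1"
proof -
  assume H: "add_subgroup H"
  then have "coset H ` H = {coset H 0}"
    using coset_eq_iff[OF H, of _ 0] add_subgroup_0[OF H] by auto
  then show ?thesis by (simp add: idx_def)
qed

lemma idx_1_imp_eq:
  assumes "add_subgroup H" "H \<subseteq> K" "idx K H = 1"
  shows "H = K"
proof -
  obtain c where c: "coset H ` K = {c}" using assms(3) card_1_singletonE unfolding idx_def by blast
  have "0 \<in> K" using add_subgroup_0 assms by blast
  then have "coset H x = coset H 0" if "x \<in> K" for x using c that by blast
  then show ?thesis using assms coset_eq_iff[OF assms(1), of _ 0] by auto
qed

definition add_sets :: "'a::group_add set \<Rightarrow> 'a set \<Rightarrow> 'a set" where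
  "add_sets A B = {a + b |a b. a \<in> A \<and> b \<in> B}"

text \<open>The second isomorphism theorem on the level of indices: every coset of \<open>H\<close>
  in the sum is already represented in \<open>A\<close>.\<close>

lemma idx_add_sets:
  assumes "add_subgroup H" "add_subgroup A"
  shows "idx (add_sets H A) H = idx A (A \<inter> H)"
proof -
  have "coset H (h + a) = coset H a" if "h \<in> H" for h a
    using that coset_eq_iff[OF assms(1)] by simp
  then have "coset H ` add_sets H A = coset H ` A"
    using add_subgroup_0[OF assms(1)] unfolding add_sets_def by (force simp: image_def)
  moreover have "idx A (A \<inter> H) = card (coset H ` A)"
    using assms by (intro idx_eq_card_image add_subgroup_Int) (auto simp: coset_eq_iff add_subgroup_diff)
  ultimately show ?thesis by (simp add: idx_def)
qed

text \<open>The intermediate group \<open>M\<close> is H enlarged by the kernel. Above it the index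
  is seen in the images; below it every coset of \<open>H\<close> has a representative in the
  kernel.\<close>

lemma idx_hom:
  fixes \<delta> :: "'a::group_add \<Rightarrow> 'b::group_add"
  assumes E: "add_subgroup E" and H: "add_subgroup H" "H \<subseteq> E"
    and \<delta>: "\<And>x y. x \<in> E \<Longrightarrow> y \<in> E \<Longrightarrow> \<delta> (x - y) = \<delta> x - \<delta> y"
  shows "idx E H = idx (\<delta> ` E) (\<delta> ` H) * idx {x \<in> E. \<delta> x = 0} {x \<in> H. \<delta> x = 0}"
proof -
  define M where "M = {x \<in> E. \<delta> x \<in> \<delta> ` H}"
  let ?N = "{x \<in> E. \<delta> x = 0}"
  have \<delta>0: "\<delta> 0 = 0" using \<delta>[of 0 0] add_subgroup_0[OF E] by simp
  have im: "add_subgroup (\<delta> ` H)" unfolding add_subgroup_def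
  proof (intro conjI ballI)
    show "0 \<in> \<delta> ` H" using add_subgroup_0[OF H(1)] \<delta>0 by (metis imageI)
    fix a b assume "a \<in> \<delta> ` H" "b \<in> \<delta> ` H"
    then obtain x y where xy: "x \<in> H" "y \<in> H" "a = \<delta> x" "b = \<delta> y" by blast
    then have "a - b = \<delta> (x - y)" using \<delta>[of x y] H(2) by (simp add: subset_iff)
    then show "a - b \<in> \<delta> ` H" using xy add_subgroup_diff[OF H(1)] by blast
  qed
  have M: "add_subgroup M" unfolding add_subgroup_def
  proof (intro conjI ballI)
    show "0 \<in> M" using add_subgroup_0[OF im] add_subgroup_0[OF E] \<delta>0 by (simp add: M_def)
    show "x - y \<in> M" if "x \<in> M" "y \<in> M" for x y
      using that \<delta>[of x y] add_subgroup_diff[OF im, of "\<delta> x" "\<delta> y"] add_subgroup_diff[OF E, of x y]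
      by (simp add: M_def)
  qed
  have HM: "H \<subseteq> M" using H by (auto simp: M_def)
  have "idx E H = idx E M * idx M H"
    using M HM E H by (intro idx_tower) (auto simp: M_def)
  also have "idx E M = idx (\<delta> ` E) (\<delta> ` H)"
  proof -
    have "idx E M = card ((\<lambda>x. coset (\<delta> ` H) (\<delta> x)) ` E)"
    proof (rule idx_eq_card_image[OF M])
      fix x y assume "x \<in> E" "y \<in> E"
      then show "coset (\<delta> ` H) (\<delta> x) = coset (\<delta> ` H) (\<delta> y) \<longleftrightarrow> x - y \<in> M"
        using coset_eq_iff[OF im] \<delta>[of x y] add_subgroup_diff[OF E] by (auto simp: M_def)
    qed
    then show ?thesis by (simp add: idx_def image_image)
  qed
  also have "idx M H = idx ?N {x \<in> H. \<delta> x = 0}"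
  proof -
    have "coset H ` M = coset H ` ?N"
    proof
      show "coset H ` ?N \<subseteq> coset H ` M"
        using add_subgroup_0[OF im] by (auto simp: M_def)
      show "coset H ` M \<subseteq> coset H ` ?N"
      proof (rule image_subsetI)
        fix x assume "x \<in> M"
        then obtain h where h: "x \<in> E" "h \<in> H" "\<delta> x = \<delta> h" by (auto simp: M_def)
        have mh: "- h \<in> H" using add_subgroup_uminus H h by auto
        have "\<delta> (- h) = - \<delta> h" using \<delta>[of 0 h] \<delta>0 h H add_subgroup_0[OF E] by auto
        moreover have "\<delta> (- h + x) = \<delta> (- h) - \<delta> (- x)"
          using \<delta>[of "- h" "- x"] mh H h add_subgroup_uminus[OF E] by auto
        moreover have "\<delta> (- x) = - \<delta> x" using \<delta>[of 0 x] \<delta>0 h add_subgroup_0[OF E] by auto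
        ultimately have "- h + x \<in> ?N" using h mh H add_subgroup_add[OF E] by auto
        moreover have "coset H (- h + x) = coset H x" using mh coset_eq_iff[OF H(1)] by simp
        ultimately show "coset H x \<in> coset H ` ?N" by blast
      qed
    qed
    then have "idx M H = card (coset H ` ?N)" by (simp add: idx_def)
    also have "add_subgroup {x \<in> H. \<delta> x = 0}"
      using H \<delta> \<delta>0 by (auto simp: add_subgroup_def subset_iff)
    then have "card (coset H ` ?N) = idx ?N {x \<in> H. \<delta> x = 0}"
      using E \<delta> by (intro idx_eq_card_image[symmetric]) (auto simp: coset_eq_iff[OF H(1)])
    finally show ?thesis .
  qed
  finally show ?thesis .
qed

lemma idx_inj_image:
  fixes f :: "'a::group_add \<Rightarrow> 'b::group_add"
  assumes K: "add_subgroup K" and H: "add_subgroup H" "H \<subseteq> K"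
    and f: "\<And>x y. x \<in> K \<Longrightarrow> y \<in> K \<Longrightarrow> f (x - y) = f x - f y" "\<And>x. x \<in> K \<Longrightarrow> f x = 0 \<Longrightarrow> x = 0"
  shows "idx (f ` K) (f ` H) = idx K H"
proof -
  have f0: "f 0 = 0" using f(1)[of 0 0] add_subgroup_0[OF K] by simp
  have "{x \<in> K. f x = 0} = {0}" "{x \<in> H. f x = 0} = {0}"
    using f f0 add_subgroup_0[OF K] add_subgroup_0[OF H(1)] H(2) by auto
  moreover have "add_subgroup {0::'a}" by (simp add: add_subgroup_def)
  ultimately show ?thesis using idx_hom[OF K H f(1)] by simp
qed

lemma idx_pos_subset:
  assumes "idx K H \<noteq> 0" "M \<subseteq> K" "0 \<in> M"
  shows "finite (coset H ` M)" "idx M H \<noteq> 0" "idx M H \<le> idx K H"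
proof -
  have f: "finite (coset H ` K)" using assms(1) unfolding idx_def by (meson card.infinite)
  then show "finite (coset H ` M)" using assms(2) by (meson finite_subset image_mono)
  then show "idx M H \<noteq> 0" using assms(3) unfolding idx_def by auto
  show "idx M H \<le> idx K H" unfolding idx_def using f assms(2) by (intro card_mono image_mono)
qed

section \<open>Integer multiples and extensions by infinite cyclic groups\<close>

abbreviation add_grp :: "'a::group_add monoid" where
  "add_grp \<equiv> \<lparr>carrier = UNIV, mult = (+), one = 0\<rparr>"

lemma group_add_grp: "group add_grp"
proof (rule groupI)
  fix x :: 'a
  show "\<exists>y\<in>carrier add_grp. y \<otimes>\<^bsub>add_grp\<^esub> x = \<one>\<^bsub>add_grp\<^esub>"
    by (auto intro: exI[of _ "- x"])
qed (auto simp: add.assoc)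

text \<open>Integer multiples in a possibly noncommutative additive group, taken from the integer
  powers of the corresponding monoid structure.\<close>

definition int_mult :: "int \<Rightarrow> 'a::group_add \<Rightarrow> 'a" where
  "int_mult k x = x [^]\<^bsub>add_grp\<^esub> k"

lemma int_mult_1 [simp]: "int_mult 1 x = x"
  unfolding int_mult_def using group.int_pow_1[OF group_add_grp, of x] by simp

lemma int_mult_0 [simp]: "int_mult 0 x = 0"
  by (simp add: int_mult_def int_pow_def)

lemma int_mult_add: "int_mult (k + l) x = int_mult k x + int_mult l x"
  unfolding int_mult_def using group.int_pow_mult[OF group_add_grp, of x k l] by simp

lemma int_mult_uminus: "int_mult (- k) x = - int_mult k x"
  using int_mult_add[of "-k" k x] by (simp add: eq_neg_iff_add_eq_0)

lemma int_mult_diff: "int_mult (k - l) x = int_mult k x - int_mult l x"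
  using int_mult_add[of k "-l" x] by (simp add: int_mult_uminus)

lemma int_mult_induct [case_names zero add sub]:
  assumes "P 0" "\<And>k. P k \<Longrightarrow> P (k + 1)" "\<And>k. P k \<Longrightarrow> P (k - 1)"
  shows "P (k :: int)"
  using assms by (induction k rule: int_induct[where k = 0]) auto

lemma int_mult_mem: "add_subgroup H \<Longrightarrow> x \<in> H \<Longrightarrow> int_mult k x \<in> H"
  by (induction k rule: int_mult_induct)
    (auto simp: int_mult_add int_mult_diff add_subgroup_0 add_subgroup_add add_subgroup_diff)

lemma int_mult_hom:
  fixes \<delta> :: "'a::group_add \<Rightarrow> int"
  assumes "add_subgroup E" "x \<in> E" "\<And>x y. x \<in> E \<Longrightarrow> y \<in> E \<Longrightarrow> \<delta> (x - y) = \<delta> x - \<delta> y"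
  shows "\<delta> (int_mult k x) = k * \<delta> x"
proof -
  have z: "\<delta> 0 = 0" using assms(3)[of 0 0] add_subgroup_0[OF assms(1)] by simp
  have a: "\<delta> (u + v) = \<delta> u + \<delta> v" if "u \<in> E" "v \<in> E" for u v
    using assms(3)[of "u + v" v] that add_subgroup_add[OF assms(1) that] by simp
  show ?thesis
    by (induction k rule: int_mult_induct)
      (simp_all add: z a assms int_mult_mem int_mult_add int_mult_diff algebra_simps)
qed

lemma int_mult_conj:
  assumes "\<And>h. h \<in> H \<Longrightarrow> w + h - w \<in> H" "\<And>h. h \<in> H \<Longrightarrow> - w + h + w \<in> H" "h \<in> H"
  shows "int_mult k w + h - int_mult k w \<in> H"
proof (induction k rule: int_mult_induct)
  case zero then show ?case using assms(3) by simp
next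
  case (add k)
  have "int_mult (k + 1) w + h - int_mult (k + 1) w = w + (int_mult k w + h - int_mult k w) - w"
    using int_mult_add[of 1 k w] by (simp add: add.commute[of k] diff_conv_add_uminus minus_add add.assoc del: add_uminus_conv_diff)
  then show ?case using assms(1)[OF add] by simp
next
  case (sub k)
  have "int_mult (k - 1) w + h - int_mult (k - 1) w = - w + (int_mult k w + h - int_mult k w) + w"
    using int_mult_add[of "-1" k w] by (simp add: int_mult_uminus diff_conv_add_uminus minus_add add.assoc del: add_uminus_conv_diff)
  then show ?case using assms(2)[OF sub] by simp
qed

lemma int_subgroup_principal:
  fixes S :: "int set"
  assumes "add_subgroup S"
  shows "\<exists>g\<ge>0. S = range ((*) g)"
proof (cases "S = {0}")
  case True then show ?thesis by (intro exI[of _ 0]) auto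
next
  case False
  then obtain x where x: "x \<in> S" "x \<noteq> 0" using add_subgroup_0[OF assms] by blast
  then have "\<exists>n::nat. n > 0 \<and> int n \<in> S"
    using add_subgroup_uminus[OF assms] by (intro exI[of _ "nat \<bar>x\<bar>"]) (auto simp: abs_if)
  define g where "g = (LEAST n::nat. n > 0 \<and> int n \<in> S)"
  have g: "g > 0" "int g \<in> S" using LeastI_ex[OF \<open>\<exists>n::nat. n > 0 \<and> int n \<in> S\<close>] by (auto simp: g_def)
  have mult: "int g * k \<in> S" for k
    by (induction k rule: int_mult_induct)
      (use g assms in \<open>auto simp: algebra_simps add_subgroupD\<close>)
  have "x \<in> range ((*) (int g))" if "x \<in> S" for x
  proof -
    have "x mod int g = x - int g * (x div int g)" by (simp add: minus_mult_div_eq_mod)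
    then have m: "x mod int g \<in> S" using add_subgroup_diff[OF assms that mult] by simp
    have "x mod int g = 0"
    proof (rule ccontr)
      assume "x mod int g \<noteq> 0"
      moreover have nn: "x mod int g \<ge> 0" using g by simp
      ultimately have "nat (x mod int g) > 0" "int (nat (x mod int g)) \<in> S"
        using m by simp_all
      then have "g \<le> nat (x mod int g)" unfolding g_def by (intro Least_le) auto
      moreover have "x mod int g < int g" using g by simp
      ultimately show False using nn by linarith
    qed
    then show ?thesis by (auto elim: zmod_eq_0_iff[THEN iffD1, elim_format])
  qed
  then show ?thesis using mult by (intro exI[of _ "int g"]) auto
qed

lemma idx_int_multiples: "g \<ge> 0 \<Longrightarrow> idx UNIV (range ((*) g)) = nat (g::int)"
proof -
  assume g: "g \<ge> 0"
  have s: "add_subgroup (range ((*) g))"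
    unfolding add_subgroup_def by (auto simp: image_iff intro: exI[of _ 0]) (metis right_diff_distrib)
  have "idx UNIV (range ((*) g)) = card ((\<lambda>x. x mod g) ` UNIV)"
    by (intro idx_eq_card_image s) (auto simp: mod_eq_dvd_iff dvd_def image_iff)
  also have "\<dots> = nat g"
  \<comment> \<open>For g = 0 the index is infinite, and both sides are 0.\<close>
  proof (cases "g = 0")
    case True then show ?thesis by (simp add: infinite_UNIV_int)
  next
    case False
    have "(\<lambda>x. x mod g) ` UNIV = {0..<g}"
    proof
      show "{0..<g} \<subseteq> (\<lambda>x. x mod g) ` UNIV" by (auto intro!: image_eqI[of x _ x for x])
    qed (use False g in auto)
    then show ?thesis by simp
  qed
  finally show ?thesis .
qed

text \<open>The extensions \<open>H\<close> of \<open>H0\<close> by \<open>m\<int>\<close> inside \<open>E\<close> form a torsor under \<open>N / H0\<close>.\<close>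

lemma bij_extensions:
  fixes \<delta> :: "'a::group_add \<Rightarrow> int"
  assumes E: "add_subgroup E" and \<delta>: "\<And>x y. x \<in> E \<Longrightarrow> y \<in> E \<Longrightarrow> \<delta> (x - y) = \<delta> x - \<delta> y"
    and N: "N = {x \<in> E. \<delta> x = 0}"
    and v: "v \<in> E" "\<delta> v = m" "m \<noteq> 0"
    and H0: "add_subgroup H0" "H0 \<subseteq> N"
    and conj: "\<And>w h. w \<in> E \<Longrightarrow> \<delta> w = m \<Longrightarrow> h \<in> H0 \<Longrightarrow> w + h - w \<in> H0"
      "\<And>w h. w \<in> E \<Longrightarrow> \<delta> w = m \<Longrightarrow> h \<in> H0 \<Longrightarrow> - w + h + w \<in> H0"
  shows "bij_betw (\<lambda>H. {a \<in> N. a + v \<in> H})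
    {H. add_subgroup H \<and> H \<subseteq> E \<and> H \<inter> N = H0 \<and> \<delta> ` H = range ((*) m)} (coset H0 ` N)"
    (is "bij_betw ?f ?\<H> _")
proof (rule bij_betw_imageI)
  have z: "\<delta> 0 = 0" using \<delta>[of 0 0] add_subgroup_0[OF E] by simp
  have neg: "\<delta> (- x) = - \<delta> x" if "x \<in> E" for x
    using \<delta>[of 0 x] that add_subgroup_0[OF E] z by simp
  have add: "\<delta> (x + y) = \<delta> x + \<delta> y" if "x \<in> E" "y \<in> E" for x y
    using \<delta>[of "x + y" y] that add_subgroup_add[OF E that] by simp
  have base: "\<exists>a. a \<in> N \<and> a + v \<in> H" if "H \<in> ?\<H>" for H
  proof -
    have "m \<in> \<delta> ` H" using that by (auto intro: range_eqI[of _ _ 1])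
    then obtain x where x: "x \<in> H" "\<delta> x = m" by auto
    then have "x - v \<in> N" using that v \<delta> add_subgroup_diff[OF E] by (auto simp: N)
    then show ?thesis using x by (intro exI[of _ "x - v"]) simp
  qed
  have diff: "a - a' \<in> H0" if "H \<in> ?\<H>" "a \<in> N" "a + v \<in> H" "a' \<in> N" "a' + v \<in> H" for H a a'
  proof -
    have "(a + v) - (a' + v) \<in> H" using that add_subgroup_diff by auto
    moreover have "(a + v) - (a' + v) = a - a'"
      by (simp add: diff_conv_add_uminus minus_add add.assoc del: add_uminus_conv_diff)
    moreover have "a - a' \<in> N" using that \<delta> E by (auto simp: N add_subgroup_diff)
    ultimately show ?thesis using that by auto
  qed
  have coset: "?f H = coset H0 a" if "H \<in> ?\<H>" "a \<in> N" "a + v \<in> H" for H a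
  proof
    show "?f H \<subseteq> coset H0 a" using diff[OF that(1) _ _ that(2,3)] by (auto simp: mem_coset_iff)
    show "coset H0 a \<subseteq> ?f H"
    proof
      fix b assume "b \<in> coset H0 a"
      then have b: "b - a \<in> H0" by (simp add: mem_coset_iff)
      then have n: "b - a \<in> N" "b - a \<in> H" using that H0 by auto
      have "(b - a) + a \<in> E" "\<delta> ((b - a) + a) = \<delta> (b - a) + \<delta> a"
        using n that add_subgroup_add[OF E] add by (auto simp: N simp del: diff_add_cancel)
      then have "b \<in> N" using n that by (simp add: N)
      moreover have "(b - a) + (a + v) \<in> H" using n that add_subgroup_add by auto
      then have "b + v \<in> H" by (simp add: add.assoc[symmetric])
      ultimately show "b \<in> ?f H" by simp
    qed
  qed
  show "inj_on ?f ?\<H>"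
  proof (rule inj_onI)
    \<comment> \<open>Both subgroups contain the same lift \<open>a + v\<close> of m. Subtracting a
      multiple of it moves x into \<open>N\<close>, where both subgroups equal
      \<open>H0\<close>.\<close>
    have sub: "H \<subseteq> H'" if H: "H \<in> ?\<H>" "H' \<in> ?\<H>" "?f H = ?f H'" for H H'
    proof
      fix x assume x: "x \<in> H"
      obtain a where a: "a \<in> N" "a + v \<in> H" using base[OF H(1)] by blast
      then have a': "a + v \<in> H'" using H(3) by blast
      let ?w = "a + v"
      have w: "?w \<in> E" "\<delta> ?w = m" using a v add add_subgroup_add[OF E] by (auto simp: N)
      obtain k where k: "\<delta> x = m * k" using x H(1) by blast
      have "int_mult k ?w \<in> H" "int_mult k ?w \<in> H'" using a a' H int_mult_mem by auto
      then have "x - int_mult k ?w \<in> H" using x H add_subgroup_diff by auto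
      moreover have "x - int_mult k ?w \<in> N"
        using x H k w \<delta> int_mult_mem[OF E w(1)] int_mult_hom[OF E w(1) \<delta>] add_subgroup_diff[OF E]
        by (auto simp: N)
      ultimately have "x - int_mult k ?w \<in> H'" using H by blast
      then have "(x - int_mult k ?w) + int_mult k ?w \<in> H'"
        using \<open>int_mult k ?w \<in> H'\<close> H add_subgroup_add by blast
      then show "x \<in> H'" by simp
    qed
    fix H H' assume "H \<in> ?\<H>" "H' \<in> ?\<H>" "?f H = ?f H'"
    then show "H = H'" using sub[of H H'] sub[of H' H] by (metis subset_antisym)
  qed
  have surj: "\<exists>H\<in>?\<H>. ?f H = coset H0 a" if a: "a \<in> N" for a
  proof -
    let ?w = "a + v"
    have w: "?w \<in> E" "\<delta> ?w = m" using a v add add_subgroup_add[OF E] by (auto simp: N)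
    define H where "H = {h + int_mult k ?w |h k. h \<in> H0}"
    have H0E: "h \<in> E" "\<delta> h = 0" if "h \<in> H0" for h using that H0 by (auto simp: N)
    have mult: "int_mult k ?w \<in> E" "\<delta> (int_mult k ?w) = k * m" for k
      using int_mult_mem[OF E w(1)] int_mult_hom[OF E w(1) \<delta>] w by auto
    have multH: "int_mult k ?w \<in> H" for k
    proof -
      have "int_mult k ?w = 0 + int_mult k ?w" by simp
      then show ?thesis unfolding H_def using add_subgroup_0[OF H0(1)] by blast
    qed
    have "add_subgroup H" unfolding add_subgroup_def
    proof (intro conjI ballI)
      show "0 \<in> H" unfolding H_def using add_subgroup_0[OF H0(1)]
        by (auto intro!: exI[of _ 0])
      fix x y assume "x \<in> H" "y \<in> H"
      then obtain h k h' k' where x: "x = h + int_mult k ?w" "h \<in> H0" and y: "y = h' + int_mult k' ?w" "h' \<in> H0"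
        by (auto simp: H_def)
      \<comment> \<open>To subtract, -h' has to be moved past a multiple of \<open>?w\<close>; the
        invariance of \<open>H0\<close> under conjugation enters here.\<close>
      let ?c = "int_mult (k - k') ?w + - h' - int_mult (k - k') ?w"
      have "?c \<in> H0" using y add_subgroup_uminus[OF H0(1)] conj[OF w] by (intro int_mult_conj) auto
      then have "h + ?c \<in> H0" using x add_subgroup_add[OF H0(1)] by blast
      moreover have "x - y = (h + ?c) + int_mult (k - k') ?w"
        unfolding x y int_mult_diff by (simp add: diff_conv_add_uminus minus_add add.assoc del: add_uminus_conv_diff)
      ultimately show "x - y \<in> H" unfolding H_def by blast
    qed
    moreover have "H \<subseteq> E" using H0E mult add_subgroup_add[OF E] by (auto simp: H_def)
    moreover have "H \<inter> N = H0"
    proof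
      show "H \<inter> N \<subseteq> H0"
      proof
        fix x assume "x \<in> H \<inter> N"
        then obtain h k where x: "x = h + int_mult k ?w" "h \<in> H0" "\<delta> x = 0" by (auto simp: H_def N)
        then have "k * m = 0" using add[OF H0E(1)[OF x(2)] mult(1)] mult(2) H0E(2)[OF x(2)] by simp
        then show "x \<in> H0" using x v by simp
      qed
      show "H0 \<subseteq> H \<inter> N"
      proof
        fix x assume x: "x \<in> H0"
        have "x = x + int_mult 0 ?w" by simp
        then show "x \<in> H \<inter> N" using x H0 unfolding H_def by blast
      qed
    qed
    moreover have "\<delta> ` H = range ((*) m)"
    proof
      show "\<delta> ` H \<subseteq> range ((*) m)"
        using add[OF H0E(1) mult(1)] mult(2) H0E(2) by (auto simp: H_def)
      show "range ((*) m) \<subseteq> \<delta> ` H"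
      proof clarify
        fix k
        show "m * k \<in> \<delta> ` H" using multH[of k] mult(2)[of k] by (metis image_eqI mult.commute)
      qed
    qed
    moreover have "?w \<in> H" using multH[of 1] by simp
    ultimately show ?thesis using coset[of H a] a by blast
  qed
  show "?f ` ?\<H> = coset H0 ` N"
  proof
    show "?f ` ?\<H> \<subseteq> coset H0 ` N"
    proof (rule image_subsetI)
      fix H assume H: "H \<in> ?\<H>"
      obtain a where "a \<in> N" "a + v \<in> H" using base[OF H] by blast
      then show "?f H \<in> coset H0 ` N" using coset[OF H] by blast
    qed
    show "coset H0 ` N \<subseteq> ?f ` ?\<H>"
    proof (rule image_subsetI)
      fix a assume "a \<in> N"
      from surj[OF this] show "coset H0 a \<in> ?f ` ?\<H>"
        by (elim bexE) (rule image_eqI[OF HOL.sym])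
    qed
  qed
qed

section \<open>Counting subspaces\<close>

text \<open>The ambient type is a commutative ring so that multiplying a vector by an integer is a
  product in the type; for functions into the integers the product is pointwise.\<close>

lemma of_nat_mult_mem: "add_subgroup H \<Longrightarrow> x \<in> H \<Longrightarrow> of_nat n * x \<in> H" for x :: "'a::comm_ring_1"
  by (induction n) (auto simp: add_subgroup_0 add_subgroup_add distrib_right)

lemma of_int_mult_mem: "add_subgroup H \<Longrightarrow> x \<in> H \<Longrightarrow> of_int n * x \<in> H" for x :: "'a::comm_ring_1"
  by (cases n rule: int_cases2) (auto simp: of_nat_mult_mem add_subgroup_uminus)

definition adjoin :: "'a::comm_ring_1 set \<Rightarrow> 'a \<Rightarrow> 'a set" where
  "adjoin H x = {h + of_int k * x |h k. h \<in> H}"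

lemma adjoin:
  assumes "add_subgroup H"
  shows "add_subgroup (adjoin H x)" "H \<subseteq> adjoin H x" "x \<in> adjoin H x"
proof -
  show "add_subgroup (adjoin H x)" unfolding add_subgroup_def
  proof (intro conjI ballI)
    have "0 = 0 + of_int 0 * x" by simp
    then show "0 \<in> adjoin H x" unfolding adjoin_def using add_subgroup_0[OF assms] by blast
    fix a b assume "a \<in> adjoin H x" "b \<in> adjoin H x"
    then obtain h k h' k' where *: "a = h + of_int k * x" "b = h' + of_int k' * x" "h \<in> H" "h' \<in> H"
      by (auto simp: adjoin_def)
    then have "a - b = (h - h') + of_int (k - k') * x" by (simp add: algebra_simps)
    then show "a - b \<in> adjoin H x" unfolding adjoin_def using * add_subgroup_diff[OF assms] by blast
  qed
  show "H \<subseteq> adjoin H x"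
  proof
    fix h assume "h \<in> H"
    moreover have "h = h + of_int 0 * x" by simp
    ultimately show "h \<in> adjoin H x" unfolding adjoin_def by blast
  qed
  have "x = 0 + of_int 1 * x" by simp
  then show "x \<in> adjoin H x" unfolding adjoin_def using add_subgroup_0[OF assms] by blast
qed

lemma adjoin_least: "add_subgroup K \<Longrightarrow> H \<subseteq> K \<Longrightarrow> x \<in> K \<Longrightarrow> adjoin H x \<subseteq> K"
  by (auto simp: adjoin_def intro!: add_subgroup_add of_int_mult_mem)

lemma adjoin_subset_add_sets: "add_subgroup L \<Longrightarrow> x \<in> L \<Longrightarrow> adjoin M x \<subseteq> add_sets M L"
  unfolding adjoin_def add_sets_def using of_int_mult_mem by blast

lemma add_sets_least: "add_subgroup E \<Longrightarrow> A \<subseteq> E \<Longrightarrow> B \<subseteq> E \<Longrightarrow> add_sets A B \<subseteq> E"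
  unfolding add_sets_def using add_subgroup_add by blast

text \<open>A prime index leaves no room for a subgroup strictly between M and E.\<close>

lemma adjoin_maximal:
  fixes E :: "'a::comm_ring_1 set"
  assumes "prime p" "add_subgroup E" "add_subgroup M" "M \<subseteq> E" "idx E M = p" "x \<in> E" "x \<notin> M"
  shows "adjoin M x = E"
proof -
  note a = adjoin[OF assms(3), of x]
  have s: "adjoin M x \<subseteq> E" using adjoin_least assms by blast
  have "p = idx E (adjoin M x) * idx (adjoin M x) M"
    using idx_tower[OF assms(3) a(1) assms(2) a(2) s] assms(5) by simp
  moreover have "idx (adjoin M x) M \<noteq> 1" using idx_1_imp_eq[OF assms(3) a(2)] a(3) assms(7) by blast
  ultimately have "idx E (adjoin M x) = 1"
    using assms(1) by (metis dvd_triv_right nat_mult_eq_1_iff prime_nat_iff mult_cancel_right mult_1 not_prime_0)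
  then show ?thesis using idx_1_imp_eq[OF a(1) s] by simp
qed

lemma idx_adjoin_le:
  fixes M :: "'a::comm_ring_1 set"
  assumes "add_subgroup M" "of_nat p * x \<in> M" "p > 0"
  shows "idx (adjoin M x) M \<le> p"
proof -
  have "coset M ` adjoin M x \<subseteq> (\<lambda>k. coset M (of_nat k * x)) ` {..<p}"
  proof (rule image_subsetI)
    fix y assume "y \<in> adjoin M x"
    then obtain h k where y: "y = h + of_int k * x" "h \<in> M" by (auto simp: adjoin_def)
    let ?r = "nat (k mod int p)"
    have "of_int k * x - of_nat ?r * x = of_int (k div int p) * (of_nat p * x)"
    proof -
      have "k = int p * (k div int p) + int ?r" using assms(3) by simp
      then have "(of_int k :: 'a) = of_int (int p * (k div int p) + int ?r)" by (rule arg_cong)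
      then have "(of_int k :: 'a) = of_nat p * of_int (k div int p) + of_nat ?r"
        by (simp only: of_int_add of_int_mult of_int_of_nat_eq)
      then show ?thesis by (simp only:) (simp add: algebra_simps)
    qed
    then have "of_int k * x - of_nat ?r * x \<in> M" using of_int_mult_mem[OF assms(1,2)] by metis
    then have "h + (of_int k * x - of_nat ?r * x) \<in> M" using y add_subgroup_add[OF assms(1)] by blast
    then have "coset M y = coset M (of_nat ?r * x)"
      using coset_eq_iff[OF assms(1)] y by (simp add: add_diff_eq)
    moreover have "?r < p" using assms(3) by (simp add: nat_less_iff)
    ultimately show "coset M y \<in> (\<lambda>k. coset M (of_nat k * x)) ` {..<p}" by blast
  qed
  then have "idx (adjoin M x) M \<le> card ((\<lambda>k. coset M (of_nat k * x)) ` {..<p})"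
    unfolding idx_def by (intro card_mono) auto
  also have "\<dots> \<le> p" using card_image_le[of "{..<p}"] by fastforce
  finally show ?thesis .
qed

text \<open>Among the proper subgroups containing U, one with the largest index over U exists, since
  these indices are bounded. Adjoining any further vector to it yields E, and p-torsion bounds that
  step by p.\<close>

lemma exists_maximal:
  fixes E :: "'a::comm_ring_1 set"
  assumes p: "prime p" and "add_subgroup E" "add_subgroup U" "U \<subseteq> E" "idx E U = p ^ Suc D"
    and tor: "\<And>x. x \<in> E \<Longrightarrow> of_nat p * x \<in> U"
  shows "\<exists>M. add_subgroup M \<and> U \<subseteq> M \<and> M \<subseteq> E \<and> idx E M = p"
proof -
  let ?P = "\<lambda>M. add_subgroup M \<and> U \<subseteq> M \<and> M \<subseteq> E \<and> M \<noteq> E"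
  have p1: "p > 1" using p prime_gt_1_nat by blast
  have ne: "U \<noteq> E" using assms(5) idx_same[OF assms(2)] p1 by (metis one_less_power less_irrefl zero_less_Suc)
  have "idx M U \<le> p ^ Suc D" if "?P M" for M
    using idx_pos_subset(3)[of E U M] that assms(5) p1 add_subgroup_0 by auto
  then have "\<exists>M. ?P M \<and> (\<forall>M'. ?P M' \<longrightarrow> idx M' U \<le> idx M U)"
    using ex_has_greatest_nat[of ?P U "\<lambda>M. idx M U" "Suc (p ^ Suc D)"] assms ne by (auto simp: less_Suc_eq_le)
  then obtain M where M: "?P M" "\<And>M'. ?P M' \<Longrightarrow> idx M' U \<le> idx M U" by blast
  then obtain v where v: "v \<in> E" "v \<notin> M" by blast
  note a = adjoin[of M v]
  have tow: "idx E U = idx E M * idx M U" using M assms by (intro idx_tower) auto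
  then have pos: "idx M U > 0" using assms(5) p1 by (metis gr0I mult_0_right power_not_zero not_less_zero)
  have "adjoin M v = E"
  proof (rule ccontr)
    assume "adjoin M v \<noteq> E"
    then have P: "?P (adjoin M v)" using a adjoin_least[of E M v] M v assms by blast
    have "idx (adjoin M v) U = idx (adjoin M v) M * idx M U"
      using M a assms(3) by (intro idx_tower) auto
    moreover have "idx (adjoin M v) U \<noteq> 0"
      using idx_pos_subset(2)[of E U "adjoin M v"] P assms(5) p1 add_subgroup_0[of "adjoin M v"] by auto
    moreover have "idx (adjoin M v) M \<noteq> 1" using idx_1_imp_eq[of M "adjoin M v"] a M v by blast
    ultimately have "idx (adjoin M v) U > idx M U" by (cases "idx (adjoin M v) M") auto
    then show False using M(2)[OF P] by simp
  qed
  then have le: "idx E M \<le> p" using idx_adjoin_le[of M p v] M v tor p1 by auto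
  have "idx E M dvd p ^ Suc D" using tow assms(5) by (metis dvd_triv_left)
  then obtain j where j: "idx E M = p ^ j" using divides_primepow_nat[OF p] by blast
  have "idx E M \<noteq> 1" using idx_1_imp_eq M by blast
  then have "j \<noteq> 0" using j by (metis power_0)
  moreover have "j \<le> 1" using le j p1 by (metis power_one_right power_le_imp_le_exp)
  ultimately have "j = 1" by simp
  then show ?thesis using M j by auto
qed

text \<open>A finite analogue of \<open>bij_extensions\<close>: L is \<open>L0\<close> with one
  element a + v adjoined, and a matters only modulo \<open>L0\<close>. Since p times that element
  already lies in \<open>L0\<close>, the intersection with M does not grow.\<close>

lemma bij_subgroups_not_le:
  fixes E :: "'a::comm_ring_1 set"
  assumes p: "prime p" and E: "add_subgroup E" and M: "add_subgroup M" "M \<subseteq> E" "idx E M = p"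
    and L0: "add_subgroup L0" "L0 \<subseteq> M" and tor: "\<And>x. x \<in> E \<Longrightarrow> of_nat p * x \<in> L0"
    and v: "v \<in> E" "v \<notin> M"
  shows "bij_betw (\<lambda>L. {a \<in> M. a + v \<in> L})
    {L. add_subgroup L \<and> L \<subseteq> E \<and> L \<inter> M = L0 \<and> \<not> L \<subseteq> M} (coset L0 ` M)"
    (is "bij_betw ?f ?\<L> _")
proof (rule bij_betw_imageI)
  have Ev: "\<exists>e k. e \<in> M \<and> x = e + of_int k * w" if "x \<in> E" "w \<in> E" "w \<notin> M" for x w
    using adjoin_maximal[OF p E M that(2,3)] that(1) unfolding adjoin_def by blast
  have base: "\<exists>a. a \<in> M \<and> a + v \<in> L" if L: "L \<in> ?\<L>" for L
  proof -
    obtain x where x: "x \<in> L" "x \<notin> M" using L by blast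
    then obtain e k where e: "e \<in> M" "v = e + of_int k * x" using Ev[OF v(1), of x] L by blast
    then have "- e + v \<in> L" using x L of_int_mult_mem by auto
    then show ?thesis using e add_subgroup_uminus[OF M(1)] by blast
  qed
  have coset: "?f L = coset L0 a" if L: "L \<in> ?\<L>" and a: "a \<in> M" "a + v \<in> L" for L a
  proof
    have L': "add_subgroup L" "L \<inter> M = L0" using L by auto
    show "?f L \<subseteq> coset L0 a"
    proof
      fix b assume b: "b \<in> ?f L"
      have "(b + v) - (a + v) \<in> L" using a b L' add_subgroup_diff by blast
      moreover have "(b + v) - (a + v) = b - a" by simp
      moreover have "b - a \<in> M" using a b add_subgroup_diff[OF M(1)] by blast
      ultimately show "b \<in> coset L0 a" using L' by (simp add: mem_coset_iff) blast
    qed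
    show "coset L0 a \<subseteq> ?f L"
    proof
      fix b assume "b \<in> coset L0 a"
      then have n: "b - a \<in> M" "b - a \<in> L" using L' by (auto simp: mem_coset_iff)
      have "(b - a) + a \<in> M" "(b - a) + (a + v) \<in> L" 
        using n a L' add_subgroup_add[OF M(1)] add_subgroup_add[OF L'(1)] by blast+
      moreover have "(b - a) + a = b" "(b - a) + (a + v) = b + v" by simp_all
      ultimately show "b \<in> ?f L" by simp
    qed
  qed
  show "inj_on ?f ?\<L>"
  proof (rule inj_onI)
    have sub: "L \<subseteq> L'" if L: "L \<in> ?\<L>" and L': "L' \<in> ?\<L>" and eq: "?f L = ?f L'" for L L'
    proof
      fix x assume x: "x \<in> L"
      obtain a where a: "a \<in> M" "a + v \<in> L" using base[OF L] by blast
      then have a': "a + v \<in> L'" using eq by blast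
      let ?w = "a + v"
      have "?w \<notin> M"
      proof
        assume "?w \<in> M"
        then have "?w - a \<in> M" using a add_subgroup_diff[OF M(1)] by blast
        then show False using v by simp
      qed
      then obtain e k where e: "e \<in> M" "x = e + of_int k * ?w" using Ev[of x ?w] x a L by blast
      have w: "of_int k * ?w \<in> L" "of_int k * ?w \<in> L'" using a a' L L' of_int_mult_mem by auto
      then have "x - of_int k * ?w \<in> L" using x L add_subgroup_diff by blast
      then have "e \<in> L" using e by simp
      then have "e \<in> L'" using e L L' by blast
      then show "x \<in> L'" using w e L' add_subgroup_add by auto
    qed
    fix L L' assume "L \<in> ?\<L>" "L' \<in> ?\<L>" "?f L = ?f L'"
    then show "L = L'" using sub[of L L'] sub[of L' L] by (metis subset_antisym)
  qed
  have surj: "\<exists>L\<in>?\<L>. ?f L = coset L0 a" if a: "a \<in> M" for a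
  proof -
    let ?w = "a + v"
    have w: "?w \<in> E" "?w \<notin> M"
    proof -
      show "?w \<in> E" using a v M add_subgroup_add[OF E] by blast
      show "?w \<notin> M"
      proof
        assume "?w \<in> M"
        then have "?w - a \<in> M" using a add_subgroup_diff[OF M(1)] by blast
        then show False using v by simp
      qed
    qed
    define L where "L = adjoin L0 ?w"
    note ad = adjoin[OF L0(1), of ?w, folded L_def]
    have "L \<inter> M = L0"
    proof
      show "L \<inter> M \<subseteq> L0"
      proof
        fix x assume "x \<in> L \<inter> M"
        then obtain h k where x: "x = h + of_int k * ?w" "h \<in> L0" "x \<in> M" by (auto simp: L_def adjoin_def)
        then have "x - h \<in> M" using L0 add_subgroup_diff[OF M(1)] by blast
        then have kw: "of_int k * ?w \<in> M" using x by simp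
        have "int p dvd k"
        proof (rule ccontr)
          assume "\<not> int p dvd k"
          then have "coprime (int p) k" using p prime_imp_coprime[of "int p" k] by simp
          then obtain s t where st: "s * int p + t * k = 1" using bezout_int[of "int p" k] by auto
          have "?w = of_int (s * int p + t * k) * ?w" unfolding st by simp
          also have "\<dots> = of_int s * (of_nat p * ?w) + of_int t * (of_int k * ?w)"
            by (simp add: algebra_simps)
          also have "\<dots> \<in> M" using tor[OF w(1)] L0 kw of_int_mult_mem[OF M(1)] add_subgroup_add[OF M(1)] by blast
          finally show False using w by simp
        qed
        then obtain l where "k = int p * l" by (elim dvdE)
        then have "of_int k * ?w = of_int l * (of_nat p * ?w)" by simp
        then have "of_int k * ?w \<in> L0" using tor[OF w(1)] of_int_mult_mem[OF L0(1)] by metis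
        then show "x \<in> L0" using x add_subgroup_add[OF L0(1)] by blast
      qed
    qed (use ad L0 in blast)
    moreover have "L \<subseteq> E" using adjoin_least[OF E, of L0 ?w] L0 M w unfolding L_def by blast
    ultimately have "L \<in> ?\<L>" using ad w by blast
    then show ?thesis using coset[of L a] a ad by blast
  qed
  show "?f ` ?\<L> = coset L0 ` M"
  proof
    show "?f ` ?\<L> \<subseteq> coset L0 ` M"
    proof (rule image_subsetI)
      fix L assume L: "L \<in> ?\<L>"
      obtain a where "a \<in> M" "a + v \<in> L" using base[OF L] by blast
      then show "?f L \<in> coset L0 ` M" using coset[OF L] by blast
    qed
    show "coset L0 ` M \<subseteq> ?f ` ?\<L>"
    proof (rule image_subsetI)
      fix a assume "a \<in> M"
      from surj[OF this] show "coset L0 a \<in> ?f ` ?\<L>"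
        by (elim bexE) (rule image_eqI[OF HOL.sym])
    qed
  qed
qed

lemma card_UN_const:
  assumes "finite I" "\<And>i. i \<in> I \<Longrightarrow> finite (A i) \<and> card (A i) = c"
    "\<And>i j. i \<in> I \<Longrightarrow> j \<in> I \<Longrightarrow> i \<noteq> j \<Longrightarrow> A i \<inter> A j = {}"
  shows "card (\<Union>i\<in>I. A i) = card I * c"
  using assms by (subst card_UN_disjoint) auto

text \<open>Subspaces of the \<open>\<int>/p\<close>-space \<open>E / Z\<close> are encoded as the subgroups between \<open>Z\<close> and \<open>E\<close>. The induction
  on \<open>D\<close> splits them according to whether they lie in a fixed hyperplane containing \<open>U\<close>.\<close>

lemma card_subgroups_meeting_trivially:
  fixes E :: "'a::comm_ring_1 set"
  assumes p: "prime p" and "add_subgroup E" "add_subgroup U" "add_subgroup Z" "Z \<subseteq> U" "U \<subseteq> E"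
    and tor: "\<And>x. x \<in> E \<Longrightarrow> of_nat p * x \<in> Z" and "idx E U = p ^ D" "idx U Z = p ^ u"
  shows "finite {L. add_subgroup L \<and> Z \<subseteq> L \<and> L \<subseteq> E \<and> L \<inter> U = Z \<and> idx L Z = p ^ s} \<and>
    card {L. add_subgroup L \<and> Z \<subseteq> L \<and> L \<subseteq> E \<and> L \<inter> U = Z \<and> idx L Z = p ^ s} = p ^ (u * s) * qbinom p D s"
  using assms
proof (induction D arbitrary: E s)
  case 0
  note Z = 0(4)
  have p1: "p > 1" using prime_gt_1_nat[OF 0(1)] .
  have UE: "U = E" using idx_1_imp_eq[OF 0(3,6)] 0(8) by simp
  have LZ: "L = Z" if "L \<subseteq> E" "L \<inter> U = Z" for L using that UE by blast
  have "p ^ s = 1 \<longleftrightarrow> s = 0" using p1 by simp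
  then have i: "idx Z Z = p ^ s \<longleftrightarrow> s = 0"
    unfolding idx_same[OF Z] by (simp only: eq_commute[of 1 "p ^ s"])
  have eq: "{L. add_subgroup L \<and> Z \<subseteq> L \<and> L \<subseteq> E \<and> L \<inter> U = Z \<and> idx L Z = p ^ s} = (if s = 0 then {Z} else {})"
  proof (intro Set.set_eqI iffI)
    fix L assume L: "L \<in> {L. add_subgroup L \<and> Z \<subseteq> L \<and> L \<subseteq> E \<and> L \<inter> U = Z \<and> idx L Z = p ^ s}"
    then have "L \<subseteq> E" "L \<inter> U = Z" by simp_all
    then have "L = Z" by (rule LZ)
    then show "L \<in> (if s = 0 then {Z} else {})" using L i by simp
  next
    fix L assume "L \<in> (if s = 0 then {Z} else {})"
    then have "L = Z" "s = 0" by (simp_all split: if_splits)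
    then show "L \<in> {L. add_subgroup L \<and> Z \<subseteq> L \<and> L \<subseteq> E \<and> L \<inter> U = Z \<and> idx L Z = p ^ s}"
      using Z 0(5) i unfolding UE by (simp add: Int_absorb2)
  qed
  show ?case unfolding eq by (cases s) simp_all
next
  case (Suc D)
  note p = Suc.prems(1) and E = Suc.prems(2) and U = Suc.prems(3) and Z = Suc.prems(4)
  have p1: "p > 1" using prime_gt_1_nat[OF p] .
  let ?S = "\<lambda>E s. {L. add_subgroup L \<and> Z \<subseteq> L \<and> L \<subseteq> E \<and> L \<inter> U = Z \<and> idx L Z = p ^ s}"
  obtain M where M: "add_subgroup M" "U \<subseteq> M" "M \<subseteq> E" "idx E M = p"
    using exists_maximal[OF p E U, of D] Suc.prems by blast
  have "idx E U = idx E M * idx M U" using M E U by (intro idx_tower)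
  then have MU: "idx M U = p ^ D" using Suc.prems M p1 by simp
  have MZ: "idx M Z = p ^ (D + u)"
    using idx_tower[OF Z U M(1)] M Suc.prems MU by (simp add: power_add)
  have IH: "finite (?S M t) \<and> card (?S M t) = p ^ (u * t) * qbinom p D t" for t
    using Suc.IH[of M t] Suc.prems M MU by blast
  show ?case
  proof (cases s)
    case 0
    have "?S E s = {Z}"
    proof
      show "?S E s \<subseteq> {Z}" using idx_1_imp_eq[OF Z] 0 by auto
      show "{Z} \<subseteq> ?S E s" using Suc.prems 0 idx_same[OF Z] by auto
    qed
    then show ?thesis using 0 by simp
  next
    case (Suc t)
    let ?B = "\<lambda>L0. {L. add_subgroup L \<and> L \<subseteq> E \<and> L \<inter> M = L0 \<and> \<not> L \<subseteq> M}"
    obtain v where v: "v \<in> E" "v \<notin> M" using M p1 idx_same[OF E] by (metis less_irrefl subsetI subset_antisym)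
    have B: "finite (?B L0) \<and> card (?B L0) = p ^ (D - t + u)" if L0: "L0 \<in> ?S M t" for L0
    proof -
      have L0': "add_subgroup L0" "Z \<subseteq> L0" "L0 \<subseteq> M" "idx L0 Z = p ^ t" using L0 by auto
      have b: "bij_betw (\<lambda>L. {a \<in> M. a + v \<in> L}) (?B L0) (coset L0 ` M)"
        by (rule bij_subgroups_not_le[OF p E M(1,3,4) L0'(1,3) _ v]) (use L0' Suc.prems in blast)
      have i: "idx M L0 * p ^ t = p ^ (D + u)"
        using idx_tower[OF Z L0'(1) M(1) L0'(2,3)] L0' MZ by simp
      then have "idx M L0 \<noteq> 0" using p1 by (metis mult_is_0 power_not_zero not_less_zero)
      then have fin: "finite (coset L0 ` M)" unfolding idx_def by (meson card.infinite)
      \<comment> \<open>Needed because \<open>D - t\<close> is a truncated subtraction; for t > D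
        the count is zero and there is no \<open>L0\<close>.\<close>
      have "t \<le> D"
      proof (rule ccontr)
        assume "\<not> t \<le> D"
        then have "card (?S M t) = 0" unfolding conjunct2[OF IH[of t]] by (simp add: qbinom_eq_0)
        then have "?S M t = {}" using conjunct1[OF IH[of t]] by (simp only: card_0_eq)
        then show False using L0 by (simp only: empty_iff)
      qed
      then have "p ^ (D + u) = p ^ (D - t + u) * p ^ t" unfolding power_add[symmetric] by simp
      then have "idx M L0 = p ^ (D - t + u)" using i p1 by simp
      then show ?thesis
        unfolding bij_betw_finite[OF b] bij_betw_same_card[OF b] idx_def using fin by (rule conjI[rotated])
    qed
    \<comment> \<open>A subspace either lies in the hyperplane \<open>M\<close> or is classified by
      its trace \<open>L0\<close> on \<open>M\<close>, which has one dimension less.\<close>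
    have dec: "?S E s = ?S M s \<union> (\<Union>L0\<in>?S M t. ?B L0)"
    proof
      show "?S E s \<subseteq> ?S M s \<union> (\<Union>L0\<in>?S M t. ?B L0)"
      proof
        fix L assume L: "L \<in> ?S E s"
        show "L \<in> ?S M s \<union> (\<Union>L0\<in>?S M t. ?B L0)"
        proof (cases "L \<subseteq> M")
          case False
          then obtain x where x: "x \<in> L" "x \<notin> M" by blast
          have "adjoin M x \<subseteq> add_sets M L" using adjoin_subset_add_sets x L by blast
          moreover have "add_sets M L \<subseteq> E" using add_sets_least[OF E M(3)] L by blast
          moreover have "adjoin M x = E" using adjoin_maximal[OF p E M(1,3,4)] x L by blast
          ultimately have "add_sets M L = E" by blast
          then have LM: "idx L (L \<inter> M) = p" using idx_add_sets[OF M(1), of L] L M by auto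
          have s: "add_subgroup (L \<inter> M)" using L M by (auto intro: add_subgroup_Int)
          have "idx L Z = idx L (L \<inter> M) * idx (L \<inter> M) Z"
            using L M Suc.prems s by (intro idx_tower) auto
          then have "idx (L \<inter> M) Z = p ^ t" using LM L Suc p1 by simp
          then have "L \<inter> M \<in> ?S M t" using L M Suc.prems s by auto
          then show ?thesis using L False by blast
        qed (use L in blast)
      qed
      show "?S M s \<union> (\<Union>L0\<in>?S M t. ?B L0) \<subseteq> ?S E s"
      proof (intro Un_least UN_least subsetI)
        fix L assume "L \<in> ?S M s" then show "L \<in> ?S E s" using M by blast
      next
        fix L L0 assume L0: "L0 \<in> ?S M t" and L: "L \<in> ?B L0"
        then obtain x where x: "x \<in> L" "x \<notin> M" by blast
        have "adjoin M x \<subseteq> add_sets M L" using adjoin_subset_add_sets x L by blast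
        moreover have "add_sets M L \<subseteq> E" using add_sets_least[OF E M(3)] L by blast
        moreover have "adjoin M x = E" using adjoin_maximal[OF p E M(1,3,4)] x L by blast
        ultimately have "add_sets M L = E" by blast
        then have LM: "idx L L0 = p" using idx_add_sets[OF M(1), of L] L M by auto
        have "idx L Z = idx L L0 * idx L0 Z"
          using L L0 Z by (intro idx_tower) auto
        then have "idx L Z = p ^ s" using LM L0 Suc by simp
        moreover have "L \<inter> U = Z" using L L0 M by blast
        ultimately show "L \<in> ?S E s" using L L0 by blast
      qed
    qed
    have fin: "finite (\<Union>L0\<in>?S M t. ?B L0)" using IH B by blast
    have "card (?S E s) = card (?S M s) + card (\<Union>L0\<in>?S M t. ?B L0)"
      unfolding dec using IH[of s] fin by (intro card_Un_disjoint) auto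
    also have "card (\<Union>L0\<in>?S M t. ?B L0) = card (?S M t) * p ^ (D - t + u)"
      using IH[of t] B by (intro card_UN_const) auto
    \<comment> \<open>As s = t + 1, the factors p^u and p^(u t) combine to p^(u s); what is left is
      the defining Pascal rule of \<open>qbinom\<close>.\<close>
    also have "card (?S M s) + card (?S M t) * p ^ (D - t + u) = p ^ (u * s) * qbinom p (Suc D) s"
      unfolding conjunct2[OF IH] unfolding Suc by (simp add: power_add algebra_simps)
    finally show ?thesis using IH[of s] fin unfolding dec by blast
  qed
qed

section \<open>Counting sublattices\<close>

abbreviation scale :: "nat \<Rightarrow> 'a::comm_ring_1 set \<Rightarrow> 'a set" where
  "scale p E \<equiv> (*) (of_nat p) ` E"

text \<open>A substitute for freeness of rank d: the order of E / p E and the absence of p-torsion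
  pass to subgroups of finite index without any choice of basis.\<close>

definition rank_mod :: "nat \<Rightarrow> nat \<Rightarrow> 'a::comm_ring_1 set \<Rightarrow> bool" where
  "rank_mod p d E \<longleftrightarrow> add_subgroup E \<and> idx E (scale p E) = p ^ d \<and> (\<forall>x\<in>E. of_nat p * x = 0 \<longrightarrow> x = 0)"

definition preim :: "nat \<Rightarrow> 'a::comm_ring_1 set \<Rightarrow> 'a set \<Rightarrow> 'a set" where
  "preim p E L = {x \<in> E. of_nat p * x \<in> L}"

lemma add_subgroup_scale: "add_subgroup E \<Longrightarrow> add_subgroup (scale p E)" for E :: "'a::comm_ring_1 set"
proof -
  assume E: "add_subgroup E"
  show ?thesis unfolding add_subgroup_def
  proof (intro conjI ballI)
    show "0 \<in> scale p E" using add_subgroup_0[OF E] by (intro image_eqI[of _ _ 0]) auto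
    fix x y assume "x \<in> scale p E" "y \<in> scale p E"
    then obtain a b where "a \<in> E" "b \<in> E" "x = of_nat p * a" "y = of_nat p * b" by blast
    then show "x - y \<in> scale p E"
      using add_subgroup_diff[OF E] by (intro image_eqI[of _ _ "a - b"]) (auto simp: algebra_simps)
  qed
qed

lemma scale_subset: "add_subgroup E \<Longrightarrow> scale p E \<subseteq> E"
  using of_nat_mult_mem by blast

lemma add_subgroup_add_sets:
  fixes A B :: "'a::ab_group_add set"
  assumes "add_subgroup A" "add_subgroup B"
  shows "add_subgroup (add_sets A B)" "A \<subseteq> add_sets A B" "B \<subseteq> add_sets A B"
    "add_sets A B = add_sets B A"
proof -
  show "add_subgroup (add_sets A B)" unfolding add_subgroup_def
  proof (intro conjI ballI)
    have "0 = 0 + (0::'a)" by simp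
    then show "0 \<in> add_sets A B" unfolding add_sets_def using assms add_subgroup_0 by blast
    fix x y assume "x \<in> add_sets A B" "y \<in> add_sets A B"
    then obtain a b a' b' where *: "x = a + b" "y = a' + b'" "a \<in> A" "b \<in> B" "a' \<in> A" "b' \<in> B"
      by (auto simp: add_sets_def)
    then have "x - y = (a - a') + (b - b')" by simp
    then show "x - y \<in> add_sets A B" unfolding add_sets_def using * assms add_subgroup_diff by blast
  qed
  show "A \<subseteq> add_sets A B"
  proof
    fix a assume "a \<in> A"
    moreover have "a = a + 0" by simp
    ultimately show "a \<in> add_sets A B" unfolding add_sets_def using add_subgroup_0[OF assms(2)] by blast
  qed
  show "B \<subseteq> add_sets A B"
  proof
    fix b assume "b \<in> B"
    moreover have "b = 0 + b" by simp
    ultimately show "b \<in> add_sets A B" unfolding add_sets_def using add_subgroup_0[OF assms(1)] by blast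
  qed
  show "add_sets A B = add_sets B A" unfolding add_sets_def by (auto simp: add.commute) (metis add.commute)+
qed

section \<open>Lattices, their codimension modulo \<open>p\<close>, and division by
  \<open>p\<close>\<close>

locale lattice_setting =
  fixes p d :: nat and E :: "'a::comm_ring_1 set"
  assumes p: "prime p" and E: "rank_mod p d E"
begin

lemma p1: "p > 1" using p prime_gt_1_nat by blast

lemma sgE: "add_subgroup E" and idxE: "idx E (scale p E) = p ^ d"
  and torE: "x \<in> E \<Longrightarrow> of_nat p * x = 0 \<Longrightarrow> x = 0"
  using E by (auto simp: rank_mod_def)

lemma idx_scale:
  assumes "add_subgroup K" "add_subgroup H" "H \<subseteq> K" "K \<subseteq> E"
  shows "idx (scale p K) (scale p H) = idx K H"
  using assms torE by (intro idx_inj_image) (auto simp: algebra_simps)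

text \<open>The index of p L in E is computed through p E and through L; multiplication by p
  preserves the index of L in E.\<close>

lemma rank_mod_subgroup:
  assumes L: "add_subgroup L" "L \<subseteq> E" and "idx E L \<noteq> 0"
  shows "rank_mod p d L"
proof -
  have "idx E (scale p E) * idx (scale p E) (scale p L) = idx E (scale p L)"
    using L sgE by (intro idx_tower[symmetric] add_subgroup_scale scale_subset) auto
  also have "\<dots> = idx E L * idx L (scale p L)"
    using L sgE by (intro idx_tower add_subgroup_scale scale_subset) auto
  finally have "idx L (scale p L) = p ^ d"
    using idx_scale[OF sgE L(1) L(2)] idxE assms(3) by simp
  then show ?thesis using L torE by (auto simp: rank_mod_def)
qed

lemma preim:
  assumes "add_subgroup L" "L \<subseteq> E"
  shows "add_subgroup (preim p E L)" "L \<subseteq> preim p E L" "preim p E L \<subseteq> E"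
    "scale p (preim p E L) = scale p E \<inter> L"
proof -
  show "add_subgroup (preim p E L)"
    using assms sgE unfolding add_subgroup_def preim_def by (auto simp: right_diff_distrib)
  show "L \<subseteq> preim p E L" using assms of_nat_mult_mem by (auto simp: preim_def)
qed (auto simp: preim_def)

text \<open>The codimension of the image of L in E / p E, in relational form; that the index is a
  power of p is the content of \<open>rank_exists\<close>.\<close>

definition rank :: "'a set \<Rightarrow> nat \<Rightarrow> bool" where
  "rank L r \<longleftrightarrow> idx E (add_sets L (scale p E)) = p ^ r"

lemma rank_idx:
  assumes L: "add_subgroup L" "L \<subseteq> E"
  shows "idx E (add_sets L (scale p E)) * idx L (L \<inter> scale p E) = p ^ d"
proof -
  note s = add_subgroup_scale[OF sgE, of p]
  note a = add_subgroup_add_sets[OF L(1) s]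
  have "add_sets L (scale p E) \<subseteq> E"
    by (rule add_sets_least[OF sgE L(2) scale_subset[OF sgE]])
  then have "p ^ d = idx E (add_sets L (scale p E)) * idx (add_sets L (scale p E)) (scale p E)"
    unfolding idxE[symmetric] by (intro idx_tower a s sgE)
  also have "idx (add_sets L (scale p E)) (scale p E) = idx L (L \<inter> scale p E)"
    unfolding a(4) by (rule idx_add_sets[OF s L(1)])
  finally show ?thesis by simp
qed

lemma rank_exists:
  assumes L: "add_subgroup L" "L \<subseteq> E"
  shows "\<exists>r\<le>d. rank L r"
proof -
  have "idx E (add_sets L (scale p E)) dvd p ^ d" using rank_idx[OF L] by (metis dvd_triv_left)
  then show ?thesis unfolding rank_def using divides_primepow_nat[OF p] by blast
qed

lemma rank_unique: "rank L r \<Longrightarrow> rank L r' \<Longrightarrow> r = r'"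
  using p1 power_inject_exp unfolding rank_def by metis

lemma rank_le: "add_subgroup L \<Longrightarrow> L \<subseteq> E \<Longrightarrow> rank L r \<Longrightarrow> r \<le> d"
  using rank_exists rank_unique by metis

text \<open>This is [L] = [M] + r: the index of L in L + p E is that of L \<inter> p E = p M in p E,
  hence that of M in E.\<close>

lemma idx_preim:
  assumes L: "add_subgroup L" "L \<subseteq> E" and "rank L r"
  shows "idx E L = idx E (preim p E L) * p ^ r"
proof -
  note s = add_subgroup_scale[OF sgE, of p]
  note a = add_subgroup_add_sets[OF L(1) s]
  have "add_sets L (scale p E) \<subseteq> E"
    by (rule add_sets_least[OF sgE L(2) scale_subset[OF sgE]])
  then have "idx E L = idx E (add_sets L (scale p E)) * idx (add_sets L (scale p E)) L"
    by (intro idx_tower a L sgE)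
  also have "idx (add_sets L (scale p E)) L = idx (scale p E) (scale p E \<inter> L)"
    by (rule idx_add_sets[OF L(1) s])
  also have "\<dots> = idx E (preim p E L)"
    unfolding preim(4)[OF L, symmetric] using preim[OF L] by (intro idx_scale sgE) auto
  finally show ?thesis using assms(3) by (simp add: rank_def)
qed

lemma preim_eq_iff:
  assumes L: "add_subgroup L" "L \<subseteq> E" and M: "M \<subseteq> E"
  shows "preim p E L = M \<longleftrightarrow> L \<inter> scale p E = scale p M \<and> L \<subseteq> M"
proof
  assume "preim p E L = M"
  then show "L \<inter> scale p E = scale p M \<and> L \<subseteq> M" using preim[OF L] by auto
next
  assume *: "L \<inter> scale p E = scale p M \<and> L \<subseteq> M"
  show "preim p E L = M"
  proof
    show "preim p E L \<subseteq> M"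
    proof
      fix x assume x: "x \<in> preim p E L"
      then have "of_nat p * x \<in> scale p M" using * by (auto simp: preim_def)
      then obtain y where y: "y \<in> M" "of_nat p * x = of_nat p * y" by blast
      then have "of_nat p * (x - y) = 0" by (simp add: algebra_simps)
      moreover have "x - y \<in> E" using x y M add_subgroup_diff[OF sgE] by (auto simp: preim_def)
      ultimately have "x = y" using torE[of "x - y"] by simp
      then show "x \<in> M" using y by simp
    qed
    show "M \<subseteq> preim p E L" using * M by (auto simp: preim_def)
  qed
qed

text \<open>The fixed subspace is (M \<inter> p E) / p M. It has dimension i, since codimension i of
  M means that M / (M \<inter> p E) has dimension d - i. For the same reason L / p M has dimension d
  - r.\<close>

lemma card_preim_fibre:
  assumes M: "add_subgroup M" "M \<subseteq> E" "idx E M \<noteq> 0" "rank M i" and "r \<le> d"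
  shows "finite {L. add_subgroup L \<and> L \<subseteq> E \<and> preim p E L = M \<and> rank L r} \<and>
    card {L. add_subgroup L \<and> L \<subseteq> E \<and> preim p E L = M \<and> rank L r} = trans_coeff p d r i"
proof -
  let ?Z = "scale p M" and ?U = "M \<inter> scale p E"
  note s = add_subgroup_scale[OF sgE, of p]
  have Z: "add_subgroup ?Z" by (rule add_subgroup_scale[OF M(1)])
  have U: "add_subgroup ?U" by (rule add_subgroup_Int[OF M(1) s])
  have sub: "?Z \<subseteq> ?U" using M scale_subset[OF M(1)] by auto
  have id: "i \<le> d" using rank_le M by blast
  have ppos: "p ^ k \<noteq> 0" for k using p1 by simp
  have *: "idx L (L \<inter> scale p E) = p ^ (d - r)" if "add_subgroup L" "L \<subseteq> E" "rank L r" for L r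
  proof -
    have "p ^ r * idx L (L \<inter> scale p E) = p ^ d" using rank_idx[OF that(1,2)] that(3) by (simp add: rank_def)
    also have "p ^ d = p ^ r * p ^ (d - r)" using rank_le[OF that] by (simp add: power_add[symmetric])
    finally show ?thesis using ppos[of r] by (metis mult_cancel_left)
  qed
  have MU: "idx M ?U = p ^ (d - i)" by (rule *[OF M(1,2,4)])
  have "p ^ d = idx M ?Z" using rank_mod_subgroup[OF M(1,2,3)] by (simp add: rank_mod_def)
  also have "\<dots> = idx M ?U * idx ?U ?Z" using sub by (intro idx_tower Z U M) auto
  also have "p ^ d = p ^ (d - i) * p ^ i" using id by (simp add: power_add[symmetric])
  finally have UZ: "idx ?U ?Z = p ^ i" unfolding MU using ppos by (metis mult_cancel_left)
  have "{L. add_subgroup L \<and> L \<subseteq> E \<and> preim p E L = M \<and> rank L r} =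
    {L. add_subgroup L \<and> ?Z \<subseteq> L \<and> L \<subseteq> M \<and> L \<inter> ?U = ?Z \<and> idx L ?Z = p ^ (d - r)}" (is "?A = ?B")
  proof (intro Set.set_eqI iffI)
    fix L assume L: "L \<in> ?A"
    then have "L \<inter> scale p E = ?Z" "L \<subseteq> M" using preim_eq_iff[of L M] M by blast+
    moreover from this have "idx L ?Z = p ^ (d - r)" using *[of L r] L by simp
    ultimately show "L \<in> ?B" using L by blast
  next
    fix L assume L: "L \<in> ?B"
    then have LE: "L \<subseteq> E" "L \<inter> scale p E = ?Z" using M by blast+
    then have P: "preim p E L = M" using preim_eq_iff[of L M] L M by blast
    have sL: "add_subgroup L" "idx L ?Z = p ^ (d - r)" using L by simp_all
    obtain r' where r': "r' \<le> d" "rank L r'" using rank_exists[OF sL(1) LE(1)] by blast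
    have "p ^ (d - r) = p ^ (d - r')" using *[OF sL(1) LE(1) r'(2)] LE(2) sL(2) by simp
    then have "d - r = d - r'" using p1 power_inject_exp by blast
    then have "r = r'" using r' assms by simp
    then show "L \<in> ?A" using sL LE P r' by simp
  qed
  moreover have "of_nat p * x \<in> ?Z" if "x \<in> M" for x using that by blast
  ultimately show ?thesis
    using card_subgroups_meeting_trivially[OF p M(1) U Z sub _ _ MU UZ, of "d - r"]
    by (simp add: trans_coeff_def mult.commute)
qed

text \<open>Lagrange's theorem in the quotient of E by L.\<close>

lemma idx_multiple:
  assumes "add_subgroup L" "L \<subseteq> E" "idx E L = n" "n > 0" "x \<in> E"
  shows "of_nat n * x \<in> L"
proof -
  let ?G = "\<lparr>carrier = E, mult = (+), one = 0 :: 'a\<rparr>"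
  have G: "comm_group ?G"
    by (rule comm_groupI)
      (use sgE in \<open>auto simp: add_subgroupD algebra_simps intro: bexI[of _ "- x" for x]\<close>)
  then interpret comm_group ?G .
  have sub: "subgroup L ?G"
  proof
    show "inv\<^bsub>?G\<^esub> x \<in> L" if "x \<in> L" for x
    proof -
      have "inv\<^bsub>?G\<^esub> x = - x" using that assms(1,2) sgE
        by (intro inv_equality) (auto simp: add_subgroup_uminus)
      then show ?thesis using that assms(1) by (simp add: add_subgroup_uminus)
    qed
  qed (use assms(1,2) in \<open>auto simp: add_subgroupD\<close>)
  then have nor: "L \<lhd> ?G" by (rule subgroup_imp_normal)
  interpret Q: group "?G Mod L" by (rule normal.factorgroup_is_group[OF nor])
  have rc: "L #>\<^bsub>?G\<^esub> y = coset L y" for y by (auto simp: r_coset_def coset_def)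
  then have car: "carrier (?G Mod L) = coset L ` E" by (auto simp: FactGroup_def RCOSETS_def)
  have pow: "y [^]\<^bsub>?G\<^esub> k = of_nat k * y" for y and k :: nat
    by (induction k) (auto simp: nat_pow_def algebra_simps)
  have "order (?G Mod L) = n" using assms(3) by (simp add: order_def car idx_def)
  then have "coset L x [^]\<^bsub>?G Mod L\<^esub> n = \<one>\<^bsub>?G Mod L\<^esub>"
    using Q.pow_order_eq_1[of "coset L x"] assms(5) by (simp add: car)
  moreover have "coset L x [^]\<^bsub>?G Mod L\<^esub> n = coset L (of_nat n * x)"
    using normal.FactGroup_pow[OF nor, of x n] assms(5) by (simp add: rc pow)
  ultimately have "coset L (of_nat n * x) = L" by simp
  then show ?thesis using coset_self[OF assms(1)] by metis
qed

text \<open>An argument in the style of Nakayama: codimension 0 gives M = L, so division by p does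
  not leave L, while p^l E lies in L.\<close>

lemma rank_0_imp_eq:
  assumes L: "add_subgroup L" "L \<subseteq> E" "idx E L = p ^ l" "rank L 0"
  shows "L = E"
proof -
  note P = preim[OF L(1,2)]
  have i: "idx E L = idx E (preim p E L)" using idx_preim[OF L(1,2,4)] by simp
  have "idx E L = idx E (preim p E L) * idx (preim p E L) L" by (intro idx_tower P L sgE)
  moreover have "idx E L \<noteq> 0" using L(3) p1 by simp
  ultimately have "idx (preim p E L) L = 1" using i by (metis mult_cancel_left nat_mult_1_right)
  then have eq: "L = preim p E L" using idx_1_imp_eq[OF L(1) P(2)] by simp
  have down: "x \<in> L" if "x \<in> E" "of_nat (p ^ k) * x \<in> L" for x k
    using that
  proof (induction k)
    case (Suc k)
    have "of_nat p * (of_nat (p ^ k) * x) \<in> L" using Suc.prems by (simp add: mult.assoc)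
    then have "of_nat (p ^ k) * x \<in> preim p E L" using of_nat_mult_mem[OF sgE Suc.prems(1), of "p ^ k"] by (simp add: preim_def)
    then show ?case using Suc eq by blast
  qed simp
  have "x \<in> L" if "x \<in> E" for x
    using down[OF that, of l] idx_multiple[OF L(1,2,3) _ that] p1 by simp
  then show ?thesis using L by blast
qed

lemma rank_E: "rank E 0"
proof -
  have "add_sets E (scale p E) = E"
    using add_sets_least[OF sgE subset_refl scale_subset[OF sgE]]
      add_subgroup_add_sets(2)[OF sgE add_subgroup_scale[OF sgE]] by (rule subset_antisym)
  then show ?thesis using idx_same[OF sgE] by (simp add: rank_def)
qed

text \<open>M_k is the k-th iterate of \<open>preim\<close>, so l is [L] and e is [M_k]: the data
  that enter the weight of \<open>pair_fun\<close>.\<close>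

definition fam :: "nat \<Rightarrow> nat \<Rightarrow> nat \<Rightarrow> nat \<Rightarrow> 'a set set" where
  "fam k r l e = {L. add_subgroup L \<and> L \<subseteq> E \<and> rank L r \<and> idx E L = p ^ l \<and>
     idx E ((preim p E ^^ k) L) = p ^ e}"

definition fam1 :: "nat \<Rightarrow> nat \<Rightarrow> 'a set set" where
  "fam1 r l = {L. add_subgroup L \<and> L \<subseteq> E \<and> rank L r \<and> idx E L = p ^ l}"

lemma fam1_le: "L \<in> fam1 r l \<Longrightarrow> r \<le> l \<and> preim p E L \<in> (\<Union>i\<le>d. fam1 i (l - r))"
proof -
  assume L: "L \<in> fam1 r l"
  then have L': "add_subgroup L" "L \<subseteq> E" "rank L r" "idx E L = p ^ l" by (auto simp: fam1_def)
  note P = preim[OF L'(1,2)]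
  have i: "p ^ l = idx E (preim p E L) * p ^ r" using idx_preim[OF L'(1,2,3)] L' by simp
  then have "p ^ r dvd p ^ l" by simp
  then have rl: "r \<le> l" using p1 power_dvd_imp_le by blast
  then have "p ^ l = p ^ (l - r) * p ^ r" by (simp add: power_add[symmetric])
  then have "idx E (preim p E L) = p ^ (l - r)" using i p1 by simp
  then show ?thesis using rl P rank_exists[OF P(1,3)] by (auto simp: fam1_def)
qed

text \<open>For r > 0 a lattice lies over one whose index has the smaller exponent l - r, and the
  fibres are finite; for r = 0 only E remains.\<close>

lemma finite_fam1: "finite (fam1 r l)"
proof (induction l arbitrary: r rule: less_induct)
  case (less l)
  show ?case
  proof (cases "r = 0 \<or> r > d")
    case True
    have "fam1 r l \<subseteq> {E}"
      using rank_0_imp_eq True rank_le by (auto simp: fam1_def) (metis leD rank_le)+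
    then show ?thesis using finite_subset by blast
  next
    case False
    show ?thesis
    proof (cases "r \<le> l")
      case True
      then have "finite (\<Union>i\<le>d. fam1 i (l - r))" using less False by auto
      moreover have "fam1 r l \<subseteq> (\<Union>M\<in>(\<Union>i\<le>d. fam1 i (l - r)). {L. add_subgroup L \<and> L \<subseteq> E \<and> preim p E L = M \<and> rank L r})"
      proof
        fix L assume L: "L \<in> fam1 r l"
        then have "preim p E L \<in> (\<Union>i\<le>d. fam1 i (l - r))" using fam1_le by blast
        then show "L \<in> (\<Union>M\<in>(\<Union>i\<le>d. fam1 i (l - r)). {L. add_subgroup L \<and> L \<subseteq> E \<and> preim p E L = M \<and> rank L r})"
          using L by (auto simp: fam1_def)
      qed
      moreover have "finite {L. add_subgroup L \<and> L \<subseteq> E \<and> preim p E L = M \<and> rank L r}"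
        if "M \<in> (\<Union>i\<le>d. fam1 i (l - r))" for M
        using that card_preim_fibre[of M _ r] False p1 by (auto simp: fam1_def)
      ultimately show ?thesis by (meson finite_UN_I finite_subset)
    next
      case False
      then have "fam1 r l = {}" using fam1_le by blast
      then show ?thesis by simp
    qed
  qed
qed

lemma fam_subset: "fam k r l e \<subseteq> fam1 r l" by (auto simp: fam_def fam1_def)

lemma finite_fam: "finite (fam k r l e)"
  using finite_fam1 fam_subset finite_subset by metis

lemma fam1_0: "fam1 0 l = (if l = 0 then {E} else {})"
proof -
  have "L = E" if "L \<in> fam1 0 l" for L using rank_0_imp_eq that by (auto simp: fam1_def)
  moreover have "E \<in> fam1 0 l \<longleftrightarrow> l = 0"
    using sgE rank_E idx_same[OF sgE] one_less_power[OF p1, of l] by (cases "l = 0") (auto simp: fam1_def)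
  ultimately show ?thesis by auto
qed

text \<open>M_{k+1} of L is M_k of \<open>preim p E L\<close>. Passing to the latter therefore keeps
  e and lowers l by r.\<close>

lemma fam_Suc:
  assumes "r \<le> d"
  shows "fam (Suc k) r l e = (\<Union>M\<in>(\<Union>i\<le>d. if r \<le> l then fam k i (l - r) e else {}). {L. add_subgroup L \<and> L \<subseteq> E \<and> preim p E L = M \<and> rank L r})"
    (is "_ = ?R")
proof (intro Set.set_eqI iffI)
  fix L assume L: "L \<in> fam (Suc k) r l e"
  then have L1: "L \<in> fam1 r l" using fam_subset by blast
  have "preim p E L \<in> (\<Union>i\<le>d. fam k i (l - r) e)"
    using fam1_le[OF L1] L by (auto simp: fam_def fam1_def funpow_Suc_right simp del: funpow.simps)
  then show "L \<in> ?R" using fam1_le[OF L1] L1 by (auto simp: fam1_def)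
next
  fix L assume "L \<in> ?R"
  then obtain i where *: "r \<le> l" "i \<le> d" "preim p E L \<in> fam k i (l - r) e" "add_subgroup L" "L \<subseteq> E" "rank L r"
    by (auto split: if_splits)
  then have "idx E L = p ^ l" using idx_preim[of L r] by (simp add: fam_def power_add[symmetric])
  then show "L \<in> fam (Suc k) r l e"
    using * by (auto simp: fam_def funpow_Suc_right simp del: funpow.simps)
qed

lemma card_fam_Suc:
  assumes "r \<le> d"
  shows "card (fam (Suc k) r l e) = (if r \<le> l then (\<Sum>i\<le>d. trans_coeff p d r i * card (fam k i (l - r) e)) else 0)"
proof (cases "r \<le> l")
  case True
  let ?F = "\<lambda>M. {L. add_subgroup L \<and> L \<subseteq> E \<and> preim p E L = M \<and> rank L r}"
  have F: "finite (?F M) \<and> card (?F M) = trans_coeff p d r i" if "M \<in> fam k i (l - r) e" for M i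
    using that assms p1 by (intro card_preim_fibre) (auto simp: fam_def)
  have "fam (Suc k) r l e = (\<Union>i\<le>d. \<Union>M\<in>fam k i (l - r) e. ?F M)"
    unfolding fam_Suc[OF assms] using True by auto
  also have "card \<dots> = (\<Sum>i\<le>d. card (\<Union>M\<in>fam k i (l - r) e. ?F M))"
  proof (rule card_UN_disjoint)
    show "\<forall>i\<in>{..d}. finite (\<Union>M\<in>fam k i (l - r) e. ?F M)" using F finite_fam by auto
    show "\<forall>i\<in>{..d}. \<forall>j\<in>{..d}. i \<noteq> j \<longrightarrow> (\<Union>M\<in>fam k i (l - r) e. ?F M) \<inter> (\<Union>M\<in>fam k j (l - r) e. ?F M) = {}"
      using rank_unique by (auto simp: fam_def)
  qed auto
  also have "\<dots> = (\<Sum>i\<le>d. card (fam k i (l - r) e) * trans_coeff p d r i)"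
    using F finite_fam by (intro sum.cong HOL.refl card_UN_const) auto
  finally show ?thesis using True by (simp add: mult.commute)
next
  case False
  then show ?thesis using fam_Suc[OF assms] by simp
qed

lemma fam_0: "fam 0 r l e = (if l = e then fam1 r l else {})"
  using p1 by (auto simp: fam_def fam1_def)

lemma fam_1: "fam 1 r l e = (if l = r + e then fam1 r l else {})"
proof -
  have "L \<in> fam 1 r l e \<longleftrightarrow> l = r + e" if L: "L \<in> fam1 r l" for L
  proof -
    have "idx E L = idx E (preim p E L) * p ^ r" using L idx_preim by (auto simp: fam1_def)
    moreover have "idx E (preim p E L) = p ^ (l - r)" "r \<le> l" using fam1_le[OF L] by (auto simp: fam1_def)
    ultimately show ?thesis using L p1 by (auto simp: fam_def fam1_def)
  qed
  then show ?thesis using fam_subset[of 1 r l e] by auto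
qed

lemma card_fam1:
  assumes "r \<le> d" 
  shows "card (fam1 r l) = (if r \<le> l then (\<Sum>i\<le>d. trans_coeff p d r i * card (fam1 i (l - r))) else 0)"
proof (cases "r \<le> l")
  case True
  \<comment> \<open>For k = 1 the value e = l - r is forced, so prescribing it excludes no
    lattice.\<close>
  then have "fam (Suc 0) r l (l - r) = fam1 r l" using fam_1[of r l "l - r"] by simp
  then show ?thesis using card_fam_Suc[OF assms, of 0 l "l - r"] by (simp add: fam_0)
next
  case False
  then have "fam1 r l = {}" using fam1_le by blast
  then show ?thesis using False by simp
qed

end

text \<open>The recursion \<open>card_fam1\<close> with the lattice removed: it shows that the
  counts are the same for every E of rank d, which allows them to be used for M_k in place of E. The
  case r = 0 is set apart because l - r would not decrease.\<close>

fun num_rank :: "nat \<Rightarrow> nat \<Rightarrow> nat \<Rightarrow> nat \<Rightarrow> nat" where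
  "num_rank p d r l = (if l = 0 then of_bool (r = 0) else if r = 0 \<or> r > l then 0
     else (\<Sum>i\<le>d. trans_coeff p d r i * num_rank p d i (l - r)))"

declare num_rank.simps [simp del]

definition num_sub :: "nat \<Rightarrow> nat \<Rightarrow> nat \<Rightarrow> nat" where
  "num_sub p d j = (\<Sum>r\<le>d. num_rank p d r j)"

context lattice_setting begin

lemma card_fam1_eq: "r \<le> d \<Longrightarrow> card (fam1 r l) = num_rank p d r l"
proof (induction l arbitrary: r rule: less_induct)
  case (less l)
  show ?case
  proof (cases "l = 0")
    case True
    have "fam1 r 0 = (if r = 0 then {E} else {})"
    proof (cases "r = 0")
      case True then show ?thesis using fam1_0[of 0] by simp
    next
      case False
      have "L \<notin> fam1 r 0" for L
        using fam1_le[of L r 0] False by auto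
      then show ?thesis using False by auto
    qed
    then show ?thesis using True by (simp add: num_rank.simps)
  next
    case False
    show ?thesis
    proof (cases "r = 0")
      case True
      then show ?thesis using False fam1_0[of l] by (subst num_rank.simps) simp
    next
      case r: False
      have "(\<Sum>i\<le>d. trans_coeff p d r i * card (fam1 i (l - r))) =
          (\<Sum>i\<le>d. trans_coeff p d r i * num_rank p d i (l - r))"
        using r False by (intro sum.cong HOL.refl arg_cong2[where f = "(*)"] less.IH) auto
      then show ?thesis
        using r False card_fam1[OF less.prems, of l] by (subst num_rank.simps) simp
    qed
  qed
qed

lemma subgroups_by_rank: "{K. add_subgroup K \<and> K \<subseteq> E \<and> idx E K = p ^ j} = (\<Union>r\<le>d. fam1 r j)"
  using rank_exists by (fastforce simp: fam1_def)

lemma card_subgroups: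
  "finite {K. add_subgroup K \<and> K \<subseteq> E \<and> idx E K = p ^ j} \<and>
   card {K. add_subgroup K \<and> K \<subseteq> E \<and> idx E K = p ^ j} = num_sub p d j"
proof -
  have "card (\<Union>r\<le>d. fam1 r j) = (\<Sum>r\<le>d. card (fam1 r j))"
    by (rule card_UN_disjoint) (use finite_fam1 rank_unique in \<open>auto simp: fam1_def\<close>)
  then show ?thesis unfolding subgroups_by_rank num_sub_def using finite_fam1 card_fam1_eq by simp
qed

lemma preim_pow:
  assumes L: "add_subgroup L" "L \<subseteq> E"
  shows "(preim p E ^^ k) L = {x \<in> E. of_nat (p ^ k) * x \<in> L}" "add_subgroup ((preim p E ^^ k) L)"
    "L \<subseteq> (preim p E ^^ k) L" "(preim p E ^^ k) L \<subseteq> E"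
proof -
  have "(preim p E ^^ k) L = {x \<in> E. of_nat (p ^ k) * x \<in> L} \<and> add_subgroup ((preim p E ^^ k) L) \<and>
    L \<subseteq> (preim p E ^^ k) L \<and> (preim p E ^^ k) L \<subseteq> E"
  proof (induction k)
    case 0 show ?case using L by auto
  next
    case (Suc k)
    then have s: "add_subgroup ((preim p E ^^ k) L)" "(preim p E ^^ k) L \<subseteq> E" by auto
    have "preim p E ((preim p E ^^ k) L) = {x \<in> E. of_nat (p ^ Suc k) * x \<in> L}"
    proof -
      have m: "of_nat (p ^ Suc k) * x = of_nat (p ^ k) * (of_nat p * x)" for x :: 'a by (simp add: mult_ac)
      have pk: "(preim p E ^^ k) L = {x \<in> E. of_nat (p ^ k) * x \<in> L}" using Suc by blast
      show ?thesis unfolding pk unfolding preim_def m using of_nat_mult_mem[OF sgE, of _ p] by blast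
    qed
    then show ?case using preim[OF s] Suc by auto
  qed
  then show "(preim p E ^^ k) L = {x \<in> E. of_nat (p ^ k) * x \<in> L}" "add_subgroup ((preim p E ^^ k) L)"
    "L \<subseteq> (preim p E ^^ k) L" "(preim p E ^^ k) L \<subseteq> E" by auto
qed

text \<open>The condition says that K lies in M_k. As M_k is itself a lattice of rank d, its
  sublattices are counted by \<open>num_sub\<close>, and L enters only through the exponent e. This
  is why the zeta function is a product.\<close>

lemma card_subgroups_scaled_into:
  assumes L: "add_subgroup L" "L \<subseteq> E" and e: "idx E ((preim p E ^^ k) L) = p ^ e"
  shows "finite {K. add_subgroup K \<and> K \<subseteq> E \<and> idx E K = p ^ a \<and> (\<forall>x\<in>K. of_nat (p ^ k) * x \<in> L)} \<and>
    card {K. add_subgroup K \<and> K \<subseteq> E \<and> idx E K = p ^ a \<and> (\<forall>x\<in>K. of_nat (p ^ k) * x \<in> L)} =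
      (if e \<le> a then num_sub p d (a - e) else 0)"
proof -
  let ?M = "(preim p E ^^ k) L"
  note M = preim_pow[OF L, of k]
  have "rank_mod p d ?M" using rank_mod_subgroup[OF M(2,4)] e p1 by simp
  then interpret M: lattice_setting p d ?M using p by unfold_locales
  have *: "idx E K = p ^ e * idx ?M K" if "add_subgroup K" "K \<subseteq> ?M" for K
    using idx_tower[OF that(1) M(2) sgE that(2) M(4)] e by simp
  have "{K. add_subgroup K \<and> K \<subseteq> E \<and> idx E K = p ^ a \<and> (\<forall>x\<in>K. of_nat (p ^ k) * x \<in> L)} =
     (if e \<le> a then {K. add_subgroup K \<and> K \<subseteq> ?M \<and> idx ?M K = p ^ (a - e)} else {})" (is "?A = ?B")
  proof -
    have "?A = {K. add_subgroup K \<and> K \<subseteq> ?M \<and> idx E K = p ^ a}" unfolding M(1) by blast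
    also have "\<dots> = {K. add_subgroup K \<and> K \<subseteq> ?M \<and> p ^ e * idx ?M K = p ^ a}" using * by auto
    also have "\<dots> = ?B"
    proof (cases "e \<le> a")
      case True
      then have "p ^ a = p ^ e * p ^ (a - e)" by (simp add: power_add[symmetric])
      then show ?thesis using True p1 by simp
    next
      case False
      have "p ^ e * x \<noteq> p ^ a" for x
      proof
        assume "p ^ e * x = p ^ a"
        then have "p ^ e dvd p ^ a" by (metis dvd_triv_left)
        then show False using False p1 power_dvd_imp_le by blast
      qed
      then show ?thesis using False by simp
    qed
    finally show ?thesis .
  qed
  then show ?thesis using M.card_subgroups[of "a - e"] by simp
qed

section \<open>Pairs of lattices with p^k K \<subseteq> L\<close>

definition pairs :: "nat \<Rightarrow> nat \<Rightarrow> nat \<Rightarrow> ('a set \<times> 'a set) set" where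
  "pairs k a l = {(K, L). add_subgroup K \<and> K \<subseteq> E \<and> idx E K = p ^ a \<and>
     add_subgroup L \<and> L \<subseteq> E \<and> idx E L = p ^ l \<and> (\<forall>x\<in>K. of_nat (p ^ k) * x \<in> L)}"

lemma card_pairs:
  "finite (pairs k a l) \<and> card (pairs k a l) = (\<Sum>r\<le>d. \<Sum>e\<le>a. card (fam k r l e) * num_sub p d (a - e))"
proof -
  let ?K = "\<lambda>L. {K. add_subgroup K \<and> K \<subseteq> E \<and> idx E K = p ^ a \<and> (\<forall>x\<in>K. of_nat (p ^ k) * x \<in> L)}"
  let ?P = "\<lambda>L. (\<lambda>K. (K, L)) ` ?K L"
  have K: "finite (?P L) \<and> card (?P L) = num_sub p d (a - e)" if "L \<in> fam k r l e" "e \<le> a" for L r e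
  proof -
    have "inj_on (\<lambda>K. (K, L)) (?K L)" by (auto simp: inj_on_def)
    then show ?thesis
      using card_subgroups_scaled_into[of L k e a] that by (auto simp: fam_def card_image)
  qed
  \<comment> \<open>L is classified by its codimension r and by e = [M_k]. Values e > a do not
    occur, because K is contained in M_k.\<close>
  have "pairs k a l = (\<Union>(r, e)\<in>{..d} \<times> {..a}. \<Union>L\<in>fam k r l e. ?P L)"
  proof (intro Set.set_eqI iffI)
    fix x assume x: "x \<in> pairs k a l"
    obtain K L where KL: "x = (K, L)" "add_subgroup L" "L \<subseteq> E" "idx E L = p ^ l" "K \<in> ?K L"
      using x by (auto simp: pairs_def)
    obtain r where r: "r \<le> d" "rank L r" using rank_exists[OF KL(2,3)] by blast
    note M = preim_pow[OF KL(2,3), of k]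
    have "idx E ((preim p E ^^ k) L) dvd p ^ l"
      using idx_tower[OF KL(2) M(2) sgE M(3,4)] KL(4) by (metis dvd_triv_left)
    then obtain e where e: "idx E ((preim p E ^^ k) L) = p ^ e" using divides_primepow_nat[OF p] by blast
    have "?K L \<noteq> {}" using KL by blast
    then have "e \<le> a" using card_subgroups_scaled_into[OF KL(2,3) e, of a]
      by (metis (no_types, lifting) card_0_eq)
    then show "x \<in> (\<Union>(r, e)\<in>{..d} \<times> {..a}. \<Union>L\<in>fam k r l e. ?P L)"
      using KL r e by (auto simp: fam_def)
  qed (auto simp: pairs_def fam_def)
  moreover have "card (\<Union>(r, e)\<in>{..d} \<times> {..a}. \<Union>L\<in>fam k r l e. ?P L) =
     (\<Sum>(r, e)\<in>{..d} \<times> {..a}. card (\<Union>L\<in>fam k r l e. ?P L))"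
  proof (subst card_UN_disjoint)
    show "\<forall>i\<in>{..d} \<times> {..a}. finite (case i of (r, e) \<Rightarrow> \<Union>L\<in>fam k r l e. ?P L)"
      using finite_fam K by auto
    show "\<forall>i\<in>{..d} \<times> {..a}. \<forall>j\<in>{..d} \<times> {..a}. i \<noteq> j \<longrightarrow>
      (case i of (r, e) \<Rightarrow> \<Union>L\<in>fam k r l e. ?P L) \<inter> (case j of (r, e) \<Rightarrow> \<Union>L\<in>fam k r l e. ?P L) = {}"
    proof (intro ballI impI)
      fix x y :: "nat \<times> nat" assume "x \<noteq> y"
      then obtain r e r' e' where xy: "x = (r, e)" "y = (r', e')" and ne: "(r, e) \<noteq> (r', e')"
        by (cases x, cases y) auto
      have "fam k r l e \<inter> fam k r' l e' = {}"
        using ne rank_unique p1 by (auto simp: fam_def)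
      then show "(case x of (r, e) \<Rightarrow> \<Union>L\<in>fam k r l e. ?P L) \<inter> (case y of (r, e) \<Rightarrow> \<Union>L\<in>fam k r l e. ?P L) = {}"
        unfolding xy by auto
    qed
  qed (auto simp: case_prod_beta)
  moreover have "\<And>r e. e \<le> a \<Longrightarrow> card (\<Union>L\<in>fam k r l e. ?P L) = card (fam k r l e) * num_sub p d (a - e)"
  proof (rule card_UN_const)
    fix r e :: nat assume e: "e \<le> a"
    show "finite (fam k r l e)" by (rule finite_fam)
    show "\<And>L. L \<in> fam k r l e \<Longrightarrow> finite (?P L) \<and> card (?P L) = num_sub p d (a - e)"
      using K e by blast
  qed auto
  moreover have "finite (\<Union>(r, e)\<in>{..d} \<times> {..a}. \<Union>L\<in>fam k r l e. ?P L)"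
    using finite_fam K by auto
  ultimately show ?thesis by (simp add: sum.cartesian_product[symmetric])
qed

end

text \<open>Vectors of length d are functions vanishing from d on. All lengths share one type, and
  the coordinate filtration consists of inclusions.\<close>

definition int_vecs :: "nat \<Rightarrow> (nat \<Rightarrow> int) set" where
  "int_vecs d = {f. \<forall>i\<ge>d. f i = 0}"

lemma of_nat_fun_apply [simp]: "(of_nat n :: 'a \<Rightarrow> 'b::semiring_1) x = of_nat n"
  by (induction n) simp_all

lemma of_int_fun_apply [simp]: "(of_int n :: 'a \<Rightarrow> 'b::ring_1) x = of_int n"
  by (cases n rule: int_cases2) simp_all

lemma add_subgroup_int_vecs: "add_subgroup (int_vecs d)"
  by (auto simp: add_subgroup_def int_vecs_def)

lemma rank_mod_int_vecs: "p > 0 \<Longrightarrow> rank_mod p d (int_vecs d)"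
  unfolding rank_mod_def
proof (intro conjI ballI impI)
  assume p: "p > 0"
  show s: "add_subgroup (int_vecs d)" by (rule add_subgroup_int_vecs)
  \<comment> \<open>Reduction of coordinates modulo p, restricted so that the image is an
    extensional function space of known cardinality.\<close>
  let ?f = "\<lambda>x::nat \<Rightarrow> int. restrict (\<lambda>i. x i mod int p) {..<d}"
  have "idx (int_vecs d) (scale p (int_vecs d)) = card (?f ` int_vecs d)"
  proof (rule idx_eq_card_image[OF add_subgroup_scale[OF s]])
    fix x y assume xy: "x \<in> int_vecs d" "y \<in> int_vecs d"
    show "?f x = ?f y \<longleftrightarrow> x - y \<in> scale p (int_vecs d)"
    proof
      assume e: "?f x = ?f y"
      have d: "int p dvd x i - y i" for i
      proof (cases "i < d")
        case True
        then have "x i mod int p = y i mod int p" using fun_cong[OF e, of i] by simp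
        then show ?thesis by (simp add: mod_eq_dvd_iff)
      qed (use xy in \<open>auto simp: int_vecs_def\<close>)
      have "x - y = of_nat p * (\<lambda>i. (x i - y i) div int p)"
        by (rule ext) (simp add: d)
      moreover have "(\<lambda>i. (x i - y i) div int p) \<in> int_vecs d" using xy by (simp add: int_vecs_def)
      ultimately show "x - y \<in> scale p (int_vecs d)" by blast
    next
      assume "x - y \<in> scale p (int_vecs d)"
      then obtain z where z: "x - y = of_nat p * z" by blast
      have "int p dvd x i - y i" for i using fun_cong[OF z, of i] by simp
      then show "?f x = ?f y" by (intro restrict_ext) (simp add: mod_eq_dvd_iff)
    qed
  qed
  also have "?f ` int_vecs d = (\<Pi>\<^sub>E i\<in>{..<d}. {0..<int p})"
  proof
    show "?f ` int_vecs d \<subseteq> (\<Pi>\<^sub>E i\<in>{..<d}. {0..<int p})"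
      using p by (intro image_subsetI) (simp add: restrict_PiE_iff)
    show "(\<Pi>\<^sub>E i\<in>{..<d}. {0..<int p}) \<subseteq> ?f ` int_vecs d"
    proof
      fix g assume g: "g \<in> (\<Pi>\<^sub>E i\<in>{..<d}. {0..<int p})"
      let ?x = "\<lambda>i. if i < d then g i else 0"
      have "g i = ?f ?x i" for i
      proof (cases "i < d")
        case True
        then have "g i \<in> {0..<int p}" using PiE_mem[OF g, of i] by simp
        then show ?thesis using True by simp
      next
        case False
        then show ?thesis using PiE_arb[OF g, of i] by simp
      qed
      then have "g = ?f ?x" by (rule ext)
      moreover have "?x \<in> int_vecs d" by (simp add: int_vecs_def)
      ultimately show "g \<in> ?f ` int_vecs d" by (rule image_eqI)
    qed
  qed
  also have "card (\<Pi>\<^sub>E i\<in>{..<d}. {0..<int p}) = p ^ d" by (simp add: card_PiE)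
  finally show "idx (int_vecs d) (scale p (int_vecs d)) = p ^ d" .
  fix x :: "nat \<Rightarrow> int" assume z: "of_nat p * x = 0"
  have "x i = 0" for i using fun_cong[OF z, of i] p by simp
  then show "x = 0" by auto
qed

section \<open>The Heisenberg-type model\<close>

text \<open>\<open>Heis m k c\<close> stands for the normal form x^m x_n^k y^c in multi-exponents.
  From x_i x_n = x_n x_i y_i, moving x_n^k past x^m' costs y^(-k m'); this is the twist in the sum
  below.\<close>

datatype heis = Heis (hx: "nat \<Rightarrow> int") (hk: int) (hy: "nat \<Rightarrow> int")

instantiation heis :: group_add begin
definition "0 = Heis 0 0 0"
definition "a + b = Heis (hx a + hx b) (hk a + hk b) (hy a + hy b - of_int (hk a) * hx b)"
definition "- a = Heis (- hx a) (- hk a) (- hy a - of_int (hk a) * hx a)"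
definition "a - (b::heis) = a + - b"
instance
  by intro_classes (simp_all add: zero_heis_def plus_heis_def uminus_heis_def minus_heis_def algebra_simps)
end

lemma Heis_add: "Heis m k c + Heis m' k' c' = Heis (m + m') (k + k') (c + c' - of_int k * m')"
  by (simp add: plus_heis_def)

lemma Heis_diff: "Heis m k c - Heis m' k' c' = Heis (m - m') (k - k') (c - c' + of_int (k - k') * m')"
  by (simp add: minus_heis_def plus_heis_def uminus_heis_def algebra_simps)

lemma Heis_uminus: "- Heis m k c = Heis (- m) (- k) (- c - of_int k * m)"
  by (simp add: uminus_heis_def)

lemma heis_sel [simp]:
  "hx 0 = 0" "hk 0 = 0" "hy 0 = 0" "hx (a - b) = hx a - hx b" "hk (a - b) = hk a - hk b"
  "hx (a + b) = hx a + hx b" "hk (a + b) = hk a + hk b" "hx (- a) = - hx a" "hk (- a) = - hk a"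
  by (simp_all add: zero_heis_def plus_heis_def uminus_heis_def minus_heis_def)

definition heis_group :: "nat \<Rightarrow> heis set" where
  "heis_group d = {Heis m k c |m k c. m \<in> int_vecs d \<and> c \<in> int_vecs d}"

text \<open>For K = \<open>int_vecs d\<close> this is the kernel of the middle coordinate, an
  abelian normal subgroup. Smaller K are used for climbing the coordinate filtration.\<close>

definition heis_abelian :: "(nat \<Rightarrow> int) set \<Rightarrow> nat \<Rightarrow> heis set" where
  "heis_abelian K d = {Heis m 0 c |m c. m \<in> K \<and> c \<in> int_vecs d}"

lemma of_int_mult_int_vecs: "m \<in> int_vecs d \<Longrightarrow> of_int k * m \<in> int_vecs d"
  by (auto simp: int_vecs_def)

lemma add_subgroup_heis_group: "add_subgroup (heis_group d)"
  unfolding add_subgroup_def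
proof (intro conjI ballI)
  show "0 \<in> heis_group d" by (auto simp: heis_group_def zero_heis_def int_vecs_def)
  fix x y assume "x \<in> heis_group d" "y \<in> heis_group d"
  then obtain m k c m' k' c' where *: "x = Heis m k c" "y = Heis m' k' c'" "m \<in> int_vecs d" "c \<in> int_vecs d"
    "m' \<in> int_vecs d" "c' \<in> int_vecs d" unfolding heis_group_def by blast
  have "c - c' + of_int (k - k') * m' \<in> int_vecs d"
    by (intro add_subgroup_add add_subgroup_diff add_subgroup_int_vecs of_int_mult_int_vecs *)
  moreover have "m - m' \<in> int_vecs d" by (intro add_subgroup_diff add_subgroup_int_vecs *)
  ultimately show "x - y \<in> heis_group d" unfolding * Heis_diff heis_group_def by blast
qed

lemma add_subgroup_heis_abelian: "add_subgroup K \<Longrightarrow> add_subgroup (heis_abelian K d)"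
  unfolding add_subgroup_def[of "heis_abelian K d"]
proof (intro conjI ballI)
  assume K: "add_subgroup K"
  have "Heis 0 0 0 \<in> heis_abelian K d"
    unfolding heis_abelian_def using add_subgroup_0[OF K] add_subgroup_0[OF add_subgroup_int_vecs] by blast
  then show "0 \<in> heis_abelian K d" by (simp add: zero_heis_def)
  fix x y assume "x \<in> heis_abelian K d" "y \<in> heis_abelian K d"
  then obtain m c m' c' where *: "x = Heis m 0 c" "y = Heis m' 0 c'" "m \<in> K" "c \<in> int_vecs d"
    "m' \<in> K" "c' \<in> int_vecs d" unfolding heis_abelian_def by blast
  have "c - c' \<in> int_vecs d" "m - m' \<in> K"
    by (intro add_subgroup_diff add_subgroup_int_vecs * K)+
  moreover have "x - y = Heis (m - m') 0 (c - c')" unfolding * Heis_diff by simp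
  ultimately show "x - y \<in> heis_abelian K d" unfolding heis_abelian_def by blast
qed

section \<open>Subgroups of the abelian part with prescribed projection and fibre\<close>

definition fibre_y :: "heis set \<Rightarrow> (nat \<Rightarrow> int) set" where
  "fibre_y B = {c. Heis 0 0 c \<in> B}"

text \<open>By Goursat these subgroups are the graphs of homomorphisms from K to
  \<open>int_vecs d\<close> modulo L; for K of rank d there are as many as the d-th power of the
  index of L.\<close>

definition glued :: "nat \<Rightarrow> (nat \<Rightarrow> int) set \<Rightarrow> (nat \<Rightarrow> int) set \<Rightarrow> heis set set" where
  "glued d K L = {B. add_subgroup B \<and> B \<subseteq> heis_abelian K d \<and> hx ` B = K \<and> fibre_y B = L}"

lemma add_subgroup_image:
  assumes "add_subgroup B" "\<And>x y. x \<in> B \<Longrightarrow> y \<in> B \<Longrightarrow> f (x - y) = f x - f y"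
  shows "add_subgroup (f ` B)"
  unfolding add_subgroup_def
proof (intro conjI ballI)
  have "f 0 = 0" using assms(2)[of 0 0] add_subgroup_0[OF assms(1)] by simp
  then show "0 \<in> f ` B" using add_subgroup_0[OF assms(1)] by (metis imageI)
  fix a b assume "a \<in> f ` B" "b \<in> f ` B"
  then obtain x y where xy: "x \<in> B" "y \<in> B" "a = f x" "b = f y" by blast
  then have "a - b = f (x - y)" using assms(2) by simp
  then show "a - b \<in> f ` B" using xy add_subgroup_diff[OF assms(1)] by blast
qed

lemma add_subgroup_fibre_y: "add_subgroup B \<Longrightarrow> add_subgroup (fibre_y B)"
  unfolding add_subgroup_def[of "fibre_y B"]
proof (intro conjI ballI)
  assume B: "add_subgroup B"
  show "0 \<in> fibre_y B" using add_subgroup_0[OF B] by (simp add: fibre_y_def zero_heis_def)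
  fix x y assume "x \<in> fibre_y B" "y \<in> fibre_y B"
  then have "Heis 0 0 x - Heis 0 0 y \<in> B" using add_subgroup_diff[OF B] by (simp add: fibre_y_def)
  then show "x - y \<in> fibre_y B" by (simp add: fibre_y_def Heis_diff)
qed

lemma idx_heis_abelian:
  assumes K: "add_subgroup K" and B: "add_subgroup B" "B \<subseteq> heis_abelian K d"
  shows "idx (heis_abelian K d) B = idx K (hx ` B) * idx (int_vecs d) (fibre_y B)"
proof -
  have "idx (heis_abelian K d) B = idx (hx ` heis_abelian K d) (hx ` B) *
      idx {x \<in> heis_abelian K d. hx x = 0} {x \<in> B. hx x = 0}"
    using add_subgroup_heis_abelian[OF K] B by (intro idx_hom) auto
  also have "hx ` heis_abelian K d = K"
  proof
    show "K \<subseteq> hx ` heis_abelian K d"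
    proof
      fix m assume "m \<in> K"
      then have "Heis m 0 0 \<in> heis_abelian K d"
        using add_subgroup_0[OF add_subgroup_int_vecs] by (auto simp: heis_abelian_def)
      then show "m \<in> hx ` heis_abelian K d" by (intro image_eqI[of _ _ "Heis m 0 0"]) auto
    qed
  qed (auto simp: heis_abelian_def)
  also have "{x \<in> heis_abelian K d. hx x = 0} = Heis 0 0 ` int_vecs d"
    using add_subgroup_0[OF K] by (auto simp: heis_abelian_def)
  also have fB: "{x \<in> B. hx x = 0} = Heis 0 0 ` fibre_y B"
    using B(2) by (auto simp: heis_abelian_def fibre_y_def image_iff)
  also have "idx (Heis 0 0 ` int_vecs d) (Heis 0 0 ` fibre_y B) = idx (int_vecs d) (fibre_y B)"
  proof (rule idx_inj_image[OF add_subgroup_int_vecs add_subgroup_fibre_y[OF B(1)]])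
    show "fibre_y B \<subseteq> int_vecs d" using B(2) by (auto simp: heis_abelian_def fibre_y_def)
  qed (auto simp: Heis_diff zero_heis_def)
  finally show ?thesis .
qed

lemma int_vecs_mono: "j \<le> d \<Longrightarrow> int_vecs j \<subseteq> int_vecs d"
  by (auto simp: int_vecs_def)

lemma idx_multiple_int_vecs:
  assumes "add_subgroup K" "K \<subseteq> int_vecs d" "idx (int_vecs d) K \<noteq> 0" "x \<in> int_vecs d"
  shows "of_nat (idx (int_vecs d) K) * x \<in> K"
proof -
  \<comment> \<open>Any prime may be chosen to enter the locale, as \<open>idx_multiple\<close>
    speaks of every positive index.\<close>
  interpret lattice_setting 2 d "int_vecs d"
    by unfold_locales (auto simp: rank_mod_int_vecs)
  show ?thesis using idx_multiple[OF assms(1,2) HOL.refl _ assms(4)] assms(3) by simp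
qed

text \<open>Climbing the coordinate filtration of \<open>K\<close>: each step is an extension by an infinite cyclic group.\<close>

lemma card_glued_filtered:
  assumes K: "add_subgroup K" "K \<subseteq> int_vecs d" "idx (int_vecs d) K \<noteq> 0"
    and L: "add_subgroup L" "L \<subseteq> int_vecs d" "idx (int_vecs d) L \<noteq> 0" and "j \<le> d"
  shows "finite (glued d (K \<inter> int_vecs j) L) \<and>
    card (glued d (K \<inter> int_vecs j) L) = idx (int_vecs d) L ^ j"
  using \<open>j \<le> d\<close>
proof (induction j)
  case 0
  have K0: "K \<inter> int_vecs 0 = {0}" using add_subgroup_0[OF K(1)] by (auto simp: int_vecs_def)
  have "glued d (K \<inter> int_vecs 0) L = {Heis 0 0 ` L}"
  proof (intro Set.set_eqI iffI)
    fix B assume B: "B \<in> glued d (K \<inter> int_vecs 0) L"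
    then have "B = Heis 0 0 ` fibre_y B"
      unfolding K0 by (auto simp: glued_def heis_abelian_def fibre_y_def image_iff)
    then show "B \<in> {Heis 0 0 ` L}" using B by (simp add: glued_def)
  next
    fix B assume "B \<in> {Heis 0 0 ` L}"
    then have B: "B = Heis 0 0 ` L" by simp
    have "add_subgroup B" unfolding B by (rule add_subgroup_image[OF L(1)]) (simp add: Heis_diff)
    moreover have "B \<subseteq> heis_abelian {0} d" unfolding B heis_abelian_def using L(2) by blast
    moreover have "hx ` B = {0}" unfolding B using add_subgroup_0[OF L(1)] by (auto simp: image_image)
    moreover have "fibre_y B = L" unfolding B by (auto simp: fibre_y_def)
    ultimately show "B \<in> glued d (K \<inter> int_vecs 0) L" unfolding K0 by (simp add: glued_def)
  qed
  then show ?case by simp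
next
  case (Suc j)
  let ?K = "\<lambda>j. K \<inter> int_vecs j" and ?N = "\<lambda>j. heis_abelian (K \<inter> int_vecs j) d"
  let ?\<delta> = "\<lambda>x. hx x j"
  have sK: "add_subgroup (?K i)" for i by (intro add_subgroup_Int K add_subgroup_int_vecs)
  have \<delta>: "?\<delta> (x - y) = ?\<delta> x - ?\<delta> y" for x y by simp
  have ker: "?N j = {x \<in> ?N (Suc j). ?\<delta> x = 0}"
    by (auto simp: heis_abelian_def int_vecs_def Suc_le_eq nat_less_le)
  obtain m where m: "m \<ge> 0" "?\<delta> ` ?N (Suc j) = range ((*) m)"
    using int_subgroup_principal[OF add_subgroup_image[OF add_subgroup_heis_abelian[OF sK] \<delta>]] by blast
  have hxN: "hx ` ?N i = ?K i" for i
  proof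
    show "?K i \<subseteq> hx ` ?N i"
    proof
      fix x assume "x \<in> ?K i"
      then have "Heis x 0 0 \<in> ?N i"
        unfolding heis_abelian_def using add_subgroup_0[OF add_subgroup_int_vecs] by blast
      then show "x \<in> hx ` ?N i" by (intro image_eqI[of _ _ "Heis x 0 0"]) auto
    qed
  qed (auto simp: heis_abelian_def)
  \<comment> \<open>K contains the j-th unit vector times the index of K, so the coordinate j does
    not vanish on it.\<close>
  have m0: "m \<noteq> 0"
  proof
    assume "m = 0"
    let ?e = "\<lambda>i. if i = j then (1::int) else 0"
    let ?n = "idx (int_vecs d) K"
    have e: "?e \<in> int_vecs (Suc j)" by (auto simp: int_vecs_def)
    then have "of_nat ?n * ?e \<in> K"
      using idx_multiple_int_vecs[OF K] int_vecs_mono[OF Suc.prems] by blast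
    moreover have "of_nat ?n * ?e \<in> int_vecs (Suc j)" using e by (auto simp: int_vecs_def)
    ultimately have "of_nat ?n * ?e \<in> hx ` ?N (Suc j)" using hxN[of "Suc j"] by blast
    then obtain y where y: "of_nat ?n * ?e = hx y" "y \<in> ?N (Suc j)" by (elim imageE)
    have "hx y j = int ?n" using fun_cong[OF y(1), of j] by simp
    moreover have "hx y j \<in> range ((*) m)" unfolding m(2)[symmetric] using y(2) by (rule imageI)
    ultimately show False using \<open>m = 0\<close> K(3) by auto
  qed
  have "m * 1 \<in> ?\<delta> ` ?N (Suc j)" unfolding m(2) by (rule rangeI)
  then obtain v where v: "v \<in> ?N (Suc j)" "?\<delta> v = m" by auto
  let ?F = "\<lambda>B0. {B. add_subgroup B \<and> B \<subseteq> ?N (Suc j) \<and> B \<inter> ?N j = B0 \<and> ?\<delta> ` B = range ((*) m)}"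
  have F: "finite (?F B0) \<and> card (?F B0) = idx (int_vecs d) L" if B0: "B0 \<in> glued d (?K j) L" for B0
  proof -
    have B0': "add_subgroup B0" "B0 \<subseteq> ?N j" "hx ` B0 = ?K j" "fibre_y B0 = L"
      using B0 by (simp_all add: glued_def)
    have comm: "w + h - w = h" "- w + h + w = h" if "w \<in> ?N (Suc j)" "h \<in> B0" for w h
    proof -
      have "h \<in> ?N (Suc j)" using that(2) B0'(2) ker by blast
      then have c: "w + h = h + w" using that(1) by (auto simp: heis_abelian_def Heis_add add.commute)
      then show "w + h - w = h" by simp
      have "- w + h + w = - w + (w + h)" unfolding c by (rule add.assoc)
      then show "- w + h + w = h" by simp
    qed
    have b: "bij_betw (\<lambda>H. {a \<in> ?N j. a + v \<in> H}) (?F B0) (coset B0 ` ?N j)"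
      by (rule bij_extensions[OF add_subgroup_heis_abelian[OF sK] \<delta> ker v m0 B0'(1,2)]) (simp_all add: comm)
    \<comment> \<open>\<open>B0\<close> already projects onto all of \<open>?K j\<close>, so only
      the index of the fibre L remains; each coordinate contributes this factor once.\<close>
    have i: "idx (?N j) B0 = idx (int_vecs d) L"
      using idx_heis_abelian[OF sK B0'(1,2)] B0'(3,4) idx_same[OF sK] by simp
    then have "finite (coset B0 ` ?N j)" using L(3) unfolding idx_def by (metis card.infinite)
    then show ?thesis
      unfolding bij_betw_finite[OF b] bij_betw_same_card[OF b] using i[unfolded idx_def[of "?N j"]] by (rule conjI)
  qed
  have dec: "glued d (?K (Suc j)) L = (\<Union>B0\<in>glued d (?K j) L. ?F B0)"
  proof (intro Set.set_eqI iffI)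
    fix B assume B: "B \<in> glued d (?K (Suc j)) L"
    then have B': "add_subgroup B" "B \<subseteq> ?N (Suc j)" "hx ` B = ?K (Suc j)" "fibre_y B = L"
      by (simp_all add: glued_def)
    have "B \<inter> ?N j \<in> glued d (?K j) L"
      unfolding glued_def
    proof (intro CollectI conjI)
      show "add_subgroup (B \<inter> ?N j)" by (intro add_subgroup_Int B' add_subgroup_heis_abelian sK)
      show "hx ` (B \<inter> ?N j) = ?K j"
      proof
        show "hx ` (B \<inter> ?N j) \<subseteq> ?K j" using hxN[of j] by blast
        show "?K j \<subseteq> hx ` (B \<inter> ?N j)"
        proof
          fix x assume x: "x \<in> ?K j"
          then have "x \<in> hx ` B" unfolding B'(3) using int_vecs_mono[of j "Suc j"] by auto
          then obtain b where b: "b \<in> B" "x = hx b" by blast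
          then have "b \<in> ?N j" unfolding ker using B'(2) x by (auto simp: int_vecs_def)
          then show "x \<in> hx ` (B \<inter> ?N j)" using b by blast
        qed
      qed
      have "Heis 0 0 c \<in> ?N j" if "Heis 0 0 c \<in> B" for c unfolding ker using that B'(2) by auto
      then show "fibre_y (B \<inter> ?N j) = L" unfolding B'(4)[symmetric] fibre_y_def by blast
    qed auto
    moreover have "?\<delta> ` B = range ((*) m)"
    proof -
      have "?\<delta> ` B = (\<lambda>x. x j) ` hx ` B" by (simp add: image_image)
      also have "\<dots> = (\<lambda>x. x j) ` hx ` ?N (Suc j)" unfolding B'(3) hxN ..
      finally show ?thesis unfolding m(2)[symmetric] by (simp add: image_image)
    qed
    ultimately show "B \<in> (\<Union>B0\<in>glued d (?K j) L. ?F B0)" using B'(1,2) by blast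
  next
    fix B assume "B \<in> (\<Union>B0\<in>glued d (?K j) L. ?F B0)"
    then obtain B0 where B0: "B0 \<in> glued d (?K j) L" and B: "B \<in> ?F B0" by blast
    have B0': "add_subgroup B0" "B0 \<subseteq> ?N j" "hx ` B0 = ?K j" "fibre_y B0 = L"
      using B0 by (simp_all add: glued_def)
    have B': "add_subgroup B" "B \<subseteq> ?N (Suc j)" "B \<inter> ?N j = B0" "?\<delta> ` B = range ((*) m)"
      using B by simp_all
    have "hx ` B = ?K (Suc j)"
    proof
      show "hx ` B \<subseteq> ?K (Suc j)" using B'(2) hxN[of "Suc j"] by blast
      show "?K (Suc j) \<subseteq> hx ` B"
      proof
        fix x assume x: "x \<in> ?K (Suc j)"
        then have "x \<in> hx ` ?N (Suc j)" using hxN by blast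
        then have "x j \<in> ?\<delta> ` ?N (Suc j)" by auto
        then have "x j \<in> ?\<delta> ` B" unfolding m(2) B'(4) .
        \<comment> \<open>b agrees with x in coordinate j, so the difference lies one step lower in
          the filtration, where \<open>B0\<close> supplies the rest.\<close>
        then obtain b where b: "b \<in> B" "x j = hx b j" by blast
        have "hx b \<in> ?K (Suc j)" using b B'(2) hxN[of "Suc j"] by blast
        then have y: "x - hx b \<in> ?K (Suc j)" using x add_subgroup_diff[OF sK] by blast
        have "(x - hx b) i = 0" if "j \<le> i" for i
          using y b(2) that by (cases "i = j") (auto simp: int_vecs_def)
        then have "x - hx b \<in> ?K j" using y by (auto simp: int_vecs_def)
        then obtain b0 where b0: "b0 \<in> B0" "x - hx b = hx b0" using B0'(3) by blast
        then have "b0 + b \<in> B" using b B'(1,3) add_subgroup_add by blast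
        moreover have "x = hx (b0 + b)" using b0(2) by (simp add: algebra_simps)
        ultimately show "x \<in> hx ` B" by blast
      qed
    qed
    moreover have "fibre_y B = L"
    proof -
      have "Heis 0 0 c \<in> ?N j" if "Heis 0 0 c \<in> B" for c unfolding ker using that B'(2) by auto
      then show ?thesis unfolding B0'(4)[symmetric] fibre_y_def B'(3)[symmetric] by blast
    qed
    ultimately show "B \<in> glued d (?K (Suc j)) L" using B'(1,2) by (simp add: glued_def)
  qed
  have IH: "finite (glued d (?K j) L)" "card (glued d (?K j) L) = idx (int_vecs d) L ^ j"
    using Suc by simp_all
  have "card (glued d (?K (Suc j)) L) = card (glued d (?K j) L) * idx (int_vecs d) L"
    unfolding dec by (rule card_UN_const[OF IH(1) F]) auto
  moreover have "finite (glued d (?K (Suc j)) L)" unfolding dec using IH(1) F by blast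
  ultimately show ?case using IH(2) by simp
qed

lemma card_glued:
  assumes "add_subgroup K" "K \<subseteq> int_vecs d" "idx (int_vecs d) K \<noteq> 0"
    "add_subgroup L" "L \<subseteq> int_vecs d" "idx (int_vecs d) L \<noteq> 0"
  shows "finite (glued d K L)" "card (glued d K L) = idx (int_vecs d) L ^ d"
proof -
  have "K \<inter> int_vecs d = K" using assms(2) by blast
  then show "finite (glued d K L)" "card (glued d K L) = idx (int_vecs d) L ^ d"
    using card_glued_filtered[OF assms order.refl] by simp_all
qed

text \<open>The commutator of x with an element of middle coordinate p^k is (0, 0, p^k
  \<open>hx x\<close>). The last condition thus says that such elements normalise B.\<close>

definition stable :: "nat \<Rightarrow> nat \<Rightarrow> nat \<Rightarrow> nat \<Rightarrow> heis set set" where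
  "stable p d k b = {B. add_subgroup B \<and> B \<subseteq> heis_abelian (int_vecs d) d \<and>
     idx (heis_abelian (int_vecs d) d) B = p ^ b \<and> (\<forall>x\<in>B. Heis 0 0 (of_nat (p ^ k) * hx x) \<in> B)}"

lemma glued_top:
  assumes "add_subgroup B" "B \<subseteq> heis_abelian (int_vecs d) d"
  shows "B \<in> glued d (hx ` B) (fibre_y B)" "hx ` B \<subseteq> int_vecs d" "fibre_y B \<subseteq> int_vecs d"
proof -
  have "x \<in> heis_abelian (hx ` B) d" if x: "x \<in> B" for x
  proof -
    obtain m c where mc: "x = Heis m 0 c" "c \<in> int_vecs d" using x assms(2) unfolding heis_abelian_def by blast
    have "m \<in> hx ` B" using x mc(1) by (intro image_eqI[of _ _ x]) simp_all
    then show ?thesis unfolding heis_abelian_def using mc by blast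
  qed
  then show "B \<in> glued d (hx ` B) (fibre_y B)" using assms(1) by (auto simp: glued_def)
  show "hx ` B \<subseteq> int_vecs d" "fibre_y B \<subseteq> int_vecs d"
    using assms(2) by (auto simp: heis_abelian_def fibre_y_def)
qed

text \<open>Stability depends only on the projection K and the fibre L of B: it says p^k K
  \<subseteq> L. Every such pair is then glued in as many ways as \<open>card_glued\<close>
  gives.\<close>

lemma card_stable:
  assumes p: "prime p"
  shows "finite (stable p d k b) \<and> card (stable p d k b) =
    (\<Sum>a\<le>b. card (lattice_setting.pairs p (int_vecs d) k a (b - a)) * (p ^ (b - a)) ^ d)"
proof -
  interpret lattice_setting p d "int_vecs d"
    using p rank_mod_int_vecs[of p d] prime_gt_0_nat by unfold_locales auto
  let ?V = "int_vecs d"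
  let ?g = "\<lambda>(K, L). glued d K L"
  have g: "finite (?g x) \<and> card (?g x) = (p ^ (b - a)) ^ d" if "x \<in> pairs k a (b - a)" for x a
    using that card_glued p1 by (auto simp: pairs_def)
  have disj: "?g x \<inter> ?g y = {}" if "x \<noteq> y" for x y
    using that by (auto simp: glued_def)
  have dec: "stable p d k b = (\<Union>a\<le>b. \<Union>x\<in>pairs k a (b - a). ?g x)"
  proof (intro Set.set_eqI iffI)
    fix B assume "B \<in> stable p d k b"
    then have B: "add_subgroup B" "B \<subseteq> heis_abelian ?V d" "idx (heis_abelian ?V d) B = p ^ b"
      "\<And>x. x \<in> B \<Longrightarrow> Heis 0 0 (of_nat (p ^ k) * hx x) \<in> B" by (auto simp: stable_def)
    note gl = glued_top[OF B(1,2)]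
    let ?K = "hx ` B" and ?L = "fibre_y B"
    have sg: "add_subgroup ?K" "add_subgroup ?L"
      using add_subgroup_image[OF B(1), of hx] add_subgroup_fibre_y[OF B(1)] by simp_all
    have i: "idx ?V ?K * idx ?V ?L = p ^ b" using idx_heis_abelian[OF add_subgroup_int_vecs B(1,2)] B(3) by simp
    then have "idx ?V ?K dvd p ^ b" by (metis dvd_triv_left)
    then obtain a where a: "a \<le> b" "idx ?V ?K = p ^ a" using divides_primepow_nat[OF p] by blast
    then have "p ^ a * idx ?V ?L = p ^ a * p ^ (b - a)" using i by (simp add: power_add[symmetric])
    then have "idx ?V ?L = p ^ (b - a)" using p1 by simp
    moreover have "\<forall>x\<in>?K. of_nat (p ^ k) * x \<in> ?L" using B(4) by (auto simp: fibre_y_def)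
    ultimately have "(?K, ?L) \<in> pairs k a (b - a)" using a sg gl unfolding pairs_def by blast
    then show "B \<in> (\<Union>a\<le>b. \<Union>x\<in>pairs k a (b - a). ?g x)" using a gl(1) by blast
  next
    fix B assume "B \<in> (\<Union>a\<le>b. \<Union>x\<in>pairs k a (b - a). ?g x)"
    then obtain a K L where a: "a \<le> b" "(K, L) \<in> pairs k a (b - a)" "B \<in> glued d K L" by auto
    then have KL: "K \<subseteq> ?V" "idx ?V K = p ^ a" "idx ?V L = p ^ (b - a)" "\<And>x. x \<in> K \<Longrightarrow> of_nat (p ^ k) * x \<in> L"
      by (simp_all add: pairs_def)
    have B: "add_subgroup B" "B \<subseteq> heis_abelian K d" "hx ` B = K" "fibre_y B = L"
      using a(3) by (simp_all add: glued_def)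
    have BV: "B \<subseteq> heis_abelian ?V d" using B(2) KL(1) unfolding heis_abelian_def by blast
    have "idx (heis_abelian ?V d) B = p ^ b"
      using idx_heis_abelian[OF add_subgroup_int_vecs B(1) BV] B(3,4) KL a(1) by (simp add: power_add[symmetric])
    moreover have "Heis 0 0 (of_nat (p ^ k) * hx x) \<in> B" if "x \<in> B" for x
      using KL(4)[of "hx x"] that B(3,4) by (auto simp: fibre_y_def)
    ultimately show "B \<in> stable p d k b" using B(1) BV by (simp add: stable_def)
  qed
  have "card (\<Union>x\<in>pairs k a (b - a). ?g x) = card (pairs k a (b - a)) * (p ^ (b - a)) ^ d" for a
    using card_pairs g disj by (intro card_UN_const) auto
  moreover have "card (\<Union>a\<le>b. \<Union>x\<in>pairs k a (b - a). ?g x) = (\<Sum>a\<le>b. card (\<Union>x\<in>pairs k a (b - a). ?g x))"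
  proof (rule card_UN_disjoint)
    show "\<forall>i\<in>{..b}. finite (\<Union>x\<in>pairs k i (b - i). ?g x)" using card_pairs g by blast
    show "\<forall>i\<in>{..b}. \<forall>j\<in>{..b}. i \<noteq> j \<longrightarrow> (\<Union>x\<in>pairs k i (b - i). ?g x) \<inter> (\<Union>x\<in>pairs k j (b - j). ?g x) = {}"
    proof (intro ballI impI)
      fix i j :: nat assume "i \<noteq> j"
      then have "x \<noteq> y" if "x \<in> pairs k i (b - i)" "y \<in> pairs k j (b - j)" for x y
        using that p1 by (auto simp: pairs_def)
      then have "?g x \<inter> ?g y = {}" if "x \<in> pairs k i (b - i)" "y \<in> pairs k j (b - j)" for x y
        using that disj by metis
      then show "(\<Union>x\<in>pairs k i (b - i). ?g x) \<inter> (\<Union>x\<in>pairs k j (b - j). ?g x) = {}" by blast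
    qed
  qed auto
  moreover have "finite (\<Union>a\<le>b. \<Union>x\<in>pairs k a (b - a). ?g x)" using card_pairs g by blast
  ultimately show ?thesis unfolding dec by simp
qed

text \<open>If H projects onto p^k Z in the middle coordinate, it meets the abelian part in a stable
  B of index p^(t - k); conversely \<open>bij_extensions\<close> yields as many H over B as this
  index.\<close>

lemma card_heis_subgroups:
  assumes p: "prime p"
  shows "finite {H. add_subgroup H \<and> H \<subseteq> heis_group d \<and> idx (heis_group d) H = p ^ t} \<and>
    card {H. add_subgroup H \<and> H \<subseteq> heis_group d \<and> idx (heis_group d) H = p ^ t} =
    (\<Sum>k\<le>t. card (stable p d k (t - k)) * p ^ (t - k))"
proof -
  have p1: "p > 1" using prime_gt_1_nat[OF p] .
  let ?G = "heis_group d" and ?A = "heis_abelian (int_vecs d) d"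
  let ?F = "\<lambda>k B. {H. add_subgroup H \<and> H \<subseteq> ?G \<and> H \<inter> ?A = B \<and> hk ` H = range ((*) (int (p ^ k)))}"
  have A: "?A = {x \<in> ?G. hk x = 0}" by (auto simp: heis_abelian_def heis_group_def)
  have F: "finite (?F k B) \<and> card (?F k B) = p ^ (t - k)" if B: "B \<in> stable p d k (t - k)" for k B
  proof -
    have B': "add_subgroup B" "B \<subseteq> ?A" "idx ?A B = p ^ (t - k)" "\<And>x. x \<in> B \<Longrightarrow> Heis 0 0 (of_nat (p ^ k) * hx x) \<in> B"
      using B by (auto simp: stable_def)
    let ?v = "Heis 0 (int (p ^ k)) 0"
    have v: "?v \<in> ?G" "hk ?v = int (p ^ k)" by (auto simp: heis_group_def int_vecs_def)
    \<comment> \<open>Conjugation by w or by its inverse changes h only by the element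
      \<open>?z\<close>, which lies in B by stability.\<close>
    have cj: "w + h - w \<in> B \<and> - w + h + w \<in> B" if w: "hk w = int (p ^ k)" and h: "h \<in> B" for w h
    proof -
      obtain m c where hh: "h = Heis m 0 c" using B'(2) h by (auto simp: heis_abelian_def)
      obtain m' k' c' where ww: "w = Heis m' k' c'" by (cases w)
      have k': "k' = int (p ^ k)" using w ww by simp
      let ?z = "Heis 0 0 (of_nat (p ^ k) * hx h)"
      have "w + h - w = h - ?z" "- w + h + w = h + ?z"
        unfolding hh ww by (simp_all add: Heis_add Heis_diff Heis_uminus k' algebra_simps)
      then show ?thesis using B'(4)[OF h] h add_subgroup_add[OF B'(1)] add_subgroup_diff[OF B'(1)] by simp
    qed
    have b: "bij_betw (\<lambda>H. {a \<in> ?A. a + ?v \<in> H}) (?F k B) (coset B ` ?A)"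
      by (rule bij_extensions[OF add_subgroup_heis_group _ A v _ B'(1,2)]) (use p1 cj in auto)
    have "idx ?A B \<noteq> 0" using B'(3) p1 by simp
    then have "finite (coset B ` ?A)" unfolding idx_def by (metis card.infinite)
    then show ?thesis
      unfolding bij_betw_finite[OF b] bij_betw_same_card[OF b] using B'(3)[unfolded idx_def] by (rule conjI)
  qed
  have dec: "{H. add_subgroup H \<and> H \<subseteq> ?G \<and> idx ?G H = p ^ t} = (\<Union>k\<le>t. \<Union>B\<in>stable p d k (t - k). ?F k B)"
  proof (intro Set.set_eqI iffI)
    fix H assume "H \<in> {H. add_subgroup H \<and> H \<subseteq> ?G \<and> idx ?G H = p ^ t}"
    then have H: "add_subgroup H" "H \<subseteq> ?G" "idx ?G H = p ^ t" by simp_all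
    have img: "hk ` ?G = UNIV"
    proof -
      have "Heis 0 k 0 \<in> ?G" for k by (auto simp: heis_group_def int_vecs_def)
      then show ?thesis by (metis (no_types, lifting) UNIV_eq_I heis.sel(2) imageI)
    qed
    have B: "{x \<in> H. hk x = 0} = H \<inter> ?A" unfolding A using H(2) by blast
    obtain g where g: "g \<ge> 0" "hk ` H = range ((*) g)"
      using int_subgroup_principal[OF add_subgroup_image[OF H(1), of hk]] by auto
    have i: "nat g * idx ?A (H \<inter> ?A) = p ^ t"
      using idx_hom[OF add_subgroup_heis_group H(1,2), of hk] H(3)
      unfolding img A[symmetric] B g(2) idx_int_multiples[OF g(1)] by simp
    then have "nat g dvd p ^ t" by (metis dvd_triv_left)
    then obtain k where k: "k \<le> t" "nat g = p ^ k" using divides_primepow_nat[OF p] by blast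
    have gk: "g = int (p ^ k)" using k g(1) by (metis int_nat_eq)
    have "p ^ k * idx ?A (H \<inter> ?A) = p ^ k * p ^ (t - k)"
      using i k by (simp add: power_add[symmetric])
    then have iA: "idx ?A (H \<inter> ?A) = p ^ (t - k)" using p1 by simp
    have "int (p ^ k) * 1 \<in> hk ` H" unfolding g(2) gk by (rule rangeI)
    then obtain w where w: "w \<in> H" "hk w = int (p ^ k)" by auto
    have "H \<inter> ?A \<in> stable p d k (t - k)"
      unfolding stable_def
    proof (intro CollectI conjI ballI)
      show "add_subgroup (H \<inter> ?A)"
        by (intro add_subgroup_Int H add_subgroup_heis_abelian add_subgroup_int_vecs)
      fix x assume x: "x \<in> H \<inter> ?A"
      then obtain m c where hh: "x = Heis m 0 c" "m \<in> int_vecs d" by (auto simp: heis_abelian_def)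
      obtain m' k' c' where ww: "w = Heis m' k' c'" by (cases w)
      have k': "k' = int (p ^ k)" using w ww by simp
      have "- w + x + w \<in> H" using x w add_subgroup_add[OF H(1)] add_subgroup_uminus[OF H(1)] by blast
      then have "- x + (- w + x + w) \<in> H" using x add_subgroup_add[OF H(1)] add_subgroup_uminus[OF H(1)] by blast
      moreover have "- x + (- w + x + w) = Heis 0 0 (of_nat (p ^ k) * hx x)"
        unfolding hh ww by (simp add: Heis_add Heis_uminus k' algebra_simps)
      moreover have "Heis 0 0 (of_nat (p ^ k) * hx x) \<in> ?A"
        using hh by (auto simp: heis_abelian_def int_vecs_def)
      ultimately show "Heis 0 0 (of_nat (p ^ k) * hx x) \<in> H \<inter> ?A" by simp
    qed (use iA in auto)
    then show "H \<in> (\<Union>k\<le>t. \<Union>B\<in>stable p d k (t - k). ?F k B)" using k(1) H g gk by blast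
  next
    fix H assume "H \<in> (\<Union>k\<le>t. \<Union>B\<in>stable p d k (t - k). ?F k B)"
    then obtain k where k: "k \<le> t" "H \<inter> ?A \<in> stable p d k (t - k)" "add_subgroup H" "H \<subseteq> ?G"
      "hk ` H = range ((*) (int (p ^ k)))" by blast
    have img: "hk ` ?G = UNIV"
    proof -
      have "Heis 0 k 0 \<in> ?G" for k by (auto simp: heis_group_def int_vecs_def)
      then show ?thesis by (metis (no_types, lifting) UNIV_eq_I heis.sel(2) imageI)
    qed
    have B: "{x \<in> H. hk x = 0} = H \<inter> ?A" unfolding A using k(4) by blast
    have "idx ?G H = nat (int (p ^ k)) * idx ?A (H \<inter> ?A)"
      using idx_hom[OF add_subgroup_heis_group k(3,4), of hk]
      unfolding img A[symmetric] B k(5) using idx_int_multiples[of "int (p ^ k)"] by simp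
    also have "\<dots> = p ^ t" unfolding nat_int using k(1,2) by (simp add: stable_def power_add[symmetric])
    finally show "H \<in> {H. add_subgroup H \<and> H \<subseteq> ?G \<and> idx ?G H = p ^ t}" using k(3,4) by simp
  qed
  have fs: "finite (stable p d k b)" for k b using card_stable[OF p] by blast
  have "card (\<Union>B\<in>stable p d k (t - k). ?F k B) = card (stable p d k (t - k)) * p ^ (t - k)" for k
    using fs F by (intro card_UN_const) blast+
  moreover have "card (\<Union>k\<le>t. \<Union>B\<in>stable p d k (t - k). ?F k B) = (\<Sum>k\<le>t. card (\<Union>B\<in>stable p d k (t - k). ?F k B))"
  proof (rule card_UN_disjoint)
    show "\<forall>k\<in>{..t}. finite (\<Union>B\<in>stable p d k (t - k). ?F k B)" using fs F by blast
    show "\<forall>i\<in>{..t}. \<forall>j\<in>{..t}. i \<noteq> j \<longrightarrow>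
      (\<Union>B\<in>stable p d i (t - i). ?F i B) \<inter> (\<Union>B\<in>stable p d j (t - j). ?F j B) = {}"
    proof (intro ballI impI)
      fix i j :: nat assume ij: "i \<noteq> j"
      have "range ((*) (int (p ^ i))) \<noteq> range ((*) (int (p ^ j)))"
      proof
        assume "range ((*) (int (p ^ i))) = range ((*) (int (p ^ j)))"
        then have "nat (int (p ^ i)) = nat (int (p ^ j))" using idx_int_multiples by (metis of_nat_0_le_iff)
        then show False unfolding nat_int using ij p1 by simp
      qed
      then have e: "?F i B \<inter> ?F j B' = {}" for B B' by blast
      show "(\<Union>B\<in>stable p d i (t - i). ?F i B) \<inter> (\<Union>B\<in>stable p d j (t - j). ?F j B) = {}"
        unfolding Int_UN_distrib2 e by simp
    qed
  qed auto
  moreover have "finite (\<Union>k\<le>t. \<Union>B\<in>stable p d k (t - k). ?F k B)" using fs F by blast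
  ultimately show ?thesis unfolding dec by simp
qed

section \<open>Generating functions\<close>

unbundle no vec_syntax and fps_syntax

lemma of_nat_qbinom: "of_nat (qbinom p n k) = (qbinom (of_nat p) n k :: 'a::comm_ring_1)"
  by (induction p n k rule: qbinom.induct) simp_all

lemma of_nat_trans_coeff: "of_nat (trans_coeff p d r i) = (trans_coeff (of_nat p) d r i :: 'a::comm_ring_1)"
  by (simp add: trans_coeff_def of_nat_qbinom)

lemma trans_coeff_eq_0:
  assumes "r < i" "i \<le> d"
  shows "trans_coeff q d r i = 0"
proof -
  have "d - i < d - r" using assms by simp
  then show ?thesis by (simp add: trans_coeff_def qbinom_eq_0)
qed

text \<open>The generating function of \<open>N l e\<close> with \<open>l\<close> and \<open>e\<close> weighted by
  \<open>q\<^bsup>d+1\<^esup>T\<close> and \<open>qT\<close>.\<close>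

definition gen2 :: "complex \<Rightarrow> nat \<Rightarrow> (nat \<Rightarrow> nat \<Rightarrow> complex) \<Rightarrow> complex fps" where
  "gen2 q d N = Abs_fps (\<lambda>m. \<Sum>l\<le>m. N l (m - l) * q ^ ((d + 1) * l + (m - l)))"

text \<open>Shifting the arguments of the counting function becomes multiplication by a monomial, so
  recursions for cardinalities turn into linear equations between power series.\<close>

lemma gen2_shift:
  "gen2 q d (\<lambda>l e. if a \<le> l \<and> b \<le> e then N (l - a) (e - b) else 0) =
   fps_const (q ^ ((d + 1) * a + b)) * fps_X ^ (a + b) * gen2 q d N"
proof (rule fps_ext)
  fix m
  let ?g = "\<lambda>l e. (if a \<le> l \<and> b \<le> e then N (l - a) (e - b) else 0) * q ^ ((d + 1) * l + e)"
  show "gen2 q d (\<lambda>l e. if a \<le> l \<and> b \<le> e then N (l - a) (e - b) else 0) $ m =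
    (fps_const (q ^ ((d + 1) * a + b)) * fps_X ^ (a + b) * gen2 q d N) $ m"
  proof (cases "a + b \<le> m")
    case False
    then have "?g l (m - l) = 0" if "l \<le> m" for l using that by auto
    then have "(\<Sum>l\<le>m. ?g l (m - l)) = 0" by (intro sum.neutral) auto
    then have "gen2 q d (\<lambda>l e. if a \<le> l \<and> b \<le> e then N (l - a) (e - b) else 0) $ m = 0"
      unfolding gen2_def fps_nth_Abs_fps .
    then show ?thesis using False by (simp add: mult.assoc fps_X_power_mult_nth)
  next
    case True
    have "(\<Sum>l\<le>m. ?g l (m - l)) = (\<Sum>l\<in>{a..m - b}. ?g l (m - l))"
      by (rule sum.mono_neutral_right) auto
    also have "\<dots> = (\<Sum>l\<le>m - (a + b). q ^ ((d + 1) * a + b) * (N l (m - (a + b) - l) * q ^ ((d + 1) * l + (m - (a + b) - l))))"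
    proof (rule sum.reindex_bij_witness[of _ "\<lambda>l. l + a" "\<lambda>l. l - a"])
      fix l assume l: "l \<in> {a..m - b}"
      then have "m - (a + b) - (l - a) = m - l - b" "l = (l - a) + a" "m - l = (m - l - b) + b"
        using True by auto
      moreover have "(d + 1) * l + (m - l) = ((d + 1) * a + b) + ((d + 1) * (l - a) + (m - l - b))"
        using calculation by (metis (no_types, opaque_lifting) add.assoc add.commute distrib_left)
      ultimately show "q ^ ((d + 1) * a + b) * (N (l - a) (m - (a + b) - (l - a)) *
          q ^ ((d + 1) * (l - a) + (m - (a + b) - (l - a)))) = ?g l (m - l)"
        using l True by (simp only: power_add) (auto simp: mult_ac)
    qed (use True in auto)
    finally show ?thesis using True
      by (simp add: gen2_def mult.assoc fps_X_power_mult_nth sum_distrib_left)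
  qed
qed

lemma gen2_sum: "gen2 q d (\<lambda>l e. \<Sum>i\<in>I. c i * N i l e) = (\<Sum>i\<in>I. fps_const (c i) * gen2 q d (N i))"
proof (rule fps_ext)
  fix m
  have "(\<Sum>l\<le>m. (\<Sum>i\<in>I. c i * N i l (m - l)) * q ^ ((d + 1) * l + (m - l))) =
     (\<Sum>i\<in>I. c i * (\<Sum>l\<le>m. N i l (m - l) * q ^ ((d + 1) * l + (m - l))))"
    unfolding sum_distrib_right sum_distrib_left by (subst sum.swap) (simp only: mult.assoc)
  then show "gen2 q d (\<lambda>l e. \<Sum>i\<in>I. c i * N i l e) $ m = (\<Sum>i\<in>I. fps_const (c i) * gen2 q d (N i)) $ m"
    by (simp add: gen2_def fps_sum_nth)
qed

text \<open>The formal sum of X^k * S k over all k, where X^k records the index p^k in the middle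
  coordinate.\<close>

definition diag_fps :: "(nat \<Rightarrow> complex fps) \<Rightarrow> complex fps" where
  "diag_fps S = Abs_fps (\<lambda>m. \<Sum>k\<le>m. S k $ (m - k))"

lemma diag_fps_Suc: "diag_fps S = S 0 + fps_X * diag_fps (\<lambda>k. S (Suc k))"
proof (rule fps_ext)
  fix m show "diag_fps S $ m = (S 0 + fps_X * diag_fps (\<lambda>k. S (Suc k))) $ m"
    by (cases m) (simp_all add: diag_fps_def sum.atMost_Suc_shift del: sum.atMost_Suc)
qed

lemma diag_fps_mult: "diag_fps (\<lambda>k. A * S k) = A * diag_fps S"
proof (rule fps_ext)
  fix m
  have "(\<Sum>k\<le>m. \<Sum>i\<le>m - k. A $ i * S k $ (m - k - i)) = (\<Sum>i\<le>m. \<Sum>k\<le>m - i. A $ i * S k $ (m - i - k))"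
  proof -
    have "(\<Sum>k\<le>m. \<Sum>i\<le>m - k. A $ i * S k $ (m - k - i)) =
        (\<Sum>(k, i)\<in>(SIGMA k:{..m}. {..m - k}). A $ i * S k $ (m - k - i))"
      by (rule sum.Sigma) auto
    also have "\<dots> = (\<Sum>(i, k)\<in>(SIGMA i:{..m}. {..m - i}). A $ i * S k $ (m - i - k))"
      by (rule sum.reindex_bij_witness[of _ "\<lambda>(i, k). (k, i)" "\<lambda>(k, i). (i, k)"])
        (auto simp: diff_diff_eq add.commute)
    also have "\<dots> = (\<Sum>i\<le>m. \<Sum>k\<le>m - i. A $ i * S k $ (m - i - k))"
      by (rule sum.Sigma[symmetric]) auto
    finally show ?thesis .
  qed
  then show "diag_fps (\<lambda>k. A * S k) $ m = (A * diag_fps S) $ m"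
    by (simp add: diag_fps_def fps_mult_nth atLeast0AtMost sum_distrib_left)
qed

lemma diag_fps_sum: "diag_fps (\<lambda>k. \<Sum>i\<in>I. S i k) = (\<Sum>i\<in>I. diag_fps (S i))"
  by (rule fps_ext) (simp add: diag_fps_def fps_sum_nth, rule sum.swap)

text \<open>The counting series and the functions satisfy systems of the same shape. As A r r has
  constant term 0, the series 1 - A r r is invertible and forward substitution can be followed on
  both sides.\<close>

lemma has_fps_expansion_tri_solve:
  fixes a :: "nat \<Rightarrow> nat \<Rightarrow> complex \<Rightarrow> complex"
  assumes "\<And>r. r \<le> n \<Longrightarrow> F r = B r + (\<Sum>i\<le>r. A r i * F i)"
    and "\<And>r i. i \<le> r \<Longrightarrow> r \<le> n \<Longrightarrow> a r i has_fps_expansion A r i"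
    and "\<And>r. r \<le> n \<Longrightarrow> b r has_fps_expansion B r"
    and "\<And>r. r \<le> n \<Longrightarrow> A r r $ 0 = 0" and "r \<le> n"
  shows "(\<lambda>v. tri_solve (\<lambda>r i. a r i v) (\<lambda>r. b r v) r) has_fps_expansion F r"
  using assms(5)
proof (induction r rule: less_induct)
  case (less r)
  let ?t = "\<lambda>r v. tri_solve (\<lambda>r i. a r i v) (\<lambda>r. b r v) r"
  have "F r = B r + (\<Sum>i<r. A r i * F i) + A r r * F r"
    using assms(1)[OF less.prems] by (simp add: lessThan_Suc_atMost[symmetric] add.assoc)
  then have "F r * (1 - A r r) = B r + (\<Sum>i<r. A r i * F i)" by (simp add: algebra_simps)
  moreover have nz: "(1 - A r r) $ 0 \<noteq> 0" using assms(4)[OF less.prems] by simp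
  ultimately have eq: "F r = (B r + (\<Sum>i<r. A r i * F i)) * inverse (1 - A r r)"
    using inverse_mult_eq_1'[OF nz] by (metis mult.assoc mult.right_neutral)
  have "(\<lambda>v. (b r v + (\<Sum>i<r. a r i v * ?t i v)) * inverse (1 - a r r v)) has_fps_expansion F r"
    unfolding eq using less assms(2,3) nz
    by (intro has_fps_expansion_mult has_fps_expansion_add has_fps_expansion_sum
        has_fps_expansion_inverse has_fps_expansion_diff has_fps_expansion_1) auto
  moreover have "(\<lambda>v. (b r v + (\<Sum>i<r. a r i v * ?t i v)) * inverse (1 - a r r v)) = ?t r"
    by (rule ext, subst (2) tri_solve.simps) (simp add: divide_inverse)
  ultimately show ?case by simp
qed

section \<open>Power series of lattices and of pairs\<close>

context lattice_setting begin

abbreviation Q :: complex where "Q \<equiv> of_nat p"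

definition fam_fps :: "nat \<Rightarrow> nat \<Rightarrow> complex fps" where
  "fam_fps k r = gen2 Q d (\<lambda>l e. of_nat (card (fam k r l e)))"

lemma fam_fps_Suc:
  assumes "r \<le> d"
  shows "fam_fps (Suc k) r = fps_const (Q ^ ((d + 1) * r)) * fps_X ^ r *
    (\<Sum>i\<le>d. fps_const (trans_coeff Q d r i) * fam_fps k i)"
proof -
  have "fam_fps (Suc k) r = gen2 Q d (\<lambda>l e. if r \<le> l \<and> 0 \<le> e then
      (\<Sum>i\<le>d. trans_coeff Q d r i * of_nat (card (fam k i (l - r) (e - 0)))) else 0)"
    unfolding fam_fps_def card_fam_Suc[OF assms]
    by (intro arg_cong[where f = "gen2 Q d"] ext) (auto simp: of_nat_trans_coeff)
  also have "\<dots> = fps_const (Q ^ ((d + 1) * r + 0)) * fps_X ^ (r + 0) *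
      gen2 Q d (\<lambda>l e. \<Sum>i\<le>d. trans_coeff Q d r i * of_nat (card (fam k i l e)))"
    by (rule gen2_shift)
  finally show ?thesis unfolding gen2_sum fam_fps_def by simp
qed

text \<open>For k = 0 both exponents l and e equal [L], so both are shifted by r. The weights
  q^(d+1) X and q X combine, and this produces the argument q^(d+2) t^2 in
  \<open>pair_fun\<close>.\<close>

lemma fam_fps_0:
  assumes "r \<le> d"
  shows "fam_fps 0 r = of_bool (r = 0) + (\<Sum>i\<le>r. (if r = 0 then 0 else
    fps_const (Q ^ ((d + 2) * r) * trans_coeff Q d r i) * fps_X ^ (2 * r)) * fam_fps 0 i)"
proof (cases "r = 0")
  case True
  have "card (fam 0 0 l e) = of_bool (l = 0 \<and> e = 0)" for l e by (auto simp: fam_0 fam1_0)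
  then have "fam_fps 0 0 = 1"
    unfolding fam_fps_def gen2_def by (intro fps_ext) (auto simp: if_distrib cong: if_cong intro!: sum.neutral)
  then show ?thesis using True by simp
next
  case False
  have c: "of_nat (card (fam 0 r l e)) = (if r \<le> l \<and> r \<le> e then
      (\<Sum>i\<le>d. trans_coeff Q d r i * of_nat (card (fam 0 i (l - r) (e - r)))) else 0)" for l e
  proof (cases "l = e")
    case True
    then show ?thesis using assms by (simp add: fam_0 card_fam1[of r e] of_nat_trans_coeff)
  next
    case False
    then have "l - r \<noteq> e - r" if "r \<le> l" "r \<le> e" using that by simp
    then show ?thesis using False by (simp add: fam_0)
  qed
  have "fam_fps 0 r = fps_const (Q ^ ((d + 1) * r + r)) * fps_X ^ (r + r) *
      (\<Sum>i\<le>d. fps_const (trans_coeff Q d r i) * fam_fps 0 i)"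
    unfolding fam_fps_def c gen2_sum[symmetric] by (rule gen2_shift)
  also have "(\<Sum>i\<le>d. fps_const (trans_coeff Q d r i) * fam_fps 0 i) = (\<Sum>i\<le>r. fps_const (trans_coeff Q d r i) * fam_fps 0 i)"
    using assms by (intro sum.mono_neutral_right) (auto simp: trans_coeff_eq_0)
  also have "(d + 1) * r + r = (d + 2) * r" by simp
  also have "r + r = 2 * r" by simp
  finally show ?thesis using False
    by (simp add: sum_distrib_left fps_const_mult[symmetric] mult_ac del: fps_const_mult)
qed

lemma fam_fps_0_expansion:
  "r \<le> d \<Longrightarrow> (\<lambda>v. lattice_fun Q d (Q ^ (d + 2) * v ^ 2) r) has_fps_expansion fam_fps 0 r"
  unfolding lattice_fun_def
proof (rule has_fps_expansion_tri_solve[OF fam_fps_0])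
  fix r i
  have "(\<lambda>v. (Q ^ ((d + 2) * r) * trans_coeff Q d r i) * v ^ (2 * r)) has_fps_expansion
    fps_const (Q ^ ((d + 2) * r) * trans_coeff Q d r i) * fps_X ^ (2 * r)"
    by (intro has_fps_expansion_mult has_fps_expansion_const has_fps_expansion_fps_X_power)
  moreover have "(Q ^ ((d + 2) * r) * trans_coeff Q d r i) * v ^ (2 * r) =
      (Q ^ (d + 2) * v ^ 2) ^ r * trans_coeff Q d r i" for v
    unfolding power_mult power_mult_distrib by (simp only: mult_ac)
  ultimately show "(\<lambda>v. if r = 0 then 0 else (Q ^ (d + 2) * v ^ 2) ^ r * trans_coeff Q d r i) has_fps_expansion
    (if r = 0 then 0 else fps_const (Q ^ ((d + 2) * r) * trans_coeff Q d r i) * fps_X ^ (2 * r))"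
    by (cases "r = 0") (simp_all only: if_True if_False simp_thms has_fps_expansion_0)
next
  fix r :: nat
  show "(\<lambda>v. of_bool (r = 0)) has_fps_expansion of_bool (r = 0)"
    by (cases "r = 0") (simp_all add: has_fps_expansion_0 has_fps_expansion_1)
qed auto

definition pair_fps :: "nat \<Rightarrow> complex fps" where
  "pair_fps r = diag_fps (\<lambda>k. fam_fps k r)"

text \<open>The part k = 0 is split off; in the others \<open>fam_fps_Suc\<close> replaces k + 1 by
  k at the cost of one X for the index and (q^(d+1) X)^r for L.\<close>

lemma pair_fps_eq:
  assumes "r \<le> d"
  shows "pair_fps r = fam_fps 0 r + (\<Sum>i\<le>r. (fps_const (Q ^ ((d + 1) * r) * trans_coeff Q d r i) * fps_X ^ Suc r) * pair_fps i)"
proof -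
  have "pair_fps r = fam_fps 0 r + fps_X * diag_fps (\<lambda>k. fps_const (Q ^ ((d + 1) * r)) * fps_X ^ r *
    (\<Sum>i\<le>d. fps_const (trans_coeff Q d r i) * fam_fps k i))"
    unfolding pair_fps_def by (subst diag_fps_Suc) (simp only: fam_fps_Suc[OF assms])
  also have "diag_fps (\<lambda>k. fps_const (Q ^ ((d + 1) * r)) * fps_X ^ r *
    (\<Sum>i\<le>d. fps_const (trans_coeff Q d r i) * fam_fps k i)) = fps_const (Q ^ ((d + 1) * r)) * fps_X ^ r *
    (\<Sum>i\<le>d. fps_const (trans_coeff Q d r i) * pair_fps i)"
    unfolding diag_fps_mult diag_fps_sum pair_fps_def ..
  also have "(\<Sum>i\<le>d. fps_const (trans_coeff Q d r i) * pair_fps i) = (\<Sum>i\<le>r. fps_const (trans_coeff Q d r i) * pair_fps i)"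
    using assms by (intro sum.mono_neutral_right) (auto simp: trans_coeff_eq_0)
  finally show ?thesis
    by (simp add: sum_distrib_left fps_const_mult[symmetric] mult_ac del: fps_const_mult)
qed

lemma pair_fps_expansion:
  "r \<le> d \<Longrightarrow> (\<lambda>v. pair_fun Q d v r) has_fps_expansion pair_fps r"
  unfolding pair_fun_def
proof (rule has_fps_expansion_tri_solve[OF pair_fps_eq])
  fix r i
  have "(\<lambda>v. (Q ^ ((d + 1) * r) * trans_coeff Q d r i) * v ^ Suc r) has_fps_expansion
    fps_const (Q ^ ((d + 1) * r) * trans_coeff Q d r i) * fps_X ^ Suc r"
    by (intro has_fps_expansion_mult has_fps_expansion_const has_fps_expansion_fps_X_power)
  moreover have "(Q ^ ((d + 1) * r) * trans_coeff Q d r i) * v ^ Suc r =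
      v * (Q ^ (d + 1) * v) ^ r * trans_coeff Q d r i" for v
    unfolding power_mult power_mult_distrib power_Suc by (simp only: mult_ac)
  ultimately show "(\<lambda>v. v * (Q ^ (d + 1) * v) ^ r * trans_coeff Q d r i) has_fps_expansion
    fps_const (Q ^ ((d + 1) * r) * trans_coeff Q d r i) * fps_X ^ Suc r"
    by (simp only:)
qed (use fam_fps_0_expansion in auto)

definition rank_fps :: "nat \<Rightarrow> complex fps" where
  "rank_fps r = Abs_fps (\<lambda>j. Q ^ j * of_nat (num_rank p d r j))"

lemma rank_fps_eq:
  assumes "r \<le> d"
  shows "rank_fps r = of_bool (r = 0) + (\<Sum>i\<le>r. (if r = 0 then 0 else
    fps_const (Q ^ r * trans_coeff Q d r i) * fps_X ^ r) * rank_fps i)"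
proof (cases "r = 0")
  case True
  have "rank_fps 0 = 1" by (rule fps_ext) (simp add: rank_fps_def num_rank.simps)
  then show ?thesis using True by simp
next
  case False
  have "rank_fps r = (\<Sum>i\<le>d. fps_const (Q ^ r * trans_coeff Q d r i) * fps_X ^ r * rank_fps i)"
  proof (rule fps_ext)
    fix m
    show "rank_fps r $ m = (\<Sum>i\<le>d. fps_const (Q ^ r * trans_coeff Q d r i) * fps_X ^ r * rank_fps i) $ m"
    proof (cases "r \<le> m")
      case True
      then have "Q ^ m = Q ^ r * Q ^ (m - r)" unfolding power_add[symmetric] by simp
      moreover have "num_rank p d r m = (\<Sum>i\<le>d. trans_coeff p d r i * num_rank p d i (m - r))"
        by (subst num_rank.simps) (use True False in simp)
      ultimately show ?thesis using True
        by (simp add: rank_fps_def fps_sum_nth mult.assoc fps_X_power_mult_nth of_nat_trans_coeff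
            sum_distrib_left mult.left_commute)
    next
      case lt: False
      then have "num_rank p d r m = 0" using False by (subst num_rank.simps) simp
      then show ?thesis using lt by (simp add: rank_fps_def fps_sum_nth mult.assoc fps_X_power_mult_nth)
    qed
  qed
  also have "\<dots> = (\<Sum>i\<le>r. fps_const (Q ^ r * trans_coeff Q d r i) * fps_X ^ r * rank_fps i)"
    using assms by (intro sum.mono_neutral_right) (auto simp: trans_coeff_eq_0)
  finally show ?thesis using False by simp
qed

lemma rank_fps_expansion:
  "r \<le> d \<Longrightarrow> (\<lambda>v. lattice_fun Q d (Q * v) r) has_fps_expansion rank_fps r"
  unfolding lattice_fun_def
proof (rule has_fps_expansion_tri_solve[OF rank_fps_eq])
  fix r i
  have "(\<lambda>v. (Q ^ r * trans_coeff Q d r i) * v ^ r) has_fps_expansion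
    fps_const (Q ^ r * trans_coeff Q d r i) * fps_X ^ r"
    by (intro has_fps_expansion_mult has_fps_expansion_const has_fps_expansion_fps_X_power)
  then show "(\<lambda>v. if r = 0 then 0 else (Q * v) ^ r * trans_coeff Q d r i) has_fps_expansion
    (if r = 0 then 0 else fps_const (Q ^ r * trans_coeff Q d r i) * fps_X ^ r)"
    by (cases "r = 0") (simp_all add: power_mult_distrib mult_ac has_fps_expansion_0)
next
  fix r :: nat
  show "(\<lambda>v. of_bool (r = 0)) has_fps_expansion of_bool (r = 0)"
    by (cases "r = 0") (simp_all add: has_fps_expansion_0 has_fps_expansion_1)
qed auto

definition zeta_fps :: "complex fps" where
  "zeta_fps = (\<Sum>r\<le>d. rank_fps r) * (\<Sum>r\<le>d. pair_fps r)"

lemma zeta_fps_expansion: "zeta_fun Q d has_fps_expansion zeta_fps"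
proof -
  have "(\<lambda>v. zeta_fun Q d v) has_fps_expansion zeta_fps"
    unfolding zeta_fun_def zeta_fps_def
    by (intro has_fps_expansion_mult has_fps_expansion_sum rank_fps_expansion pair_fps_expansion) auto
  then show ?thesis by simp
qed

text \<open>Here the product of series is matched with the group count: the powers of q in the
  weights have to reproduce the number of gluings and the number of extensions.\<close>

lemma zeta_fps_nth:
  "zeta_fps $ t = of_nat (\<Sum>k\<le>t. (\<Sum>a\<le>t - k. card (pairs k a (t - k - a)) * (p ^ (t - k - a)) ^ d) * p ^ (t - k))"
proof -
  define s where "s = (\<lambda>j. of_nat (num_sub p d j) :: complex)"
  define N where "N = (\<lambda>k r l e. of_nat (card (fam k r l e)) :: complex)"
  have Z: "(\<Sum>r\<le>d. rank_fps r) $ j = Q ^ j * s j" for j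
    by (simp add: fps_sum_nth rank_fps_def s_def num_sub_def sum_distrib_left)
  have "(\<Sum>r\<le>d. rank_fps r) * (\<Sum>r\<le>d. pair_fps r) = diag_fps (\<lambda>k. (\<Sum>r\<le>d. rank_fps r) * (\<Sum>r\<le>d. fam_fps k r))"
    unfolding pair_fps_def diag_fps_mult diag_fps_sum ..
  then have zt: "zeta_fps $ t = (\<Sum>k\<le>t. ((\<Sum>r\<le>d. rank_fps r) * (\<Sum>r\<le>d. fam_fps k r)) $ (t - k))"
    unfolding zeta_fps_def by (simp add: diag_fps_def)
  have "((\<Sum>r\<le>d. rank_fps r) * (\<Sum>r\<le>d. fam_fps k r)) $ b =
     (\<Sum>a\<le>b. (\<Sum>r\<le>d. \<Sum>e\<le>a. N k r (b - a) e * s (a - e)) * (Q ^ (b - a)) ^ d) * Q ^ b" for k b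
  proof -
    have "((\<Sum>r\<le>d. rank_fps r) * fam_fps k r) $ b =
       (\<Sum>a\<le>b. \<Sum>e\<le>a. (N k r (b - a) e * s (a - e)) * (Q ^ (b - a)) ^ d * Q ^ b)" for r
    proof -
      have "((\<Sum>r\<le>d. rank_fps r) * fam_fps k r) $ b =
        (\<Sum>i\<le>b. \<Sum>l\<le>b - i. (Q ^ i * s i) * (N k r l (b - i - l) * Q ^ ((d + 1) * l + (b - i - l))))"
        unfolding fps_mult_nth Z fam_fps_def gen2_def N_def by (simp add: atLeast0AtMost sum_distrib_left)
      also have "\<dots> = (\<Sum>(i, l)\<in>(SIGMA i:{..b}. {..b - i}). (Q ^ i * s i) * (N k r l (b - i - l) * Q ^ ((d + 1) * l + (b - i - l))))"
        by (rule sum.Sigma) auto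
      also have "\<dots> = (\<Sum>(a, e)\<in>(SIGMA a:{..b}. {..a}). (N k r (b - a) e * s (a - e)) * (Q ^ (b - a)) ^ d * Q ^ b)"
      \<comment> \<open>In the product, i is the exponent of the index of K in M_k and l is [L].
        Since the total is b, this means a = [K] = b - l and e = [M_k] = b - i - l.\<close>
      proof (rule sum.reindex_bij_witness[of _ "\<lambda>(a, e). (a - e, b - a)" "\<lambda>(i, l). (b - l, b - i - l)"])
        fix x assume x: "x \<in> (SIGMA i:{..b}. {..b - i})"
        then obtain i l where il: "x = (i, l)" "i \<le> b" "l \<le> b - i" by auto
        \<comment> \<open>The exponent of q splits into l d, for the gluing data, and b, for the
          lifts of a generator in the middle coordinate.\<close>
        then have "i + ((d + 1) * l + (b - i - l)) = l * d + b" by (simp add: algebra_simps)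
        then have "Q ^ i * Q ^ ((d + 1) * l + (b - i - l)) = (Q ^ l) ^ d * Q ^ b"
          unfolding power_add[symmetric] power_mult[symmetric] by (simp only: )
        moreover have "b - (b - l) = l" "b - l - (b - i - l) = i" using il by auto
        ultimately show "(case (case x of (i, l) \<Rightarrow> (b - l, b - i - l)) of
            (a, e) \<Rightarrow> N k r (b - a) e * s (a - e) * (Q ^ (b - a)) ^ d * Q ^ b) =
          (case x of (i, l) \<Rightarrow> Q ^ i * s i * (N k r l (b - i - l) * Q ^ ((d + 1) * l + (b - i - l))))"
          unfolding il(1) by (simp add: mult_ac)
      qed auto
      also have "\<dots> = (\<Sum>a\<le>b. \<Sum>e\<le>a. (N k r (b - a) e * s (a - e)) * (Q ^ (b - a)) ^ d * Q ^ b)"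
        by (rule sum.Sigma[symmetric]) auto
      finally show ?thesis .
    qed
    then have "((\<Sum>r\<le>d. rank_fps r) * (\<Sum>r\<le>d. fam_fps k r)) $ b =
       (\<Sum>r\<le>d. \<Sum>a\<le>b. \<Sum>e\<le>a. (N k r (b - a) e * s (a - e)) * (Q ^ (b - a)) ^ d * Q ^ b)"
      by (simp add: sum_distrib_left fps_sum_nth)
    also have "\<dots> = (\<Sum>a\<le>b. \<Sum>r\<le>d. \<Sum>e\<le>a. (N k r (b - a) e * s (a - e)) * (Q ^ (b - a)) ^ d * Q ^ b)"
      by (rule sum.swap)
    finally show ?thesis by (simp only: sum_distrib_right)
  qed
  then show ?thesis
    unfolding zt conjunct2[OF card_pairs] N_def s_def by simp
qed

end

section \<open>The presented group\<close>

context group begin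

lemma conj_int_pow:
  assumes "a \<in> carrier G" "b \<in> carrier G"
  shows "(a \<otimes> b \<otimes> inv a) [^] (k::int) = a \<otimes> b [^] k \<otimes> inv a"
proof -
  have "inv a \<otimes> (a \<otimes> z) = z" if "z \<in> carrier G" for z
    using assms(1) that by (simp add: m_assoc[symmetric])
  then have "(\<lambda>b. a \<otimes> b \<otimes> inv a) \<in> hom G G"
    using assms(1) by (intro homI) (simp_all add: m_assoc)
  then interpret h: group_hom G G "\<lambda>b. a \<otimes> b \<otimes> inv a"
    by unfold_locales
  show ?thesis using h.hom_int_pow[OF assms(2)] by simp
qed

lemma commute_int_pow:
  assumes "a \<in> carrier G" "b \<in> carrier G" "a \<otimes> b = b \<otimes> a"
  shows "a \<otimes> b [^] (k::int) = b [^] k \<otimes> a"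
proof -
  have "a \<otimes> b \<otimes> inv a = b" using assms by (simp add: m_assoc)
  then have "a \<otimes> b [^] k \<otimes> inv a = b [^] k" using conj_int_pow[OF assms(1,2), of k] by simp
  then show ?thesis using assms by (metis inv_closed inv_solve_right' int_pow_closed m_closed)
qed

text \<open>The commutator is bilinear because y commutes with x and t. Conjugation by t sends x to
  x y^(-1), which gives the exponent m; conjugation by the inverse of x^m then sends t to t y^(-m),
  which gives the exponent k.\<close>

lemma int_pow_commutator:
  assumes c: "x \<in> carrier G" "t \<in> carrier G" "y \<in> carrier G"
    and xt: "x \<otimes> t = t \<otimes> x \<otimes> y" and yx: "y \<otimes> x = x \<otimes> y" and yt: "y \<otimes> t = t \<otimes> y"
  shows "t [^] (k::int) \<otimes> x [^] (m::int) = x [^] m \<otimes> t [^] k \<otimes> y [^] (- (k * m))"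
proof -
  have iy: "inv y \<otimes> x = x \<otimes> inv y" "inv y \<otimes> t = t \<otimes> inv y"
    using commute_int_pow[of x y "-1"] commute_int_pow[of t y "-1"] c yx yt by (simp_all add: int_pow_neg)
  have "t \<otimes> x = x \<otimes> t \<otimes> inv y" using c xt by (simp add: inv_solve_right)
  also have "\<dots> = x \<otimes> inv y \<otimes> t" using c iy by (simp add: m_assoc)
  finally have "t \<otimes> x \<otimes> inv t = x \<otimes> inv y" using c by (simp add: inv_solve_right')
  then have "t \<otimes> x [^] m \<otimes> inv t = (x \<otimes> inv y) [^] m" using conj_int_pow[OF c(2,1), of m] by simp
  also have "\<dots> = x [^] m \<otimes> inv y [^] m"
    using int_pow_mult_distrib[of x "inv y" m] c iy by simp
  also have "inv y [^] m = y [^] (- m)" using c by (simp add: int_pow_inv int_pow_neg)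
  finally have 1: "t \<otimes> x [^] m = x [^] m \<otimes> y [^] (- m) \<otimes> t"
    using c by (metis inv_closed inv_solve_right' int_pow_closed m_closed)
  have yt': "y [^] (- m) \<otimes> t = t \<otimes> y [^] (- m)" using commute_int_pow[of t y "- m"] c yt by simp
  have "inv (x [^] m) \<otimes> t \<otimes> x [^] m = t \<otimes> y [^] (- m)"
    using 1 yt' c by (simp add: m_assoc inv_solve_left')
  then have "(inv (x [^] m) \<otimes> t \<otimes> inv (inv (x [^] m))) [^] k = (t \<otimes> y [^] (- m)) [^] k"
    using c by simp
  then have "inv (x [^] m) \<otimes> t [^] k \<otimes> inv (inv (x [^] m)) = (t \<otimes> y [^] (- m)) [^] k"
    using conj_int_pow[of "inv (x [^] m)" t k] c by simp
  also have "\<dots> = t [^] k \<otimes> (y [^] (- m)) [^] k"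
    using int_pow_mult_distrib[of t "y [^] (- m)" k] c yt' by simp
  also have "(y [^] (- m)) [^] k = y [^] (- (k * m))" using c by (simp add: int_pow_pow mult.commute)
  finally show ?thesis using c by (simp add: m_assoc inv_solve_left')
qed

section \<open>Ordered products of powers and their collection\<close>

fun pow_prod :: "(nat \<Rightarrow> 'a) \<Rightarrow> nat \<Rightarrow> (nat \<Rightarrow> int) \<Rightarrow> 'a" where
  "pow_prod g 0 v = \<one>"
| "pow_prod g (Suc j) v = pow_prod g j v \<otimes> g j [^] v j"

lemma pow_prod_closed: "(\<And>i. i < j \<Longrightarrow> g i \<in> carrier G) \<Longrightarrow> pow_prod g j v \<in> carrier G"
  by (induction j) auto

lemma pow_prod_commute:
  assumes "\<And>i. i < j \<Longrightarrow> g i \<in> carrier G" "z \<in> carrier G" "\<And>i. i < j \<Longrightarrow> z \<otimes> g i = g i \<otimes> z"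
  shows "z \<otimes> pow_prod g j v = pow_prod g j v \<otimes> z"
  using assms
proof (induction j)
  case (Suc j)
  have c: "pow_prod g j v \<in> carrier G" "g j \<in> carrier G" "z \<in> carrier G" using Suc.prems by (auto intro: pow_prod_closed)
  have 1: "z \<otimes> pow_prod g j v = pow_prod g j v \<otimes> z" using Suc by auto
  have 2: "z \<otimes> g j [^] v j = g j [^] v j \<otimes> z" using commute_int_pow c Suc.prems by auto
  have "z \<otimes> (pow_prod g j v \<otimes> g j [^] v j) = (z \<otimes> pow_prod g j v) \<otimes> g j [^] v j" using c by (simp add: m_assoc)
  also have "\<dots> = pow_prod g j v \<otimes> (z \<otimes> g j [^] v j)" unfolding 1 using c by (simp add: m_assoc)
  also have "\<dots> = pow_prod g j v \<otimes> g j [^] v j \<otimes> z" unfolding 2 using c by (simp add: m_assoc)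
  finally show ?case by simp
qed auto

lemma pow_prod_add:
  assumes "\<And>i. i < j \<Longrightarrow> g i \<in> carrier G" "\<And>i k. i < j \<Longrightarrow> k < j \<Longrightarrow> g i \<otimes> g k = g k \<otimes> g i"
  shows "pow_prod g j (\<lambda>i. v i + w i) = pow_prod g j v \<otimes> pow_prod g j w"
  using assms
proof (induction j)
  case (Suc j)
  have c: "pow_prod g j v \<in> carrier G" "pow_prod g j w \<in> carrier G" "g j \<in> carrier G"
    using Suc.prems by (auto intro: pow_prod_closed)
  have "g j \<otimes> pow_prod g j w = pow_prod g j w \<otimes> g j" using Suc.prems by (intro pow_prod_commute) auto
  then have 1: "pow_prod g j w \<otimes> g j [^] v j = g j [^] v j \<otimes> pow_prod g j w"
    using commute_int_pow[of "pow_prod g j w" "g j"] c by simp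
  have "pow_prod g (Suc j) (\<lambda>i. v i + w i) = pow_prod g j v \<otimes> (pow_prod g j w \<otimes> g j [^] v j) \<otimes> g j [^] w j"
    using Suc c by (simp add: int_pow_mult m_assoc)
  also have "\<dots> = pow_prod g (Suc j) v \<otimes> pow_prod g (Suc j) w" unfolding 1 using c by (simp add: m_assoc)
  finally show ?case .
qed auto

lemma pow_prod_commutator:
  assumes c: "\<And>i. i < j \<Longrightarrow> x i \<in> carrier G" "t \<in> carrier G" "\<And>i. i < j \<Longrightarrow> y i \<in> carrier G"
    and xt: "\<And>i. i < j \<Longrightarrow> x i \<otimes> t = t \<otimes> x i \<otimes> y i"
    and yx: "\<And>i k. i < j \<Longrightarrow> k < j \<Longrightarrow> y i \<otimes> x k = x k \<otimes> y i"
    and yt: "\<And>i. i < j \<Longrightarrow> y i \<otimes> t = t \<otimes> y i"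
    and yy: "\<And>i k. i < j \<Longrightarrow> k < j \<Longrightarrow> y i \<otimes> y k = y k \<otimes> y i"
  shows "t [^] (k::int) \<otimes> pow_prod x j m = pow_prod x j m \<otimes> t [^] k \<otimes> pow_prod y j (\<lambda>i. - (k * m i))"
  using assms
proof (induction j)
  case (Suc j)
  let ?X = "pow_prod x j m" and ?Y = "pow_prod y j (\<lambda>i. - (k * m i))"
  have c: "?X \<in> carrier G" "?Y \<in> carrier G" "x j \<in> carrier G" "y j \<in> carrier G" "t \<in> carrier G"
    using Suc.prems by (auto intro: pow_prod_closed)
  have IH: "t [^] k \<otimes> ?X = ?X \<otimes> t [^] k \<otimes> ?Y" using Suc by auto
  have "x j \<otimes> ?Y = ?Y \<otimes> x j" using Suc.prems by (intro pow_prod_commute) auto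
  then have Yx: "?Y \<otimes> x j [^] m j = x j [^] m j \<otimes> ?Y" using commute_int_pow[of ?Y "x j"] c by simp
  have tx: "t [^] k \<otimes> x j [^] m j = x j [^] m j \<otimes> t [^] k \<otimes> y j [^] (- (k * m j))"
    using Suc.prems by (intro int_pow_commutator) auto
  have "y j \<otimes> ?Y = ?Y \<otimes> y j" using Suc.prems by (intro pow_prod_commute) auto
  then have Yy: "?Y \<otimes> y j [^] (- (k * m j)) = y j [^] (- (k * m j)) \<otimes> ?Y" using commute_int_pow[of ?Y "y j"] c by simp
    have "t [^] k \<otimes> pow_prod x (Suc j) m = (t [^] k \<otimes> ?X) \<otimes> x j [^] m j" using c by (simp add: m_assoc)
    also have "\<dots> = ?X \<otimes> t [^] k \<otimes> (?Y \<otimes> x j [^] m j)" unfolding IH using c by (simp add: m_assoc)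
    also have "\<dots> = ?X \<otimes> (t [^] k \<otimes> x j [^] m j) \<otimes> ?Y" unfolding Yx using c by (simp add: m_assoc)
    also have "\<dots> = ?X \<otimes> x j [^] m j \<otimes> t [^] k \<otimes> (y j [^] (- (k * m j)) \<otimes> ?Y)" unfolding tx using c by (simp add: m_assoc)
    also have "\<dots> = pow_prod x (Suc j) m \<otimes> t [^] k \<otimes> pow_prod y (Suc j) (\<lambda>i. - (k * m i))"
      unfolding Yy[symmetric] by simp
    finally show ?case .
qed auto

lemma pow_prod_zero: "pow_prod g j (\<lambda>_. 0) = \<one>"
  by (induction j) auto

lemma pow_prod_unit:
  assumes "\<And>i. i < j \<Longrightarrow> g i \<in> carrier G" 
  shows "pow_prod g j (\<lambda>l. if l = i then 1 else 0) = (if i < j then g i else \<one>)"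
  using assms by (induction j) (auto simp: less_Suc_eq)

text \<open>\<open>z\<close> is the inverse of y_i for the relators with a nontrivial commutator,
  and \<one> for the others.\<close>

lemma commutator_eq_one:
  assumes "a \<in> carrier G" "b \<in> carrier G" "z \<in> carrier G"
    and "inv a \<otimes> (inv b \<otimes> (a \<otimes> (b \<otimes> z))) = \<one>"
  shows "a \<otimes> b \<otimes> z = b \<otimes> a"
  using assms by (simp add: inv_solve_left' m_assoc)

end

section \<open>Transport of subgroups and indices along an isomorphism\<close>

lemma bij_subgroups_iso:
  fixes \<Gamma> (structure) and \<psi> :: "'a \<Rightarrow> 'b::group_add"
  assumes "group \<Gamma>" and inj: "inj_on \<psi> (carrier \<Gamma>)"
    and hom: "\<And>x y. x \<in> carrier \<Gamma> \<Longrightarrow> y \<in> carrier \<Gamma> \<Longrightarrow> \<psi> (x \<otimes> y) = \<psi> x + \<psi> y"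
    and im: "\<psi> ` carrier \<Gamma> = E"
  shows "bij_betw ((`) \<psi>) {H. subgroup H \<Gamma> \<and> group_index \<Gamma> H = N} {H. add_subgroup H \<and> H \<subseteq> E \<and> idx E H = N}"
proof -
  interpret group \<Gamma> by fact
  have one: "\<psi> \<one> = 0"
    using hom[of "\<one>" "\<one>"] add_left_cancel[of "\<psi> \<one>" "\<psi> \<one>" 0] by simp
  have inv: "\<psi> (inv x) = - \<psi> x" if "x \<in> carrier \<Gamma>" for x
    using hom[of "inv x" x] that one by (simp add: eq_neg_iff_add_eq_0)
  have index: "group_index \<Gamma> H = idx E (\<psi> ` H)" if H: "subgroup H \<Gamma>" for H
  proof -
    have Hc: "H \<subseteq> carrier \<Gamma>" using H by (rule subgroup.subset)
    have c: "\<psi> ` (H #> a) = coset (\<psi> ` H) (\<psi> a)" if "a \<in> carrier \<Gamma>" for a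
      using that Hc hom by (auto simp: r_coset_def coset_def image_iff subset_iff)
    have "coset (\<psi> ` H) ` E = (\<lambda>C. \<psi> ` C) ` (rcosets H)"
      unfolding im[symmetric] RCOSETS_def by (auto simp: c image_iff)
    moreover have "inj_on (\<lambda>C. \<psi> ` C) (rcosets H)"
    proof (rule inj_onI)
      fix C D assume "C \<in> rcosets H" "D \<in> rcosets H" and e: "\<psi> ` C = \<psi> ` D"
      then have "C \<subseteq> carrier \<Gamma>" "D \<subseteq> carrier \<Gamma>" using subgroup.rcosets_carrier[OF H is_group] by blast+
      then show "C = D" using e inj_on_image_eq_iff[OF inj] by blast
    qed
    ultimately show ?thesis unfolding group_index_def idx_def by (simp add: card_image)
  qed
  show ?thesis
  proof (rule bij_betw_imageI)
    show "inj_on ((`) \<psi>) {H. subgroup H \<Gamma> \<and> group_index \<Gamma> H = N}"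
    proof (rule inj_onI)
      fix C D assume "C \<in> {H. subgroup H \<Gamma> \<and> group_index \<Gamma> H = N}" "D \<in> {H. subgroup H \<Gamma> \<and> group_index \<Gamma> H = N}"
        and e: "\<psi> ` C = \<psi> ` D"
      then have "C \<subseteq> carrier \<Gamma>" "D \<subseteq> carrier \<Gamma>" using subgroup.subset by auto
      then show "C = D" using e inj_on_image_eq_iff[OF inj] by blast
    qed
    show "(`) \<psi> ` {H. subgroup H \<Gamma> \<and> group_index \<Gamma> H = N} = {H. add_subgroup H \<and> H \<subseteq> E \<and> idx E H = N}"
    proof
      show "(`) \<psi> ` {H. subgroup H \<Gamma> \<and> group_index \<Gamma> H = N} \<subseteq> {H. add_subgroup H \<and> H \<subseteq> E \<and> idx E H = N}"
      proof (rule image_subsetI)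
        fix H assume "H \<in> {H. subgroup H \<Gamma> \<and> group_index \<Gamma> H = N}"
        then have H: "subgroup H \<Gamma>" "group_index \<Gamma> H = N" by auto
        have Hc: "H \<subseteq> carrier \<Gamma>" using H(1) by (rule subgroup.subset)
        have "add_subgroup (\<psi> ` H)" unfolding add_subgroup_def
        proof (intro conjI ballI)
          show "0 \<in> \<psi> ` H" using one subgroup.one_closed[OF H(1)] by (metis imageI)
          fix a b assume "a \<in> \<psi> ` H" "b \<in> \<psi> ` H"
          then obtain x y where xy: "x \<in> H" "y \<in> H" "a = \<psi> x" "b = \<psi> y" by blast
          then have "a - b = \<psi> (x \<otimes> inv y)" using Hc hom[of x "inv y"] inv[of y] by (simp add: subset_iff)
          then show "a - b \<in> \<psi> ` H" using xy H(1) by (simp add: subgroup.m_closed subgroup.m_inv_closed)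
        qed
        moreover have "\<psi> ` H \<subseteq> E" using Hc im by blast
        moreover have "idx E (\<psi> ` H) = N" using index[OF H(1)] H(2) by simp
        ultimately show "\<psi> ` H \<in> {H. add_subgroup H \<and> H \<subseteq> E \<and> idx E H = N}" by simp
      qed
      show "{H. add_subgroup H \<and> H \<subseteq> E \<and> idx E H = N} \<subseteq> (`) \<psi> ` {H. subgroup H \<Gamma> \<and> group_index \<Gamma> H = N}"
      proof
        fix K assume "K \<in> {H. add_subgroup H \<and> H \<subseteq> E \<and> idx E H = N}"
        then have K: "add_subgroup K" "K \<subseteq> E" "idx E K = N" by auto
        define H where "H = {x \<in> carrier \<Gamma>. \<psi> x \<in> K}"
        have KH: "\<psi> ` H = K" using K(2) im by (auto simp: H_def)
        have "subgroup H \<Gamma>"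
        proof
          show "H \<subseteq> carrier \<Gamma>" by (auto simp: H_def)
          show "\<one> \<in> H" using one add_subgroup_0[OF K(1)] by (simp add: H_def)
          show "x \<otimes> y \<in> H" if "x \<in> H" "y \<in> H" for x y
            using that hom add_subgroup_add[OF K(1)] by (simp add: H_def)
          show "inv x \<in> H" if "x \<in> H" for x
            using that inv add_subgroup_uminus[OF K(1)] by (simp add: H_def)
        qed
        moreover from this have "group_index \<Gamma> H = N" using index KH K(3) by simp
        ultimately show "K \<in> (`) \<psi> ` {H. subgroup H \<Gamma> \<and> group_index \<Gamma> H = N}" using KH by blast
      qed
    qed
  qed
qed

section \<open>Values of words in the model\<close>

definition unit_vec :: "nat \<Rightarrow> nat \<Rightarrow> int" where
  "unit_vec j = (\<lambda>i. if i = j then 1 else 0)"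

text \<open>Generators are numbered from 1 and coordinates from 0, hence \<open>i - 1\<close>; the
  last x-generator is the middle coordinate.\<close>

definition gen_val :: "nat \<Rightarrow> gen \<Rightarrow> heis" where
  "gen_val n g = (case g of X i \<Rightarrow> if i = n then Heis 0 1 0 else Heis (unit_vec (i - 1)) 0 0
     | Y i \<Rightarrow> Heis 0 0 (unit_vec (i - 1)))"

definition letter_val :: "nat \<Rightarrow> gen \<times> bool \<Rightarrow> heis" where
  "letter_val n l = (if snd l then gen_val n (fst l) else - gen_val n (fst l))"

definition word_val :: "nat \<Rightarrow> gen word \<Rightarrow> heis" where
  "word_val n w = sum_list (map (letter_val n) w)"

lemma word_val_simps [simp]:
  "word_val n [] = 0" "word_val n (l # w) = letter_val n l + word_val n w"
  "word_val n (u @ v) = word_val n u + word_val n v"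
  by (simp_all add: word_val_def)

lemma word_val_relator:
  assumes "r \<in> G_relators n"
  shows "word_val n r = 0"
proof -
  consider i where "i \<in> {1..n - 1}" "r = commutator_word (X i) (X n) @ [(Y i, False)]"
    | a b where "r = commutator_word a b" "a \<in> G_gens n" "b \<in> G_gens n" "\<forall>i\<in>{1..n - 1}. {a, b} \<noteq> {X i, X n}"
    using assms unfolding G_relators_def by blast
  then show ?thesis
  proof cases
    case 1
    then have "i \<noteq> n" by auto
    then show ?thesis unfolding 1(2)
      by (simp add: commutator_word_def letter_val_def gen_val_def Heis_add Heis_uminus zero_heis_def)
  next
    case 2
    have "gen_val n a + gen_val n b = gen_val n b + gen_val n a"
    \<comment> \<open>Two elements commute if both middle coordinates vanish, or if both x-parts do.
      A pair of generators violating both would be some X i with i < n together with X n, which is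
      excluded.\<close>
    proof (cases "hk (gen_val n a) = 0 \<and> hk (gen_val n b) = 0")
      case True
      then show ?thesis by (simp add: plus_heis_def add.commute)
    next
      case False
      have *: "g = X n" if "hk (gen_val n g) \<noteq> 0" for g
        using that by (auto simp: gen_val_def split: gen.splits if_splits)
      have **: "hx (gen_val n g) = 0" if "g = X n \<or> g \<notin> X ` {1..n - 1}" "g \<in> G_gens n" for g
        using that by (auto simp: gen_val_def G_gens_def)
      have neq: "X i \<noteq> X n" if "i \<in> {1..n - 1}" for i using that by auto
      have "a \<notin> X ` {1..n - 1}"
      proof
        assume "a \<in> X ` {1..n - 1}"
        then obtain i where i: "i \<in> {1..n - 1}" "a = X i" by blast
        then have "b = X n" using *[of a] *[of b] neq False by metis
        then show False using 2(4) i by blast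
      qed
      moreover have "b \<notin> X ` {1..n - 1}"
      proof
        assume "b \<in> X ` {1..n - 1}"
        then obtain i where i: "i \<in> {1..n - 1}" "b = X i" by blast
        then have "a = X n" using *[of a] *[of b] neq False by metis
        then show False using 2(4) i by blast
      qed
      ultimately have "hx (gen_val n a) = 0" "hx (gen_val n b) = 0" using ** 2(2,3) by auto
      then show ?thesis by (simp add: plus_heis_def add.commute)
    qed
    moreover have "word_val n r = - gen_val n a + (- gen_val n b + (gen_val n a + gen_val n b))"
      unfolding 2(1) by (simp add: commutator_word_def letter_val_def)
    ultimately show ?thesis by simp
  qed
qed

lemma word_val_rel: "(u, v) \<in> pres_rel (G_gens n) (G_relators n) \<Longrightarrow> word_val n u = word_val n v"
proof (induction rule: pres_rel.induct)
  case (cancel u v a e)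
  then show ?case by (cases e) (simp_all add: letter_val_def)
qed (simp_all add: word_val_relator)

lemma int_mult_Heis: "int_mult k (Heis m 0 c) = Heis (of_int k * m) 0 (of_int k * c)"
  by (induction k rule: int_mult_induct)
    (simp_all add: int_mult_add int_mult_diff Heis_add Heis_diff zero_heis_def algebra_simps fun_eq_iff)

lemma int_mult_Heis_k: "int_mult k (Heis 0 1 0) = Heis 0 k 0"
  by (induction k rule: int_mult_induct)
    (simp_all add: int_mult_add int_mult_diff Heis_add Heis_diff zero_heis_def fun_eq_iff)

lemma int_vecs_generated:
  assumes "\<And>i. i < d \<Longrightarrow> P (unit_vec i)" "P 0" "\<And>x y. P x \<Longrightarrow> P y \<Longrightarrow> P (x + y)"
    "\<And>k x. P x \<Longrightarrow> P (of_int k * x)" "m \<in> int_vecs d"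
  shows "P m"
proof -
  have "m \<in> int_vecs j \<Longrightarrow> P m" if "j \<le> d" for j
    using that
  proof (induction j arbitrary: m)
    case 0
    then have "m = 0" by (auto simp: int_vecs_def)
    then show ?case using assms(2) by metis
  next
    case (Suc j)
    let ?m = "\<lambda>i. if i = j then 0 else m i"
    have "?m \<in> int_vecs j" using Suc.prems by (auto simp: int_vecs_def)
    then have "P ?m" using Suc by simp
    moreover have "P (of_int (m j) * unit_vec j)" using assms(1,4) Suc.prems by simp
    moreover have "m = ?m + of_int (m j) * unit_vec j" by (auto simp: unit_vec_def)
    ultimately show ?case using assms(3) by metis
  qed
  then show ?thesis using assms(5) by blast
qed

lemma heis_group_generated:
  assumes K: "add_subgroup K" and g: "\<And>i. i < d \<Longrightarrow> Heis (unit_vec i) 0 0 \<in> K"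
    "\<And>i. i < d \<Longrightarrow> Heis 0 0 (unit_vec i) \<in> K" "Heis 0 1 0 \<in> K"
  shows "heis_group d \<subseteq> K"
proof -
  have 0: "Heis 0 0 0 \<in> K" using add_subgroup_0[OF K] by (simp add: zero_heis_def)
  have m: "Heis m 0 0 \<in> K" if "m \<in> int_vecs d" for m
  proof (rule int_vecs_generated[OF g(1) 0 _ _ that])
    show "Heis (x + y) 0 0 \<in> K" if "Heis x 0 0 \<in> K" "Heis y 0 0 \<in> K" for x y
      using add_subgroup_add[OF K that] by (simp add: Heis_add)
    show "Heis (of_int k * x) 0 0 \<in> K" if "Heis x 0 0 \<in> K" for k x
      using int_mult_mem[OF K that, of k] by (simp add: int_mult_Heis)
  qed
  have c: "Heis 0 0 c \<in> K" if "c \<in> int_vecs d" for c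
  proof (rule int_vecs_generated[OF g(2) 0 _ _ that])
    show "Heis 0 0 (x + y) \<in> K" if "Heis 0 0 x \<in> K" "Heis 0 0 y \<in> K" for x y
      using add_subgroup_add[OF K that] by (simp add: Heis_add)
    show "Heis 0 0 (of_int k * x) \<in> K" if "Heis 0 0 x \<in> K" for k x
      using int_mult_mem[OF K that, of k] by (simp add: int_mult_Heis)
  qed
  have k: "Heis 0 k 0 \<in> K" for k using int_mult_mem[OF K g(3), of k] by (simp add: int_mult_Heis_k)
  show ?thesis
  proof
    fix x assume "x \<in> heis_group d"
    then obtain a b e where x: "x = Heis a b e" "a \<in> int_vecs d" "e \<in> int_vecs d" by (auto simp: heis_group_def)
    have "Heis a 0 0 + Heis 0 b 0 + Heis 0 0 e \<in> K" by (intro add_subgroup_add K m c k x(2,3))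
    then show "x \<in> K" unfolding x(1) by (simp add: Heis_add)
  qed
qed

section \<open>Normal forms in the presented group\<close>

locale G_presentation =
  fixes n :: nat
  assumes n: "n \<ge> 2"
begin

abbreviation "S \<equiv> G_gens n"
abbreviation "R \<equiv> G_relators n"
abbreviation "d \<equiv> n - 1"

definition cls :: "gen word \<Rightarrow> gen word set" where "cls w = pres_rel S R `` {w}"

sublocale group "G n"
  unfolding G_def by (rule group_presented_group)

abbreviation mult_G (infixl "\<cdot>" 70) where "x \<cdot> y \<equiv> x \<otimes>\<^bsub>G n\<^esub> y"
abbreviation inv_G ("\<iota>") where "\<iota> x \<equiv> inv\<^bsub>G n\<^esub> x"

lemma carrier_eq: "carrier (G n) = cls ` words S"
  by (auto simp: G_def presented_group_def quotient_def cls_def)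

lemma one_eq: "\<one>\<^bsub>G n\<^esub> = cls []"
  by (simp add: G_def presented_group_def cls_def)

lemma mult_eq: "u \<in> words S \<Longrightarrow> v \<in> words S \<Longrightarrow> cls u \<cdot> cls v = cls (u @ v)"
  by (simp add: G_def cls_def presented_group_mult)

lemma cls_closed: "w \<in> words S \<Longrightarrow> cls w \<in> carrier (G n)"
  by (auto simp: carrier_eq)

lemma cls_eqI: "(u, v) \<in> pres_rel S R \<Longrightarrow> cls u = cls v"
  unfolding cls_def by (rule equiv_class_eq[OF equiv_pres_rel])

text \<open>Independent of the chosen representative by \<open>word_val_rel\<close>.\<close>

definition val :: "gen word set \<Rightarrow> heis" where
  "val A = word_val n (SOME w. w \<in> A)"

lemma val_cls: "w \<in> words S \<Longrightarrow> val (cls w) = word_val n w"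
proof -
  assume w: "w \<in> words S"
  then have "w \<in> cls w" by (simp add: cls_def pres_rel.refl)
  then have "(SOME w'. w' \<in> cls w) \<in> cls w" by (rule someI)
  then show ?thesis unfolding val_def using word_val_rel by (simp add: cls_def)
qed

definition gn :: "gen \<Rightarrow> gen word set" where "gn a = cls [(a, True)]"

lemma letter_words: "a \<in> S \<Longrightarrow> [(a, e)] \<in> words S" "l # w \<in> words S \<longleftrightarrow> fst l \<in> S \<and> w \<in> words S"
  by (auto simp: words_def mem_Times_iff)

lemma gn_closed: "a \<in> S \<Longrightarrow> gn a \<in> carrier (G n)"
  unfolding gn_def by (intro cls_closed letter_words)

lemma cls_inv: "a \<in> S \<Longrightarrow> cls [(a, False)] = \<iota> (gn a)"
proof -
  assume a: "a \<in> S"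
  have "cls [(a, False)] \<cdot> gn a = cls [(a, False), (a, True)]"
    unfolding gn_def using a by (subst mult_eq) (auto intro: letter_words)
  also have "\<dots> = \<one>\<^bsub>G n\<^esub>" unfolding one_eq
    using pres_rel.cancel[of "[]" S "[]" a False R] a by (intro cls_eqI) simp
  finally show ?thesis using a by (intro inv_equality[symmetric] gn_closed cls_closed letter_words)
qed

lemma cls_Cons: "a \<in> S \<Longrightarrow> w \<in> words S \<Longrightarrow>
    cls ((a, e) # w) = (if e then gn a else \<iota> (gn a)) \<cdot> cls w"
  using mult_eq[of "[(a, e)]" w] letter_words(1)[of a e] cls_inv[of a] by (cases e) (auto simp: gn_def)

lemma relator_eq_one: "r \<in> R \<Longrightarrow> r \<in> words S \<Longrightarrow> cls r = \<one>\<^bsub>G n\<^esub>"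
  unfolding one_eq using pres_rel.relator[of "[]" S "[]" r R] by (intro cls_eqI) simp

lemma gens_mem [simp]: "X i \<in> S \<longleftrightarrow> 1 \<le> i \<and> i \<le> n" "Y i \<in> S \<longleftrightarrow> 1 \<le> i \<and> i \<le> d"
  by (auto simp: G_gens_def)

lemma gn_commute:
  assumes ab: "a \<in> S" "b \<in> S" "\<forall>i\<in>{1..n - 1}. {a, b} \<noteq> {X i, X n}"
  shows "gn a \<cdot> gn b = gn b \<cdot> gn a"
proof -
  have "commutator_word a b \<in> R" unfolding G_relators_def using ab by blast
  moreover have "commutator_word a b \<in> words S" using ab by (simp add: commutator_word_def letter_words)
  ultimately have "cls (commutator_word a b) = \<one>\<^bsub>G n\<^esub>" by (rule relator_eq_one)
  then have "\<iota> (gn a) \<cdot> (\<iota> (gn b) \<cdot> (gn a \<cdot> (gn b \<cdot> \<one>\<^bsub>G n\<^esub>))) = \<one>\<^bsub>G n\<^esub>"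
    using ab by (simp add: commutator_word_def cls_Cons letter_words one_eq)
  then have "gn a \<cdot> gn b \<cdot> \<one>\<^bsub>G n\<^esub> = gn b \<cdot> gn a"
    using ab by (intro commutator_eq_one gn_closed) auto
  then show ?thesis using gn_closed ab by simp
qed

lemma gn_commutator:
  assumes i: "i < d"
  shows "gn (X (Suc i)) \<cdot> gn (X n) = gn (X n) \<cdot> gn (X (Suc i)) \<cdot> gn (Y (Suc i))"
proof -
  let ?r = "commutator_word (X (Suc i)) (X n) @ [(Y (Suc i), False)]"
  have m: "X (Suc i) \<in> S" "X n \<in> S" "Y (Suc i) \<in> S" using i n by auto
  have "?r \<in> R" unfolding G_relators_def using i by auto
  moreover have "?r \<in> words S" using m by (simp add: commutator_word_def letter_words del: gens_mem)
  ultimately have "cls ?r = \<one>\<^bsub>G n\<^esub>" by (rule relator_eq_one)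
  moreover have "cls ?r = \<iota> (gn (X (Suc i))) \<cdot> (\<iota> (gn (X n)) \<cdot> (gn (X (Suc i)) \<otimes>\<^bsub>G n\<^esub>
      (gn (X n) \<cdot> (\<iota> (gn (Y (Suc i))) \<cdot> \<one>\<^bsub>G n\<^esub>))))"
    by (simp only: commutator_word_def append.simps cls_Cons m letter_words fst_conv words_Nil simp_thms
        if_True if_False one_eq)
  ultimately have "\<iota> (gn (X (Suc i))) \<cdot> (\<iota> (gn (X n)) \<cdot> (gn (X (Suc i)) \<otimes>\<^bsub>G n\<^esub>
      (gn (X n) \<cdot> \<iota> (gn (Y (Suc i)))))) = \<one>\<^bsub>G n\<^esub>"
    using gn_closed[OF m(3)] by simp
  then have "gn (X (Suc i)) \<cdot> gn (X n) \<cdot> \<iota> (gn (Y (Suc i))) = gn (X n) \<cdot> gn (X (Suc i))"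
    by (intro commutator_eq_one gn_closed inv_closed m)
  then show ?thesis using gn_closed[OF m(1)] gn_closed[OF m(2)] gn_closed[OF m(3)]
    by (simp add: inv_solve_right')
qed

abbreviation "gx i \<equiv> gn (X (Suc i))"
abbreviation "gy i \<equiv> gn (Y (Suc i))"
abbreviation "gt \<equiv> gn (X n)"

lemma closed: "i < d \<Longrightarrow> gx i \<in> carrier (G n)" "i < d \<Longrightarrow> gy i \<in> carrier (G n)" "gt \<in> carrier (G n)"
  using n by (auto intro!: gn_closed)

lemma commutes:
  "i < d \<Longrightarrow> k < d \<Longrightarrow> gx i \<cdot> gx k = gx k \<cdot> gx i"
  "i < d \<Longrightarrow> k < d \<Longrightarrow> gy i \<cdot> gx k = gx k \<cdot> gy i"
  "i < d \<Longrightarrow> k < d \<Longrightarrow> gy i \<cdot> gy k = gy k \<cdot> gy i"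
  "i < d \<Longrightarrow> gy i \<cdot> gt = gt \<cdot> gy i"
  using n by (intro gn_commute; auto simp: doubleton_eq_iff)+

text \<open>The collected word x^m x_n^k y^c. It is a homomorphism from the model back to the
  presented group, and so provides what injectivity of \<open>val\<close> requires.\<close>

definition nf :: "heis \<Rightarrow> gen word set" where
  "nf a = pow_prod gx d (hx a) \<cdot> gt [^]\<^bsub>G n\<^esub> hk a \<cdot> pow_prod gy d (hy a)"

lemma nf_add: "nf (a + b) = nf a \<cdot> nf b"
proof -
  let ?x = "pow_prod gx d" and ?y = "pow_prod gy d" and ?t = "\<lambda>k::int. gt [^]\<^bsub>G n\<^esub> k"
  obtain m k c where a: "a = Heis m k c" by (cases a)
  obtain m' k' c' where b: "b = Heis m' k' c'" by (cases b)
  have cl: "?x v \<in> carrier (G n)" "?y v \<in> carrier (G n)" "?t l \<in> carrier (G n)" for v l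
    using closed by (auto intro: pow_prod_closed)
  have xadd: "?x (m + m') = ?x m \<cdot> ?x m'"
    using pow_prod_add[of d gx m m'] closed commutes by (simp add: plus_fun_def)
  have yadd: "?y (c + c' - of_int k * m') = ?y (\<lambda>i. - (k * m' i)) \<cdot> (?y c \<cdot> ?y c')"
  proof -
    have e: "c + c' - of_int k * m' = (\<lambda>i. - (k * m' i) + (c i + c' i))" by auto
    have pa: "?y (\<lambda>i. v i + w i) = ?y v \<cdot> ?y w" for v w
      using closed commutes by (intro pow_prod_add) auto
    show ?thesis unfolding e pa[of "\<lambda>i. - (k * m' i)" "\<lambda>i. c i + c' i"] pa[of c c'] ..
  qed
  have yx: "?y v \<cdot> ?x w = ?x w \<cdot> ?y v" for v w
  proof (rule pow_prod_commute)
    fix i assume i: "i < d"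
    then show "?y v \<cdot> gx i = gx i \<cdot> ?y v"
      using closed commutes by (intro pow_prod_commute[symmetric]) auto
  qed (use closed cl in auto)
  have "gt \<cdot> ?y v = ?y v \<cdot> gt" for v
    using closed commutes by (intro pow_prod_commute) auto
  then have yt: "?y v \<cdot> ?t l = ?t l \<cdot> ?y v" for v l
    using commute_int_pow[of "?y v" gt] cl closed by simp
  have tx: "?t k \<cdot> ?x m' = ?x m' \<cdot> ?t k \<cdot> ?y (\<lambda>i. - (k * m' i))"
    using closed commutes gn_commutator by (intro pow_prod_commutator) auto
  have "nf a \<cdot> nf b = ?x m \<cdot> ?t k \<cdot> (?y c \<cdot> ?x m') \<cdot> ?t k' \<cdot> ?y c'"
    unfolding nf_def a b using cl by (simp add: m_assoc)
  also have "\<dots> = ?x m \<cdot> (?t k \<cdot> ?x m') \<cdot> (?y c \<cdot> ?t k') \<cdot> ?y c'"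
    unfolding yx using cl by (simp add: m_assoc)
  also have "\<dots> = ?x m \<cdot> ?x m' \<cdot> ?t k \<cdot> (?y (\<lambda>i. - (k * m' i)) \<cdot> ?t k') \<cdot> (?y c \<cdot> ?y c')"
    unfolding tx yt[of c] using cl by (simp add: m_assoc)
  also have "\<dots> = (?x m \<cdot> ?x m') \<cdot> (?t k \<cdot> ?t k') \<cdot> (?y (\<lambda>i. - (k * m' i)) \<cdot> (?y c \<cdot> ?y c'))"
    unfolding yt using cl by (simp add: m_assoc)
  also have "\<dots> = nf (a + b)"
    unfolding nf_def a b Heis_add heis.sel xadd yadd using closed by (simp add: int_pow_mult)
  finally show ?thesis by simp
qed

lemma nf_closed: "nf a \<in> carrier (G n)"
  unfolding nf_def using closed by (intro m_closed pow_prod_closed int_pow_closed)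

lemma nf_0: "nf 0 = \<one>\<^bsub>G n\<^esub>"
  using nf_add[of 0 0] nf_closed[of 0] by (simp add: l_cancel_one')

lemma nf_uminus: "nf (- a) = \<iota> (nf a)"
  using nf_add[of "- a" a] nf_closed nf_0 by (intro inv_equality[symmetric]) auto

lemma nf_gen: "a \<in> S \<Longrightarrow> nf (gen_val n a) = gn a"
proof -
  assume a: "a \<in> S"
  have z: "pow_prod g j 0 = \<one>\<^bsub>G n\<^esub>" for g j using pow_prod_zero[of g j] by (simp add: zero_fun_def)
  have u: "pow_prod gx d (unit_vec i) = gx i" "pow_prod gy d (unit_vec i) = gy i" if "i < d" for i
    using pow_prod_unit[of d gx i] pow_prod_unit[of d gy i] closed that by (simp_all add: unit_vec_def)
  show ?thesis
  proof (cases a)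
    case (X i)
    show ?thesis
    proof (cases "i = n")
      case True
      then show ?thesis using closed X by (simp add: nf_def gen_val_def z)
    next
      case False
      then have "i - 1 < d" "Suc (i - 1) = i" using a X by auto
      then show ?thesis using False closed(1)[of "i - 1"] X u(1)[of "i - 1"] by (simp add: nf_def gen_val_def z)
    qed
  next
    case (Y i)
    then have "i - 1 < d" "Suc (i - 1) = i" using a by auto
    then show ?thesis using closed(2)[of "i - 1"] Y u(2)[of "i - 1"] by (simp add: nf_def gen_val_def z)
  qed
qed

text \<open>\<open>nf\<close> is multiplicative and correct on generators, so it recovers every
  class from its value; words with equal values are therefore equal in the group.\<close>

lemma cls_eq_nf: "w \<in> words S \<Longrightarrow> cls w = nf (word_val n w)"
proof (induction w)
  case Nil
  then show ?case by (simp add: nf_0 one_eq)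
next
  case (Cons l w)
  obtain a e where l: "l = (a, e)" by (cases l)
  then have aw: "a \<in> S" "w \<in> words S" using Cons.prems letter_words(2) by auto
  have "cls (l # w) = nf (letter_val n l) \<cdot> nf (word_val n w)"
    using cls_Cons[OF aw, of e] Cons.IH[OF aw(2)] nf_gen[OF aw(1)] nf_uminus[of "gen_val n a"]
    by (simp add: l letter_val_def)
  then show ?case by (simp add: nf_add)
qed

lemma val_iso:
  "inj_on val (carrier (G n))"
  "x \<in> carrier (G n) \<Longrightarrow> y \<in> carrier (G n) \<Longrightarrow> val (x \<cdot> y) = val x + val y"
  "val ` carrier (G n) = heis_group d"
proof -
  show "inj_on val (carrier (G n))"
  proof (rule inj_onI)
    fix x y assume "x \<in> carrier (G n)" "y \<in> carrier (G n)" and e: "val x = val y"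
    then obtain u v where "u \<in> words S" "x = cls u" "v \<in> words S" "y = cls v" by (auto simp: carrier_eq)
    then show "x = y" using e val_cls cls_eq_nf by metis
  qed
  show hom: "val (x \<cdot> y) = val x + val y" if xy: "x \<in> carrier (G n)" "y \<in> carrier (G n)" for x y
  proof -
    obtain u v where "u \<in> words S" "x = cls u" "v \<in> words S" "y = cls v" using xy by (auto simp: carrier_eq)
    then show ?thesis by (simp add: mult_eq val_cls)
  qed
  have gen: "gen_val n a \<in> heis_group d" if "a \<in> S" for a
  proof -
    have u: "unit_vec i \<in> int_vecs d" if "i < d" for i using that by (auto simp: unit_vec_def int_vecs_def)
    have z: "0 \<in> int_vecs d" by (simp add: int_vecs_def)
    show ?thesis
    proof (cases a)
      case (X i)
      then show ?thesis using that z u[of "i - 1"] unfolding gen_val_def heis_group_def by fastforce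
    next
      case (Y i)
      then show ?thesis using that z u[of "i - 1"] unfolding gen_val_def heis_group_def by fastforce
    qed
  qed
  have w: "word_val n w \<in> heis_group d" if "w \<in> words S" for w
    using that
  proof (induction w)
    case Nil
    then show ?case using add_subgroup_0[OF add_subgroup_heis_group] by simp
  next
    case (Cons l w)
    then have "letter_val n l \<in> heis_group d" "word_val n w \<in> heis_group d"
      using gen letter_words(2) add_subgroup_uminus[OF add_subgroup_heis_group] by (auto simp: letter_val_def)
    then show ?case using add_subgroup_add[OF add_subgroup_heis_group] by simp
  qed
  show "val ` carrier (G n) = heis_group d"
  proof
    show "val ` carrier (G n) \<subseteq> heis_group d" using w by (auto simp: carrier_eq val_cls)
    have img: "gen_val n a \<in> val ` carrier (G n)" if "a \<in> S" for a
      using val_cls[OF letter_words(1)[OF that, of True]] cls_closed[OF letter_words(1)[OF that, of True]]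
      by (auto simp: letter_val_def image_iff intro!: bexI[of _ "cls [(a, True)]"])
    have one: "val \<one>\<^bsub>G n\<^esub> = 0" unfolding one_eq by (simp add: val_cls)
    have inv: "val (\<iota> x) = - val x" if "x \<in> carrier (G n)" for x
      using hom[of "\<iota> x" x] that one by (simp add: eq_neg_iff_add_eq_0)
    show "heis_group d \<subseteq> val ` carrier (G n)"
    proof (rule heis_group_generated)
      show "add_subgroup (val ` carrier (G n))" unfolding add_subgroup_def
      proof (intro conjI ballI)
        show "0 \<in> val ` carrier (G n)" using one one_closed by (metis imageI)
        fix a b assume "a \<in> val ` carrier (G n)" "b \<in> val ` carrier (G n)"
        then obtain x y where xy: "x \<in> carrier (G n)" "y \<in> carrier (G n)" "a = val x" "b = val y" by blast
        then have "a - b = val (x \<cdot> \<iota> y)" using hom[of x "\<iota> y"] inv[of y] by simp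
        then show "a - b \<in> val ` carrier (G n)" using xy by simp
      qed
      show "Heis (unit_vec i) 0 0 \<in> val ` carrier (G n)" if "i < d" for i
      proof -
        have "X (Suc i) \<in> S" "Suc i \<noteq> n" using that by auto
        then show ?thesis using img[of "X (Suc i)"] by (simp add: gen_val_def)
      qed
      show "Heis 0 0 (unit_vec i) \<in> val ` carrier (G n)" if "i < d" for i
      proof -
        have "Y (Suc i) \<in> S" using that by auto
        then show ?thesis using img[of "Y (Suc i)"] by (simp add: gen_val_def)
      qed
      show "Heis 0 1 0 \<in> val ` carrier (G n)" using img[of "X n"] n by (simp add: gen_val_def)
    qed
  qed
qed

lemma bij_subgroups:
  "bij_betw ((`) val) {H. subgroup H (G n) \<and> group_index (G n) H = N}
     {H. add_subgroup H \<and> H \<subseteq> heis_group d \<and> idx (heis_group d) H = N}"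
  by (rule bij_subgroups_iso[OF is_group val_iso])

end

section \<open>The local zeta function\<close>

lemma card_G_subgroups:
  assumes n: "n \<ge> 2" and p: "prime p"
  shows "finite {H. subgroup H (G n) \<and> group_index (G n) H = p ^ t} \<and>
    of_nat (card {H. subgroup H (G n) \<and> group_index (G n) H = p ^ t}) =
      lattice_setting.zeta_fps p (n - 1) (int_vecs (n - 1)) $ t"
proof -
  interpret L: lattice_setting p "n - 1" "int_vecs (n - 1)"
    using p rank_mod_int_vecs[of p "n - 1"] prime_gt_0_nat by unfold_locales auto
  interpret G_presentation n using n by unfold_locales
  show ?thesis
    unfolding bij_betw_finite[OF bij_subgroups] bij_betw_same_card[OF bij_subgroups] L.zeta_fps_nth
      conjunct2[OF card_heis_subgroups[OF p]] conjunct2[OF card_stable[OF p]]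
    using card_heis_subgroups[OF p] by blast
qed

lemma of_nat_power_powr:
  assumes "p > 0"
  shows "of_nat (p ^ t) powr (s :: complex) = (of_nat p powr s) ^ t"
proof -
  have "ln (real (p ^ t)) = real t * ln (real p)" using assms by (simp add: ln_realpow)
  then have "Ln (of_nat (p ^ t)) = of_nat t * Ln (of_nat p)"
    using assms by (simp add: Ln_of_nat del: of_nat_power)
  then show ?thesis using assms by (simp add: powr_def exp_of_nat_mult[symmetric] mult_ac)
qed

text \<open>Grouping subgroups by index turns the unordered sum into a power series at p^(-s).
  Absolute convergence inside the radius of convergence justifies the regrouping.\<close>

lemma has_sum_zeta_term:
  assumes p: "prime p"
    and c: "\<And>t. finite {H. subgroup H \<Gamma> \<and> group_index \<Gamma> H = p ^ t} \<and>
      of_nat (card {H. subgroup H \<Gamma> \<and> group_index \<Gamma> H = p ^ t}) = (F $ t :: complex)"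
    and v: "norm (of_nat p powr (- s) :: complex) < fps_conv_radius F"
  shows "zeta_term \<Gamma> s summable_on p_index_subgroups \<Gamma> p"
    and "local_zeta \<Gamma> p s = eval_fps F (of_nat p powr (- s))"
proof -
  let ?v = "of_nat p powr (- s) :: complex"
  let ?S = "\<lambda>t. {H. subgroup H \<Gamma> \<and> group_index \<Gamma> H = p ^ t}"
  have p1: "p > 1" using prime_gt_1_nat[OF p] .
  have zt: "zeta_term \<Gamma> s H = ?v ^ t" if "H \<in> ?S t" for H t
    using that of_nat_power_powr[of p t "- s"] p1 by (simp add: zeta_term_def)
  have bij: "bij_betw snd (SIGMA t:UNIV. ?S t) (p_index_subgroups \<Gamma> p)"
  proof (rule bij_betw_imageI)
    show "inj_on snd (SIGMA t:UNIV. ?S t)"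
      using p1 by (auto simp: inj_on_def)
    show "snd ` (SIGMA t:UNIV. ?S t) = p_index_subgroups \<Gamma> p"
      by (force simp: p_index_subgroups_def)
  qed
  have nsum: "summable (\<lambda>t. norm (F $ t * ?v ^ t))" by (rule norm_summable_fps[OF v])
  have "(\<lambda>x. norm (case x of (t, H) \<Rightarrow> ?v ^ t)) summable_on (SIGMA t:UNIV. ?S t)"
    unfolding Infinite_Sum.abs_summable_on_Sigma_iff
  proof (intro conjI ballI)
    fix t :: nat
    show "(\<lambda>H. norm (case (t, H) of (t, H) \<Rightarrow> ?v ^ t)) summable_on ?S t"
      using c by (intro summable_on_finite) auto
  next
    have "(\<Sum>\<^sub>\<infinity>H\<in>?S t. norm (case (t, H) of (t, H) \<Rightarrow> ?v ^ t)) = norm (F $ t * ?v ^ t)" for t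
    proof -
      have "(\<Sum>\<^sub>\<infinity>H\<in>?S t. norm (case (t, H) of (t, H) \<Rightarrow> ?v ^ t)) = of_nat (card (?S t)) * norm (?v ^ t)"
        using c by (subst infsum_finite) auto
      also have "of_nat (card (?S t)) = norm (F $ t)" using c[of t] by (metis norm_of_nat)
      finally show ?thesis by (simp add: norm_mult)
    qed
    then show "(\<lambda>t. norm (\<Sum>\<^sub>\<infinity>H\<in>?S t. norm (case (t, H) of (t, H) \<Rightarrow> ?v ^ t))) summable_on UNIV"
      using nsum by (simp only:) (intro norm_summable_imp_summable_on, simp)
  qed
  then have sum: "(\<lambda>(t, H). ?v ^ t) summable_on (SIGMA t:UNIV. ?S t)" by (rule Infinite_Sum.abs_summable_summable)
  have eq: "zeta_term \<Gamma> s (snd x) = (\<lambda>(t, H). ?v ^ t) x" if "x \<in> (SIGMA t:UNIV. ?S t)" for x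
    using that zt by auto
  have "(\<lambda>x. zeta_term \<Gamma> s (snd x)) summable_on (SIGMA t:UNIV. ?S t)"
    using sum by (subst summable_on_cong[OF eq])
  then show "zeta_term \<Gamma> s summable_on p_index_subgroups \<Gamma> p"
    by (subst (asm) summable_on_reindex_bij_betw[OF bij])
  have "local_zeta \<Gamma> p s = (\<Sum>\<^sub>\<infinity>x\<in>(SIGMA t:UNIV. ?S t). zeta_term \<Gamma> s (snd x))"
    unfolding local_zeta_def by (rule infsum_reindex_bij_betw[OF bij, symmetric])
  also have "\<dots> = (\<Sum>\<^sub>\<infinity>x\<in>(SIGMA t:UNIV. ?S t). (\<lambda>(t, H). ?v ^ t) x)" by (rule infsum_cong[OF eq])
  also have "\<dots> = (\<Sum>\<^sub>\<infinity>t\<in>UNIV. \<Sum>\<^sub>\<infinity>H\<in>?S t. ?v ^ t)"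
    using infsum_Sigma'_banach[of "\<lambda>t H. ?v ^ t", OF sum] by simp
  also have "\<dots> = (\<Sum>\<^sub>\<infinity>t\<in>UNIV. F $ t * ?v ^ t)"
  proof (rule infsum_cong)
    fix t
    have "(\<Sum>\<^sub>\<infinity>H\<in>?S t. ?v ^ t) = of_nat (card (?S t)) * ?v ^ t" using c by (subst infsum_finite) auto
    then show "(\<Sum>\<^sub>\<infinity>H\<in>?S t. ?v ^ t) = F $ t * ?v ^ t" using c[of t] by metis
  qed
  also have "\<dots> = eval_fps F ?v"
    using norm_summable_imp_has_sum[OF nsum sums_eval_fps[OF v]] by (rule infsumI)
  finally show "local_zeta \<Gamma> p s = eval_fps F ?v" .
qed

lemma has_value_unique: "has_value R u v w \<Longrightarrow> has_value R u v w' \<Longrightarrow> w = w'"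
  by (simp add: has_value_def)

text \<open>Each inequality in Q(U, V) is checked at one complex point: at (1, 1) for U and V being
  nonzero, and at U = 2, V = 0 for the others.\<close>

lemma generic_ratfun: "generic ratU d ratV"
proof -
  have nz: "R \<noteq> 0" if "has_value R (u::complex) v w" "w \<noteq> 0" for R u v w
    using has_value_unique[OF that(1)] has_value_0[of u v] that(2) by auto
  have n1: "R \<noteq> 1" if "has_value R (u::complex) v w" "w \<noteq> 1" for R u v w
    using has_value_unique[OF that(1)] has_value_1[of u v] that(2) by auto
  have "ratU \<noteq> 0" "ratV \<noteq> 0" using nz[OF has_value_ratU[of 1 1]] nz[OF has_value_ratV[of 1 1]] by simp_all
  moreover have "ratU ^ i \<noteq> 1" if "i > 0" for i
  proof -
    have "(2::complex) ^ i \<noteq> 1"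
    proof
      assume "(2::complex) ^ i = 1"
      then have "norm ((2::complex) ^ i) = 1" by simp
      then have "(2::real) ^ i = 1" by (simp add: norm_power)
      then show False using that one_less_power[of "2::real" i] by simp
    qed
    then show ?thesis using n1[OF has_value_power[OF has_value_ratU[of 2 0]]] by blast
  qed
  moreover have "ratU ^ a * ratV ^ b \<noteq> 1" if "b > 0" for a b :: nat
  proof -
    have "(2::complex) ^ a * 0 ^ b \<noteq> 1" using that by (simp add: zero_power)
    then show ?thesis
      by (rule n1[OF has_value_mult[OF has_value_power[OF has_value_ratU] has_value_power[OF has_value_ratV]]])
  qed
  ultimately show ?thesis by (auto simp: generic_def)
qed

lemma generic_complex:
  assumes p: "p > 1" and v: "v \<noteq> 0" "norm v < 1 / real p ^ (2 * (d + 1) ^ 2)"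
  shows "generic (of_nat p :: complex) d v"
  unfolding generic_def
proof (intro conjI allI impI)
  let ?N = "2 * (d + 1) ^ 2"
  have pN: "real p ^ ?N \<ge> 1" using p by (intro one_le_power) simp
  then have v1: "norm v < 1" using v(2) by (meson divide_le_eq_1 less_le_trans order_less_le_trans zero_less_one)
  show "(of_nat p :: complex) ^ i \<noteq> 1" if "i > 0" for i
  proof
    assume "(of_nat p :: complex) ^ i = 1"
    then have "p ^ i = 1" by (metis of_nat_1 of_nat_eq_iff of_nat_power)
    then show False using p that by simp
  qed
  fix a b :: nat assume ab: "a \<le> ?N \<and> 0 < b"
  have "norm ((of_nat p :: complex) ^ a * v ^ b) = real p ^ a * norm v ^ b" by (simp add: norm_mult norm_power)
  also have "\<dots> \<le> real p ^ ?N * norm v ^ 1"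
  proof (intro mult_mono)
    show "real p ^ a \<le> real p ^ ?N" using ab p by (intro power_increasing) auto
    show "norm v ^ b \<le> norm v ^ 1" using ab v1 by (intro power_decreasing) auto
  qed auto
  also have "\<dots> < 1"
  proof -
    have "real p ^ ?N > 0" using p by simp
    then show ?thesis using v(2) by (simp add: pos_less_divide_eq mult.commute)
  qed
  finally show "(of_nat p :: complex) ^ a * v ^ b \<noteq> 1" by auto
qed (use p v in auto)

lemma G_zeta_eq:
  assumes n: "n \<ge> 2" and p: "prime p"
  shows "\<exists>\<sigma>::real. \<forall>s. Re s > \<sigma> \<longrightarrow> zeta_term (G n) s summable_on p_index_subgroups (G n) p \<and>
    generic (of_nat p) (n - 1) (of_nat p powr (- s)) \<and>
    local_zeta (G n) p s = zeta_fun (of_nat p) (n - 1) (of_nat p powr (- s))"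
proof -
  interpret L: lattice_setting p "n - 1" "int_vecs (n - 1)"
    using p rank_mod_int_vecs[of p "n - 1"] prime_gt_0_nat by unfold_locales auto
  note p1 = L.p1
  let ?F = "L.zeta_fps"
  have exp: "fps_conv_radius ?F > 0" "eventually (\<lambda>z. eval_fps ?F z = zeta_fun (of_nat p) (n - 1) z) (nhds 0)"
    using L.zeta_fps_expansion by (auto simp: has_fps_expansion_def)
  obtain \<epsilon> where \<epsilon>: "\<epsilon> > 0" "\<And>z. norm z < \<epsilon> \<Longrightarrow> eval_fps ?F z = zeta_fun (of_nat p) (n - 1) z"
    using exp(2) unfolding eventually_nhds_metric by (auto simp: dist_norm)
  obtain r where r: "0 < ereal r" "ereal r < fps_conv_radius ?F" using ereal_dense2[OF exp(1)] by auto
  \<comment> \<open>p^(-s) has to lie in three discs: where the series converges, where its sum is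
    \<open>zeta_fun\<close>, and where \<open>generic\<close> holds. The abscissa is the real s with
    p^(-s) = \<rho>.\<close>
  define \<rho> where "\<rho> = min (min \<epsilon> r) (1 / real p ^ (2 * (n - 1 + 1) ^ 2))"
  have \<rho>: "\<rho> > 0" using \<epsilon>(1) r(1) p1 by (simp add: \<rho>_def)
  show ?thesis
  proof (intro exI[of _ "- log p \<rho>"] allI impI)
    fix s assume s: "Re s > - log p \<rho>"
    let ?v = "of_nat p powr (- s) :: complex"
    have "norm ?v = real p powr (- Re s)" using p1 by (simp add: norm_powr_real_powr)
    also have "\<dots> < real p powr (log p \<rho>)" using s p1 by (intro powr_less_mono) auto
    also have "\<dots> = \<rho>" using p1 \<rho> by (intro powr_log_cancel) auto
    finally have v: "norm ?v < \<epsilon>" "norm ?v < r" "norm ?v < 1 / real p ^ (2 * (n - 1 + 1) ^ 2)"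
      by (simp_all add: \<rho>_def)
    have "ereal (norm ?v) < fps_conv_radius ?F" using v(2) r(2) by (metis less_ereal.simps(1) less_trans)
    note hs = has_sum_zeta_term[OF p card_G_subgroups[OF n p] this]
    have "?v \<noteq> 0" using p1 by simp
    then have "generic (of_nat p) (n - 1) ?v" using v(3) by (intro generic_complex p1)
    then show "zeta_term (G n) s summable_on p_index_subgroups (G n) p \<and>
        generic (of_nat p) (n - 1) ?v \<and> local_zeta (G n) p s = zeta_fun (of_nat p) (n - 1) ?v"
      using hs \<epsilon>(2)[OF v(1)] by simp
  qed
qed

lemma is_zeta_ratfun_zeta_fun:
  assumes n: "n \<ge> 2"
  shows "is_zeta_ratfun (G n) (zeta_fun ratU (n - 1) ratV)"
  unfolding is_zeta_ratfun_def
proof (intro allI impI)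
  fix p :: nat assume p: "prime p"
  obtain \<sigma> :: real where \<sigma>: "\<And>s. Re s > \<sigma> \<Longrightarrow> zeta_term (G n) s summable_on p_index_subgroups (G n) p \<and>
    generic (of_nat p) (n - 1) (of_nat p powr (- s)) \<and>
    local_zeta (G n) p s = zeta_fun (of_nat p) (n - 1) (of_nat p powr (- s))"
    using G_zeta_eq[OF n p] by blast
  show "\<exists>\<sigma>::real. \<forall>s. \<sigma> < Re s \<longrightarrow> zeta_term (G n) s summable_on p_index_subgroups (G n) p \<and>
        ratfun_regular (zeta_fun ratU (n - 1) ratV) (of_nat p) (of_nat p powr (- s)) \<and>
        local_zeta (G n) p s = ratfun_eval (zeta_fun ratU (n - 1) ratV) (of_nat p) (of_nat p powr (- s))"
  proof (intro exI[of _ \<sigma>] allI impI)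
    fix s assume s: "\<sigma> < Re s"
    have "has_value (zeta_fun ratU (n - 1) ratV) (of_nat p) (of_nat p powr (- s))
        (zeta_fun (of_nat p) (n - 1) (of_nat p powr (- s) :: complex))"
      using \<sigma>[OF s] by (intro has_value_zeta_fun has_value_ratU has_value_ratV) auto
    then show "zeta_term (G n) s summable_on p_index_subgroups (G n) p \<and>
        ratfun_regular (zeta_fun ratU (n - 1) ratV) (of_nat p) (of_nat p powr (- s)) \<and>
        local_zeta (G n) p s = ratfun_eval (zeta_fun ratU (n - 1) ratV) (of_nat p) (of_nat p powr (- s))"
      using \<sigma>[OF s] by (simp add: has_value_def)
  qed
qed

text \<open>The functional equation appears formally, with U for p and V for p^(-s), and again
  numerically. In the numerical form the left-hand side is the value of the rational function at
  (p^(-1), p^s), not a sum over subgroups.\<close>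

theorem corollary1:
  fixes n :: nat
  assumes "n \<ge> 2"
  shows "(\<exists>!R. is_zeta_ratfun (G n) R) \<and>
    ratfun_eval (zeta_ratfun (G n)) (inverse ratU) (inverse ratV) =
      - (ratU ^ ((2 * n - 1) choose 2) * ratV ^ (2 * n - 1)) * zeta_ratfun (G n) \<and>
    (\<forall>p. prime p \<longrightarrow> (\<exists>\<sigma>::real. \<forall>s. Re s > \<sigma> \<longrightarrow>
      ratfun_regular (zeta_ratfun (G n)) (inverse (of_nat p)) (of_nat p powr s) \<and>
      ratfun_eval (zeta_ratfun (G n)) (inverse (of_nat p)) (of_nat p powr s) =
        - (of_nat p powr (of_nat ((2 * n - 1) choose 2) - of_nat (2 * n - 1) * s))
          * local_zeta (G n) p s))"
proof (intro conjI allI impI)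
  let ?R = "zeta_fun ratU (n - 1) ratV"
  have isz: "is_zeta_ratfun (G n) ?R" by (rule is_zeta_ratfun_zeta_fun[OF assms])
  then show "\<exists>!R. is_zeta_ratfun (G n) R" using is_zeta_ratfun_unique by blast
  have R: "zeta_ratfun (G n) = ?R"
    unfolding zeta_ratfun_def using isz is_zeta_ratfun_unique by (intro the_equality) blast+
  have d: "2 * (n - 1) + 1 = 2 * n - 1" using assms by simp
  \<comment> \<open>Formal substitution is evaluation with target field \<open>ratfun\<close>, so
    the evaluation lemma applies and the algebraic functional equation is used in Q(U, V)
    itself.\<close>
  have hv: "has_value ?R (inverse ratU) (inverse ratV) (zeta_fun (inverse ratU) (n - 1) (inverse ratV))"
    by (intro has_value_zeta_fun has_value_ratU has_value_ratV generic_inverse generic_ratfun)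
  show "ratfun_eval (zeta_ratfun (G n)) (inverse ratU) (inverse ratV) =
      - (ratU ^ ((2 * n - 1) choose 2) * ratV ^ (2 * n - 1)) * zeta_ratfun (G n)"
    using hv unfolding R has_value_def zeta_fun_inverse[OF generic_ratfun] d by blast
  fix p :: nat assume p: "prime p"
  have p0: "(of_nat p :: complex) \<noteq> 0" using prime_gt_0_nat[OF p] by simp
  obtain \<sigma> :: real where \<sigma>: "\<And>s. Re s > \<sigma> \<Longrightarrow> zeta_term (G n) s summable_on p_index_subgroups (G n) p \<and>
    generic (of_nat p) (n - 1) (of_nat p powr (- s)) \<and>
    local_zeta (G n) p s = zeta_fun (of_nat p) (n - 1) (of_nat p powr (- s))"
    using G_zeta_eq[OF assms p] by blast
  show "\<exists>\<sigma>::real. \<forall>s. Re s > \<sigma> \<longrightarrow>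
      ratfun_regular (zeta_ratfun (G n)) (inverse (of_nat p)) (of_nat p powr s) \<and>
      ratfun_eval (zeta_ratfun (G n)) (inverse (of_nat p)) (of_nat p powr s) =
        - (of_nat p powr (of_nat ((2 * n - 1) choose 2) - of_nat (2 * n - 1) * s))
          * local_zeta (G n) p s"
  proof (intro exI[of _ \<sigma>] allI impI)
    fix s assume s: "\<sigma> < Re s"
    let ?v = "of_nat p powr (- s) :: complex"
    have g: "generic (of_nat p) (n - 1) ?v" and z: "local_zeta (G n) p s = zeta_fun (of_nat p) (n - 1) ?v"
      using \<sigma>[OF s] by auto
    have iv: "inverse ?v = of_nat p powr s" by (simp add: powr_minus)
    have "has_value ?R (inverse (of_nat p)) (of_nat p powr s)
        (zeta_fun (inverse (of_nat p)) (n - 1) (inverse ?v))"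
      unfolding iv[symmetric] by (intro has_value_zeta_fun has_value_ratU has_value_ratV generic_inverse g)
    moreover have "zeta_fun (inverse (of_nat p)) (n - 1) (inverse ?v) =
        - (of_nat p ^ ((2 * n - 1) choose 2) * ?v ^ (2 * n - 1)) * local_zeta (G n) p s"
      using zeta_fun_inverse[OF g] unfolding z d .
    moreover have "of_nat p ^ ((2 * n - 1) choose 2) * ?v ^ (2 * n - 1) =
        of_nat p powr (of_nat ((2 * n - 1) choose 2) - of_nat (2 * n - 1) * s)"
    proof -
      have "?v ^ (2 * n - 1) = of_nat p powr (- (of_nat (2 * n - 1) * s))"
        using p0 by (simp add: powr_def exp_of_nat_mult[symmetric] mult_ac)
      moreover have "of_nat p powr of_nat ((2 * n - 1) choose 2) = (of_nat p :: complex) ^ ((2 * n - 1) choose 2)"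
        using p0 by (intro powr_nat') simp
      ultimately show ?thesis unfolding diff_conv_add_uminus powr_add by simp
    qed
    ultimately show "ratfun_regular (zeta_ratfun (G n)) (inverse (of_nat p)) (of_nat p powr s) \<and>
      ratfun_eval (zeta_ratfun (G n)) (inverse (of_nat p)) (of_nat p powr s) =
        - (of_nat p powr (of_nat ((2 * n - 1) choose 2) - of_nat (2 * n - 1) * s))
          * local_zeta (G n) p s"
      unfolding R has_value_def by simp
  qed
qed

end
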